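(* Let $L>0$, $h^*>0$, $g>0$, $\mu>0$, $\sigma>0$ and $\bar\kappa\ge 0$ be constants, let $c=\sqrt{gh^*}$, and let $\bar S=\{\varphi\in H^2(0,L):\varphi'(0)=\varphi'(L)=0\}$. For every $\varphi_0\in \bar S\cap H^4(0,L)$, every $p_0\in\bar S$ and every $f\in C^3(\mathbb{R}_+)$ with $\varphi_0'''(0)=\varphi_0'''(L)=-\sigma^{-1}f(0)$, there exists a unique function $$\varphi\in C^0(\mathbb{R}_+;\bar S\cap H^4(0,L))\cap C^1(\mathbb{R}_+;\bar S)\cap C^2(\mathbb{R}_+;L^2(0,L))$$ with $\varphi[0]=\varphi_0$, $\varphi_t[0]=p_0$, that satisfies for all $t\ge 0$: $$\varphi_{tt}=c^2\varphi_{xx}-\sigma h^*\varphi_{xxxx}+\mu\varphi_{txx}-\bar\kappa\varphi_t \ \text{ on } (0,L),$$ $$\varphi_x(t,0)=\varphi_x(t,L)=0,\qquad \varphi_{xxx}(t,0)=\varphi_{xxx}(t,L)=-\sigma^{-1}f(t).$$ Moreover, if $\int_0^L\varphi_0(x)\,dx=\int_0^L p_0(x)\,dx=0$, then $\int_0^L\varphi(t,x)\,dx=\int_0^L\varphi_t(t,x)\,dx=0$ for all $t\ge 0$.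
   Context: $\mathbb{R}_+=[0,+\infty)$. For a function $\varphi$ of $(t,x)$, $\varphi[t]$ denotes the profile $x\mapsto\varphi(t,x)$. For a normed space $Y$, $C^k(\mathbb{R}_+;Y)$ denotes $k$-times continuously differentiable maps $\mathbb{R}_+\to Y$; time derivatives $\varphi_t,\varphi_{tt}$ (and mixed derivatives such as $\varphi_{txx}$) are understood as derivatives of the maps $t\mapsto\varphi[t]$ (resp. $t\mapsto\varphi_{xx}[t]$) in the corresponding function spaces; $x$-derivatives are (weak) spatial derivatives. $H^k(0,L)$ is the Sobolev space of $L^2(0,L)$ functions with weak derivatives up to order $k$ in $L^2(0,L)$. *)

theory Defs
  imports "HOL-Analysis.Analysis"
begin

type_synonym rfun = "real \<Rightarrow> real"

abbreviation Iv :: "real \<Rightarrow> real measure" where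
  "Iv L \<equiv> lebesgue_on {0<..<L}"

definition L2 :: "real \<Rightarrow> rfun \<Rightarrow> bool" where
  "L2 L f \<longleftrightarrow> f \<in> borel_measurable (Iv L) \<and> integrable (Iv L) (\<lambda>x. (f x)^2)"

definition L2norm :: "real \<Rightarrow> rfun \<Rightarrow> real" where
  "L2norm L f = sqrt (\<integral>x. (f x)^2 \<partial>Iv L)"

definition test_fn :: "real \<Rightarrow> rfun \<Rightarrow> bool" where
  "test_fn L \<psi> \<longleftrightarrow> (\<forall>n x. ((deriv ^^ n) \<psi>) differentiable (at x))
      \<and> (\<exists>a b. 0 < a \<and> a \<le> b \<and> b < L \<and> (\<forall>x. x \<notin> {a..b} \<longrightarrow> \<psi> x = 0))"

definition weak_deriv :: "real \<Rightarrow> rfun \<Rightarrow> rfun \<Rightarrow> bool" where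
  "weak_deriv L f g \<longleftrightarrow>
     set_integrable lebesgue {0<..<L} f \<and> set_integrable lebesgue {0<..<L} g \<and>
     (\<forall>\<psi>. test_fn L \<psi> \<longrightarrow>
        (\<integral>x. f x * deriv \<psi> x \<partial>Iv L) = - (\<integral>x. g x * \<psi> x \<partial>Iv L))"

definition Hk :: "real \<Rightarrow> nat \<Rightarrow> rfun \<Rightarrow> bool" where
  "Hk L k f \<longleftrightarrow> (\<exists>D. D 0 = f \<and> (\<forall>j\<le>k. L2 L (D j)) \<and>
                     (\<forall>j<k. weak_deriv L (D j) (D (Suc j))))"

text \<open>A chosen representative of the (a.e. unique) weak L2 derivative.\<close>
definition wderiv :: "real \<Rightarrow> rfun \<Rightarrow> rfun" where
  "wderiv L f = (SOME g. L2 L g \<and> weak_deriv L f g)"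

definition dx :: "real \<Rightarrow> nat \<Rightarrow> rfun \<Rightarrow> rfun" where
  "dx L n f = (wderiv L ^^ n) f"

definition Hnorm :: "real \<Rightarrow> nat \<Rightarrow> rfun \<Rightarrow> real" where
  "Hnorm L k f = sqrt (\<Sum>j\<le>k. (L2norm L (dx L j f))^2)"

definition bval :: "real \<Rightarrow> rfun \<Rightarrow> real \<Rightarrow> real" where
  "bval L g x = (THE v. \<exists>h. continuous_on {0..L} h \<and>
                   (AE y in Iv L. h y = g y) \<and> h x = v)"

definition Sbar :: "real \<Rightarrow> rfun \<Rightarrow> bool" where
  "Sbar L f \<longleftrightarrow> Hk L 2 f \<and> bval L (dx L 1 f) 0 = 0 \<and> bval L (dx L 1 f) L = 0"

definition cont_path :: "(rfun \<Rightarrow> real) \<Rightarrow> (real \<Rightarrow> rfun) \<Rightarrow> bool" where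
  "cont_path N u \<longleftrightarrow> (\<forall>t0\<ge>0. ((\<lambda>t. N (\<lambda>x. u t x - u t0 x)) \<longlongrightarrow> 0) (at t0 within {0..}))"

definition deriv_path :: "(rfun \<Rightarrow> real) \<Rightarrow> (real \<Rightarrow> rfun) \<Rightarrow> (real \<Rightarrow> rfun) \<Rightarrow> bool" where
  "deriv_path N u v \<longleftrightarrow> (\<forall>t0\<ge>0.
      ((\<lambda>t. N (\<lambda>x. (u t x - u t0 x) / (t - t0) - v t0 x)) \<longlongrightarrow> 0) (at t0 within {0..}))"

definition C3_Rplus :: "rfun \<Rightarrow> bool" where
  "C3_Rplus f \<longleftrightarrow> (\<exists>f1 f2 f3. \<forall>t\<ge>0.
      (f has_real_derivative f1 t) (at t within {0..}) \<and>
      (f1 has_real_derivative f2 t) (at t within {0..}) \<and>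
      (f2 has_real_derivative f3 t) (at t within {0..}) \<and>
      continuous (at t within {0..}) f3)"

definition is_solution ::
  "real \<Rightarrow> real \<Rightarrow> real \<Rightarrow> real \<Rightarrow> real \<Rightarrow> real \<Rightarrow> rfun \<Rightarrow> rfun \<Rightarrow> rfun
   \<Rightarrow> (real \<Rightarrow> rfun) \<Rightarrow> (real \<Rightarrow> rfun) \<Rightarrow> bool" where
  "is_solution L hs g mu sig kappa f phi0 p0 phi phit \<longleftrightarrow>
     (\<forall>t\<ge>0. Sbar L (phi t) \<and> Hk L 4 (phi t)) \<and> cont_path (Hnorm L 4) phi \<and>
     (\<forall>t\<ge>0. Sbar L (phit t)) \<and> deriv_path (Hnorm L 2) phi phit \<and> cont_path (Hnorm L 2) phit \<and>
     (\<exists>phitt. (\<forall>t\<ge>0. L2 L (phitt t)) \<and> deriv_path (L2norm L) phit phitt \<and>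
              cont_path (L2norm L) phitt \<and>
        (\<forall>t\<ge>0. AE x in Iv L.
            phitt t x = (sqrt (g * hs))^2 * dx L 2 (phi t) x - sig * hs * dx L 4 (phi t) x
                        + mu * dx L 2 (phit t) x - kappa * phit t x)) \<and>
     (AE x in Iv L. phi 0 x = phi0 x) \<and> (AE x in Iv L. phit 0 x = p0 x) \<and>
     (\<forall>t\<ge>0. bval L (dx L 1 (phi t)) 0 = 0 \<and> bval L (dx L 1 (phi t)) L = 0 \<and>
             bval L (dx L 3 (phi t)) 0 = - f t / sig \<and>
             bval L (dx L 3 (phi t)) L = - f t / sig)"

end

(*
  With k_n = n pi / L, the cosines cos(k_n x) diagonalise the problem: the coefficients of a solution
  satisfy y'' + (mu k_n^2 + kappa) y' + (c^2 k_n^2 + sigma h k_n^4) y = F_n, where the boundary values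
  enter only through F_n. Energy estimates for these scalar equations give uniqueness, and n = 0 gives
  conservation of the zero mean. For existence, f(t) w(x) with a fixed cubic w carries the boundary
  values; the remainder has homogeneous boundary data, and the energy of y' bounds its coefficients,
  uniformly on compact time intervals, by summable sequences in the weights of H^4, H^2 and L^2.
  Dominated convergence of series then yields the required regularity in time.
*)

theory Submission
  imports Defs "HOL-Computational_Algebra.Polynomial"
begin

subsection \<open>Functions on a bounded interval\<close>

text \<open>The energy of \<open>y\<close> itself would give \<open>y\<close> only the weight k^4,
  that is H^2. The energy of \<open>y'\<close> bounds \<open>y''\<close> without weight and
  \<open>y'\<close> with weight k^4; the equation, solved for the stiffness term, then yields the
  weight k^8 of H^4. The price is a time derivative of the forcing: inserting f w leaves a residual
  that contains f'', so f''' must be bounded on compact intervals. At time 0 this energy contains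
  y''(0), whose square-summability rests on that of k^4 y(0); there the compatibility of
  \<open>phi0\<close> with f(0) enters. Spatial derivatives are chosen representatives, fixed only
  almost everywhere. Statements about them are therefore reduced to coefficients, and completeness
  of the cosines leads back to equality almost everywhere. Coefficients decaying as H^4 requires
  force the first and third derivatives to vanish at both ends, which is why the lift stays outside
  the series.\<close>

lemma le_one_plus_square: "x \<le> 1 + (x::real)^2"
proof -
  have "0 \<le> (x - 1 / 2)^2" by simp
  then show ?thesis by (simp add: power2_eq_square algebra_simps)
qed

locale bounded_interval =
  fixes L :: real
  assumes L_pos: "0 < L"
begin

lemma finite_Iv [simp]: "finite_measure (Iv L)"
  by (rule finite_measure_lebesgue_on) simp

lemma sigma_finite_Iv: "sigma_finite_measure (Iv L)"
  using finite_Iv by (simp add: finite_measure_def)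

lemma measure_Iv [simp]: "measure (Iv L) {0<..<L} = L"
  using L_pos by (simp add: measure_restrict_space)

lemma integrable_const_Iv [simp]: "integrable (Iv L) (\<lambda>x. c::real)"
  by (rule finite_measure.integrable_const[OF finite_Iv])

lemma set_integrable_iff: "set_integrable lebesgue {0<..<L} f \<longleftrightarrow> integrable (Iv L) (f::real\<Rightarrow>real)"
  by (simp add: set_integrable_def integrable_restrict_space)

lemma measurable_continuous_Iv:
  assumes "continuous_on {0..L} (f::real\<Rightarrow>real)"
  shows "f \<in> borel_measurable (Iv L)"
  by (rule continuous_imp_measurable_on_sets_lebesgue)
     (use assms in \<open>auto intro: continuous_on_subset\<close>)

lemma measurable_bounded_Iv:
  assumes "f \<in> borel_measurable (Iv L)" "\<And>x. 0 < x \<Longrightarrow> x < L \<Longrightarrow> \<bar>f x\<bar> \<le> (B::real)"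
  shows "integrable (Iv L) f"
  by (rule finite_measure.integrable_const_bound[OF finite_Iv, of _ B])
     (use assms in \<open>auto intro!: AE_I2\<close>)

lemma continuous_bounded_Iv:
  assumes "continuous_on {0..L} (f::real\<Rightarrow>real)"
  obtains B where "0 \<le> B" "\<And>x. 0 \<le> x \<Longrightarrow> x \<le> L \<Longrightarrow> \<bar>f x\<bar> \<le> B"
proof -
  have "bounded (f ` {0..L})" using assms by (intro compact_imp_bounded compact_continuous_image) auto
  then obtain B where B: "\<And>x. x \<in> {0..L} \<Longrightarrow> norm (f x) \<le> B" unfolding bounded_iff by blast
  show ?thesis
  proof (rule that[of "\<bar>B\<bar>"])
    show "\<bar>f x\<bar> \<le> \<bar>B\<bar>" if "0 \<le> x" "x \<le> L" for x using B[of x] that by simp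
  qed simp
qed

lemma integrable_continuous_Iv:
  assumes "continuous_on {0..L} (f::real\<Rightarrow>real)"
  shows "integrable (Iv L) f"
proof -
  obtain B where "\<And>x. 0 \<le> x \<Longrightarrow> x \<le> L \<Longrightarrow> \<bar>f x\<bar> \<le> B" using continuous_bounded_Iv[OF assms] by blast
  then show ?thesis by (intro measurable_bounded_Iv[OF measurable_continuous_Iv[OF assms], of B]) auto
qed

lemma integrable_mult_bounded:
  assumes g: "integrable (Iv L) g" and m: "f \<in> borel_measurable (Iv L)"
    and B: "\<And>x. 0 < x \<Longrightarrow> x < L \<Longrightarrow> \<bar>f x\<bar> \<le> (B::real)"
  shows "integrable (Iv L) (\<lambda>x. g x * f x :: real)"
proof (rule Bochner_Integration.integrable_bound[where f="\<lambda>x. B * g x"])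
  show "integrable (Iv L) (\<lambda>x. B * g x)" using g by simp
  show "(\<lambda>x. g x * f x) \<in> borel_measurable (Iv L)" using g m by measurable
  show "AE x in Iv L. norm (g x * f x) \<le> norm (B * g x)"
  proof (rule AE_I2)
    fix x assume "x \<in> space (Iv L)"
    then have "\<bar>f x\<bar> \<le> \<bar>B\<bar>" using B[of x] by auto
    then show "norm (g x * f x) \<le> norm (B * g x)" by (simp add: abs_mult mult.commute mult_right_mono)
  qed
qed

lemma integrable_mult_continuous:
  assumes g: "integrable (Iv L) g" and f: "continuous_on {0..L} (f::real\<Rightarrow>real)"
  shows "integrable (Iv L) (\<lambda>x. g x * f x)"
proof -
  obtain B where "\<And>x. 0 \<le> x \<Longrightarrow> x \<le> L \<Longrightarrow> \<bar>f x\<bar> \<le> B" using continuous_bounded_Iv[OF f] by blast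
  then show ?thesis by (intro integrable_mult_bounded[OF g measurable_continuous_Iv[OF f], of B]) auto
qed

lemma L2_mult_integrable:
  assumes "L2 L f" "L2 L g"
  shows "integrable (Iv L) (\<lambda>x. f x * g x)"
proof (rule Bochner_Integration.integrable_bound[where f="\<lambda>x. (f x)^2 + (g x)^2"])
  show "integrable (Iv L) (\<lambda>x. (f x)^2 + (g x)^2)" using assms by (simp add: L2_def)
  show "(\<lambda>x. f x * g x) \<in> borel_measurable (Iv L)" using assms by (auto simp: L2_def)
  have "\<bar>a * b\<bar> \<le> a^2+b^2" for a b :: real
  proof -
    have "2 * \<bar>a * b\<bar> \<le> a^2+b^2" using sum_squares_bound[of "\<bar>a\<bar>" "\<bar>b\<bar>"] by (simp add: abs_mult mult.assoc)
    then show ?thesis by linarith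
  qed
  then show "AE x in Iv L. norm (f x * g x) \<le> norm ((f x)^2 + (g x)^2)"
    by (auto intro!: AE_I2)
qed

lemma L2_continuous: "continuous_on {0..L} f \<Longrightarrow> L2 L f"
  unfolding L2_def by (auto intro!: measurable_continuous_Iv integrable_continuous_Iv continuous_intros)

lemma L2_integrable: "L2 L f \<Longrightarrow> integrable (Iv L) f"
  using L2_mult_integrable[of f "\<lambda>x. 1"] L2_continuous[of "\<lambda>x. 1"] by simp

lemma L2_add [intro]: "L2 L f \<Longrightarrow> L2 L g \<Longrightarrow> L2 L (\<lambda>x. f x + g x)"
  using L2_mult_integrable[of f g] unfolding L2_def
  by (auto simp: power2_sum mult.assoc)

lemma L2_cmult [intro]: "L2 L f \<Longrightarrow> L2 L (\<lambda>x. c * f x)"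
  unfolding L2_def by (auto simp: power_mult_distrib)

lemma L2_diff [intro]: "L2 L f \<Longrightarrow> L2 L g \<Longrightarrow> L2 L (\<lambda>x. f x - g x)"
  using L2_add[of f "\<lambda>x. (-1) * g x"] L2_cmult[of g "-1"] by simp

lemma L2_divide [intro]: "L2 L f \<Longrightarrow> L2 L (\<lambda>x. f x / c)"
  using L2_cmult[of f "1/c"] by simp

lemma L2_abs [intro]: "L2 L f \<Longrightarrow> L2 L (\<lambda>x. \<bar>f x\<bar>)"
  unfolding L2_def by auto

text \<open>Lebesgue measure is complete, so changing a function on a null set keeps it measurable;
  extension by zero transfers this from the line to the interval. It is needed because weak
  derivatives are known only almost everywhere.\<close>

lemma measurable_cong_AE_Iv:
  assumes "f \<in> borel_measurable (Iv L)" "AE x in Iv L. f x = (g x :: real)"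
  shows "g \<in> borel_measurable (Iv L)"
proof -
  have "(\<lambda>x. if x \<in> {0<..<L} then f x else 0) \<in> borel_measurable lebesgue"
    using assms(1) by (subst borel_measurable_if) auto
  moreover have "AE x in lebesgue. (if x \<in> {0<..<L} then f x else 0) = (if x \<in> {0<..<L} then g x else 0)"
    using assms(2) by (subst (asm) AE_restrict_space_iff) auto
  ultimately have "(\<lambda>x. if x \<in> {0<..<L} then g x else 0) \<in> borel_measurable lebesgue"
    by (rule borel_measurable_AE)
  then show ?thesis by (subst (asm) borel_measurable_if) auto
qed

lemma L2norm_nonneg [simp]: "0 \<le> L2norm L f"
  by (simp add: L2norm_def)

lemma L2norm_sq: "(L2norm L f)^2 = (\<integral>x. (f x)^2 \<partial>Iv L)"
  by (simp add: L2norm_def)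

lemma L2norm_cong_AE:
  assumes "AE x in Iv L. f x = g x" "L2 L f" "L2 L g"
  shows "L2norm L f = L2norm L g"
  unfolding L2norm_def using assms by (subst integral_cong_AE[of _ _ "\<lambda>x. (g x)^2"]) (auto simp: L2_def)

section \<open>Primitives and integration by parts\<close>

lemma integral_Iv_eq:
  assumes "integrable (Iv L) (f::real\<Rightarrow>real)"
  shows "(\<integral>x. f x \<partial>Iv L) = integral {0..L} f"
  using lebesgue_integral_eq_integral[OF assms] integral_open_interval_real[of 0 L f] by simp

lemma FTC_Iv:
  assumes "\<And>x. (F has_real_derivative f x) (at x)" "continuous_on {0..L} f"
  shows "(\<integral>x. f x \<partial>Iv L) = F L - F 0"
proof -
  have "(f has_integral (F L - F 0)) {0..L}"
    using assms(1) L_pos by (intro fundamental_theorem_of_calculus)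
      (auto simp: has_real_derivative_iff_has_vector_derivative[symmetric] intro: has_field_derivative_at_within)
  then show ?thesis using integral_Iv_eq[OF integrable_continuous_Iv[OF assms(2)]] by (simp add: integral_unique)
qed

text \<open>The cutoff sits in the integrand rather than in the domain, so that the integrand is
  jointly measurable in \<open>s\<close> and \<open>x\<close> and Fubini's theorem applies.\<close>

definition prim :: "(real \<Rightarrow> real) \<Rightarrow> real \<Rightarrow> real" where
  "prim g x = (\<integral>s. (if s < x then g s else 0) \<partial>Iv L)"

lemma integrable_cut:
  assumes "integrable (Iv L) (g::real\<Rightarrow>real)"
  shows "integrable (Iv L) (\<lambda>s. if s < x then g s else 0)"
proof -
  have [measurable]: "(\<lambda>s. s) \<in> borel_measurable (Iv L)" by (intro measurable_continuous_Iv continuous_intros)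
  note [measurable] = borel_measurable_integrable[OF assms]
  show ?thesis
    by (rule Bochner_Integration.integrable_bound[OF assms]) auto
qed

lemma FTC_cut:
  assumes "\<And>x. (F has_real_derivative f x) (at x)" "continuous_on UNIV f" "0 < s" "s < L"
  shows "(\<integral>x. (if s < x then f x else 0) \<partial>Iv L) = F L - F s"
proof -
  have i: "integrable (Iv L) f" using assms(2) by (intro integrable_continuous_Iv) (auto intro: continuous_on_subset)
  have [measurable]: "(\<lambda>s. s) \<in> borel_measurable (Iv L)" by (intro measurable_continuous_Iv continuous_intros)
  note [measurable] = borel_measurable_integrable[OF i]
  have i2: "integrable (Iv L) (\<lambda>x. if s < x then f x else 0)"
    by (rule Bochner_Integration.integrable_bound[OF i]) auto
  have "(f has_integral (F L - F s)) {s..L}"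
    using assms L_pos by (intro fundamental_theorem_of_calculus)
      (auto simp: has_real_derivative_iff_has_vector_derivative[symmetric] intro: has_field_derivative_at_within)
  then have "((\<lambda>x. if x \<in> {s..L} then f x else 0) has_integral (F L - F s)) {0..L}"
    by (subst has_integral_restrict) (use assms in auto)
  then have "((\<lambda>x. if s < x then f x else 0) has_integral (F L - F s)) {0..L}"
    by (rule has_integral_spike[of "{s}", rotated 2]) (use assms in auto)
  then show ?thesis using integral_Iv_eq[OF i2] by (simp add: integral_unique)
qed

lemma prim_bound:
  assumes "integrable (Iv L) g"
  shows "\<bar>prim g x\<bar> \<le> (\<integral>s. \<bar>g s\<bar> \<partial>Iv L)"
proof -
  have "\<bar>prim g x\<bar> \<le> (\<integral>s. \<bar>if s < x then g s else 0\<bar> \<partial>Iv L)"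
    unfolding prim_def by simp
  also have "\<dots> \<le> (\<integral>s. \<bar>g s\<bar> \<partial>Iv L)"
    by (rule integral_mono) (use assms integrable_cut[OF assms, of x] in auto)
  finally show ?thesis .
qed

lemma prim_0: "prim g 0 = 0"
  unfolding prim_def by (rule integral_eq_zero_AE) (auto intro!: AE_I2)

lemma prim_L: "prim g L = (\<integral>x. g x \<partial>Iv L)"
  unfolding prim_def by (rule Bochner_Integration.integral_cong) auto

lemma prim_eq_integral:
  assumes g: "integrable (Iv L) g" and x: "0 \<le> x" "x \<le> L"
  shows "prim g x = integral {0..x} g"
proof -
  have "prim g x = integral {0..L} (\<lambda>s. if s < x then g s else 0)"
    unfolding prim_def by (rule integral_Iv_eq[OF integrable_cut[OF g]])
  also have "\<dots> = integral {0..L} (\<lambda>s. if s \<in> {0..x} then g s else 0)"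
    by (rule integral_spike[of "{x}"]) auto
  also have "\<dots> = integral {0..x} g"
    using x by (subst Henstock_Kurzweil_Integration.integral_restrict_Int) (auto intro!: arg_cong2[where f=integral])
  finally show ?thesis .
qed

lemma integrable_on_Icc: "integrable (Iv L) (g::real\<Rightarrow>real) \<Longrightarrow> g integrable_on {0..L}"
  using integrable_on_lebesgue_on[of "{0<..<L}" g] by (simp add: integrable_on_open_interval_real)

lemma prim_continuous:
  assumes "integrable (Iv L) g"
  shows "continuous_on {0..L} (prim g)"
proof -
  have "continuous_on {0..L} (\<lambda>x. integral {0..x} g)"
    by (rule indefinite_integral_continuous_1[OF integrable_on_Icc[OF assms]])
  then show ?thesis
    by (rule continuous_on_eq) (use prim_eq_integral[OF assms] in auto)
qed

text \<open>Fubini on the triangle \<open>s < x\<close>. Since \<open>g\<close> is merely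
  integrable, \<open>prim g\<close> cannot be differentiated at every point; exchanging the order of
  integration moves the fundamental theorem onto the smooth factor.\<close>

lemma IBP_prim:
  assumes g: "integrable (Iv L) g"
    and d: "\<And>x. (\<eta> has_real_derivative \<eta>' x) (at x)" and c: "continuous_on UNIV \<eta>'"
  shows "(\<integral>x. prim g x * \<eta>' x \<partial>Iv L) = prim g L * \<eta> L - (\<integral>x. g x * \<eta> x \<partial>Iv L)"
proof -
  interpret pair_sigma_finite "Iv L" "Iv L"
    unfolding pair_sigma_finite_def using sigma_finite_Iv by blast
  have cL: "continuous_on {0..L} \<eta>'" using c continuous_on_subset by blast
  have cont_eta: "continuous_on {0..L} \<eta>"
    using d by (meson DERIV_isCont continuous_at_imp_continuous_on)
  have ie: "integrable (Iv L) \<eta>'" using cL by (rule integrable_continuous_Iv)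
  note [measurable] = borel_measurable_integrable[OF ie] borel_measurable_integrable[OF g]
  have [measurable]: "(\<lambda>s. s) \<in> borel_measurable (Iv L)" by (intro measurable_continuous_Iv continuous_intros)
  \<comment> \<open>Integrating this kernel in \<open>s\<close> produces
    \<open>prim g x * \<eta>' x\<close>; integrating it in \<open>x\<close> produces
    \<open>g s\<close> times an increment of \<open>\<eta>\<close>.\<close>
  define K where "K = (\<lambda>x s. if s < x then g s * \<eta>' x else 0)"
  have mK: "case_prod K \<in> borel_measurable (Iv L \<Otimes>\<^sub>M Iv L)" unfolding K_def by measurable
  have iK: "integrable (Iv L \<Otimes>\<^sub>M Iv L) (case_prod K)"
  proof (rule Fubini_integrable[OF mK])
    have *: "integrable (Iv L) (\<lambda>s. K x s)" for x
      using integrable_mult_right[OF integrable_cut[OF g], of "\<eta>' x" x]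
      by (rule back_subst[of "integrable (Iv L)"]) (auto simp: K_def)
    then show "AE x in Iv L. integrable (Iv L) (\<lambda>y. case_prod K (x, y))" by simp
    show "integrable (Iv L) (\<lambda>x. \<integral>y. norm (case_prod K (x, y)) \<partial>Iv L)"
    proof (rule Bochner_Integration.integrable_bound[where f="\<lambda>x. (\<integral>s. \<bar>g s\<bar> \<partial>Iv L) * \<eta>' x"])
      show "integrable (Iv L) (\<lambda>x. (\<integral>s. \<bar>g s\<bar> \<partial>Iv L) * \<eta>' x)" using ie by simp
      show "(\<lambda>x. \<integral>y. norm (case_prod K (x, y)) \<partial>Iv L) \<in> borel_measurable (Iv L)" 
        using mK by measurable
      show "AE x in Iv L. norm (\<integral>y. norm (case_prod K (x, y)) \<partial>Iv L) \<le> norm ((\<integral>s. \<bar>g s\<bar> \<partial>Iv L) * \<eta>' x)"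
      proof (rule AE_I2)
        fix x
        have "(\<integral>y. \<bar>K x y\<bar> \<partial>Iv L) \<le> (\<integral>y. \<bar>g y\<bar> * \<bar>\<eta>' x\<bar> \<partial>Iv L)"
          by (rule integral_mono) (use *[of x] g in \<open>auto simp: K_def abs_mult\<close>)
        then show "norm (\<integral>y. norm (case_prod K (x, y)) \<partial>Iv L) \<le> norm ((\<integral>s. \<bar>g s\<bar> \<partial>Iv L) * \<eta>' x)"
          by (simp add: abs_mult)
      qed
    qed
  qed
  have A: "(\<integral>s. K x s \<partial>Iv L) = prim g x * \<eta>' x" for x
  proof -
    have "(\<integral>s. K x s \<partial>Iv L) = (\<integral>s. (if s < x then g s else 0) * \<eta>' x \<partial>Iv L)"
      by (rule Bochner_Integration.integral_cong) (auto simp: K_def)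
    then show ?thesis by (simp add: prim_def)
  qed
  have B: "(\<integral>x. K x s \<partial>Iv L) = g s * \<eta> L - g s * \<eta> s" if "0 < s" "s < L" for s
  proof -
    have "(\<integral>x. K x s \<partial>Iv L) = (\<integral>x. g s * (if s < x then \<eta>' x else 0) \<partial>Iv L)"
      by (rule Bochner_Integration.integral_cong) (auto simp: K_def)
    also have "\<dots> = g s * (\<eta> L - \<eta> s)" using FTC_cut[OF d c that] by simp
    finally show ?thesis by (simp add: algebra_simps)
  qed
  have "(\<integral>x. prim g x * \<eta>' x \<partial>Iv L) = (\<integral>s. (\<integral>x. K x s \<partial>Iv L) \<partial>Iv L)"
    using Fubini_integral[OF iK] A by simp
  also have "\<dots> = (\<integral>s. g s * \<eta> L - g s * \<eta> s \<partial>Iv L)"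
    by (rule Bochner_Integration.integral_cong) (use B in auto)
  also have "\<dots> = (\<integral>s. g s \<partial>Iv L) * \<eta> L - (\<integral>s. g s * \<eta> s \<partial>Iv L)"
    using g integrable_mult_continuous[OF g cont_eta] by simp
  finally show ?thesis by (simp add: prim_L)
qed

end

subsection \<open>Bump functions and the fundamental lemma\<close>

text \<open>The classical function exp(-1/x) extended by zero, multiplied by a polynomial in 1/x.
  The polynomial parameter closes the family under differentiation.\<close>

definition flat :: "real poly \<Rightarrow> real \<Rightarrow> real" where
  "flat p x = (if x > 0 then poly p (1/x) * exp (-(1/x)) else 0)"

text \<open>With y = 1/x one has dy/dx = -y^2, so p(y) exp(-y) has derivative y^2 (p(y) - p'(y))
  exp(-y).\<close>

definition flat_deriv :: "real poly \<Rightarrow> real poly" where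
  "flat_deriv p = [:0,0,1:] * (p - pderiv p)"

lemma poly_times_exp_tendsto_0: "((\<lambda>y::real. poly p y * exp (- y)) \<longlongrightarrow> 0) at_top"
proof -
  have "((\<lambda>y. \<Sum>i\<le>degree p. coeff p i * (y ^ i / exp y)) \<longlongrightarrow> (\<Sum>i\<le>degree p. coeff p i * 0)) at_top"
    by (intro tendsto_intros tendsto_power_div_exp_0)
  moreover have "(\<Sum>i\<le>degree p. coeff p i * (y ^ i / exp y)) = poly p y * exp (- y)" for y
    by (simp add: poly_altdef sum_distrib_right exp_minus divide_simps)
  ultimately show ?thesis by simp
qed

lemma flat_has_deriv: "(flat p has_real_derivative flat (flat_deriv p) x) (at x)"
proof -
  consider "x > 0" | "x < 0" | "x = 0" by linarith
  then show ?thesis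
  proof cases
    case 1
    have "((\<lambda>x. poly p (1/x) * exp (-(1/x))) has_real_derivative
        (poly (pderiv p) (1/x) * (- 1 / x^2)) * exp (-(1/x)) + poly p (1/x) * (exp (-(1/x)) * (1/x^2))) (at x)"
      using 1 by (auto intro!: derivative_eq_intros DERIV_chain2[OF poly_DERIV] simp: power2_eq_square)
    then have "((\<lambda>x. poly p (1/x) * exp (-(1/x))) has_real_derivative flat (flat_deriv p) x) (at x)"
      by (rule back_subst[of "\<lambda>d. (_ has_real_derivative d) _"])
         (use 1 in \<open>simp add: flat_def flat_deriv_def power2_eq_square algebra_simps\<close>)
    then show ?thesis
      by (rule has_field_derivative_transform_within_open[of _ _ _ "{0<..}"]) (use 1 in \<open>auto simp: flat_def\<close>)
  next
    case 2
    have "((\<lambda>x. 0) has_real_derivative flat (flat_deriv p) x) (at x)"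
      using 2 by (simp add: flat_def)
    then show ?thesis
      by (rule has_field_derivative_transform_within_open[of _ _ _ "{..<0}"]) (use 2 in \<open>auto simp: flat_def\<close>)
  next
    case 3
    \<comment> \<open>Dividing by \<open>h\<close> multiplies the polynomial by its variable, so the
      difference quotient at 0 is again a polynomial in 1/h times exp(-1/h) and vanishes in the
      limit.\<close>
    have "((\<lambda>h. poly ([:0,1:] * p) (inverse h) * exp (- inverse h)) \<longlongrightarrow> 0) (at_right 0)"
      by (rule filterlim_compose[OF poly_times_exp_tendsto_0 filterlim_inverse_at_top_right])
    then have "((\<lambda>h. flat p h / h) \<longlongrightarrow> 0) (at_right 0)"
      by (rule Lim_transform_eventually)
         (auto simp: eventually_at_right_field flat_def divide_simps intro!: exI[of _ 1])
    moreover have "((\<lambda>h. flat p h / h) \<longlongrightarrow> 0) (at_left 0)"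
      by (rule Lim_transform_eventually[of "\<lambda>_. 0"])
         (auto simp: eventually_at_left_field flat_def intro!: exI[of _ "-1"])
    ultimately have "((\<lambda>h. flat p h / h) \<longlongrightarrow> 0) (at 0)"
      by (simp add: filterlim_split_at)
    then show ?thesis using 3 by (simp add: DERIV_def flat_def)
  qed
qed

text \<open>Spanned by products of two flat functions at opposite ends; closed under differentiation,
  hence consisting of smooth functions.\<close>

inductive_set bump_span :: "(real \<Rightarrow> real) set" where
  base: "(\<lambda>x. flat p (m * (x - a)) * flat q (m * (b - x))) \<in> bump_span"
| add: "f \<in> bump_span \<Longrightarrow> g \<in> bump_span \<Longrightarrow> (\<lambda>x. f x + g x) \<in> bump_span"

lemma flat_smult: "flat (smult c p) x = c * flat p x"
  by (simp add: flat_def)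

lemma bump_span_deriv:
  "f \<in> bump_span \<Longrightarrow> \<exists>f'\<in>bump_span. \<forall>x. (f has_real_derivative f' x) (at x)"
proof (induction rule: bump_span.induct)
  case (base p m a q b)
  have 1: "((\<lambda>x. flat p (m * (x - a))) has_real_derivative flat (flat_deriv p) (m * (x - a)) * m) (at x)" for x
    by (rule DERIV_chain2[OF flat_has_deriv]) (auto intro!: derivative_eq_intros)
  have 2: "((\<lambda>x. flat q (m * (b - x))) has_real_derivative flat (flat_deriv q) (m * (b - x)) * (- m)) (at x)" for x
    by (rule DERIV_chain2[OF flat_has_deriv]) (auto intro!: derivative_eq_intros)
  have 3: "((\<lambda>x. flat p (m * (x - a)) * flat q (m * (b - x))) has_real_derivative
     flat (smult m (flat_deriv p)) (m * (x - a)) * flat q (m * (b - x)) +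
     flat p (m * (x - a)) * flat (smult (-m) (flat_deriv q)) (m * (b - x))) (at x)" for x
    by (rule DERIV_cong[OF DERIV_mult[OF 1 2]]) (simp only: flat_smult algebra_simps)
  show ?case
    by (rule bexI[OF _ bump_span.add[OF bump_span.base bump_span.base]]) (use 3 in blast)
next
  case (add f g)
  then obtain f' g' where "f' \<in> bump_span" "g' \<in> bump_span"
    "\<forall>x. (f has_real_derivative f' x) (at x)" "\<forall>x. (g has_real_derivative g' x) (at x)" by blast
  then show ?case by (intro bexI[of _ "\<lambda>x. f' x + g' x"] allI DERIV_add bump_span.add) auto
qed

lemma bump_span_smooth:
  assumes "f \<in> bump_span"
  shows "((deriv ^^ n) f) \<in> bump_span"
proof (induction n)
  case 0 then show ?case using assms by simp
next
  case (Suc n)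
  obtain f' where "f' \<in> bump_span" "\<forall>x. ((deriv ^^ n) f has_real_derivative f' x) (at x)"
    using bump_span_deriv[OF Suc] by blast
  moreover from this have "deriv ((deriv ^^ n) f) = f'" by (auto intro!: DERIV_imp_deriv)
  ultimately show ?case by simp
qed

lemma bump_span_differentiable:
  "f \<in> bump_span \<Longrightarrow> ((deriv ^^ n) f) differentiable (at x)"
  using bump_span_deriv[OF bump_span_smooth, of f n] real_differentiable_def by blast

lemma bump_span_scale:
  "f \<in> bump_span \<Longrightarrow> (\<lambda>x. c * f x) \<in> bump_span"
proof (induction rule: bump_span.induct)
  case (base p m a q b)
  show ?case using bump_span.base[of "smult c p" m a q b] by (simp add: flat_smult mult.assoc)
next
  case (add f g)
  then show ?case using bump_span.add by (simp add: distrib_left)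
qed

text \<open>The factor \<open>Suc m\<close> stretches the argument: as \<open>m\<close> grows the
  exponents tend to 0 and the bumps approach the indicator of the open interval from
  \<open>a\<close> to \<open>b\<close>. The successor keeps the factor nonzero.\<close>

definition bump :: "nat \<Rightarrow> real \<Rightarrow> real \<Rightarrow> real \<Rightarrow> real" where
  "bump m a b x = flat 1 (real (Suc m) * (x - a)) * flat 1 (real (Suc m) * (b - x))"

lemma bump_in_span: "bump m a b \<in> bump_span"
  unfolding bump_def[abs_def] by (rule bump_span.base)

lemma bump_cases: "bump m a b x = (if a < x \<and> x < b then
    exp (-(1 / (real (Suc m) * (x - a)))) * exp (-(1 / (real (Suc m) * (b - x)))) else 0)"
  by (auto simp: bump_def flat_def zero_less_mult_iff)

lemma bump_nonneg: "0 \<le> bump m a b x" by (simp add: bump_cases)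

lemma bump_le_1: "bump m a b x \<le> 1"
  by (auto simp: bump_cases intro!: mult_le_one)

lemma bump_continuous: "continuous_on S (bump m a b)"
  using bump_span_deriv[OF bump_in_span]
  by (meson DERIV_isCont continuous_at_imp_continuous_on)

lemma test_fn_bump_span:
  assumes "f \<in> bump_span" "0 < a" "a \<le> b" "b < L" "\<And>x. x \<notin> {a..b} \<Longrightarrow> f x = 0"
  shows "test_fn L f"
  unfolding test_fn_def using bump_span_differentiable[OF assms(1)] assms(2-) by blast

lemma test_fn_bump: "0 < a \<Longrightarrow> a < b \<Longrightarrow> b < L \<Longrightarrow> test_fn L (bump m a b)"
  by (rule test_fn_bump_span[OF bump_in_span, of a b]) (auto simp: bump_cases)

lemma bump_tendsto:
  "(\<lambda>m. bump m a b x) \<longlonglongrightarrow> (if a < x \<and> x < b then 1 else 0)"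
proof (cases "a < x \<and> x < b")
  case True
  have *: "(\<lambda>m. exp (-(1 / (real (Suc m) * c)))) \<longlonglongrightarrow> exp (-0)" if "c > 0" for c
  proof (intro tendsto_intros)
    have "(\<lambda>m. inverse (real (Suc m)) * (1/c)) \<longlonglongrightarrow> 0 * (1/c)"
      by (intro tendsto_intros LIMSEQ_inverse_real_of_nat)
    then show "(\<lambda>m. 1 / (real (Suc m) * c)) \<longlonglongrightarrow> 0" by (simp add: divide_inverse)
  qed
  show ?thesis using tendsto_mult[OF *[of "x - a"] *[of "b - x"]] True by (simp add: bump_cases)
next
  case False
  then have "bump m a b x = 0" for m by (auto simp: bump_cases)
  then show ?thesis using False by auto
qed

context bounded_interval begin

lemma integral_bump_tendsto:
  assumes f: "integrable (Iv L) f"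
  shows "(\<lambda>m. \<integral>x. f x * bump m a b x \<partial>Iv L) \<longlonglongrightarrow> (\<integral>x. (if a < x \<and> x < b then f x else 0) \<partial>Iv L)"
proof (rule integral_dominated_convergence[where w="\<lambda>x. \<bar>f x\<bar>"])
  note [measurable] = borel_measurable_integrable[OF f]
  have [measurable]: "(\<lambda>s. s) \<in> borel_measurable (Iv L)" by (intro measurable_continuous_Iv continuous_intros)
  show "(\<lambda>x. if a < x \<and> x < b then f x else 0) \<in> borel_measurable (Iv L)" by measurable
  show "(\<lambda>x. f x * bump m a b x) \<in> borel_measurable (Iv L)" for m
    by (rule borel_measurable_times[OF borel_measurable_integrable[OF f] measurable_continuous_Iv[OF bump_continuous]])
  show "integrable (Iv L) (\<lambda>x. \<bar>f x\<bar>)" using f by simp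
  show "AE x in Iv L. (\<lambda>m. f x * bump m a b x) \<longlonglongrightarrow> (if a < x \<and> x < b then f x else 0)"
  proof (rule AE_I2)
    fix x show "(\<lambda>m. f x * bump m a b x) \<longlonglongrightarrow> (if a < x \<and> x < b then f x else 0)"
      using tendsto_mult[OF tendsto_const bump_tendsto, of "f x" a b x] by (cases "a < x \<and> x < b") auto
  qed
  show "AE x in Iv L. norm (f x * bump m a b x) \<le> \<bar>f x\<bar>" for m
    by (rule AE_I2) (auto simp: abs_mult bump_nonneg bump_le_1 intro!: mult_left_le)
qed

text \<open>Lebesgue differentiation: at almost every point the function is the limit of its
  averages over short intervals to the right, and all these averages vanish.\<close>

lemma AE_zero_if_integral_intervals_zero:
  assumes f: "integrable (Iv L) (f::real\<Rightarrow>real)"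
    and z: "\<And>a b. 0 < a \<Longrightarrow> a < b \<Longrightarrow> b < L \<Longrightarrow> (\<integral>x. (if a < x \<and> x < b then f x else 0) \<partial>Iv L) = 0"
  shows "AE x in Iv L. f x = 0"
proof -
  define F where "F = (\<lambda>x. if x \<in> {0<..<L} then f x else 0)"
  note [measurable] = borel_measurable_integrable[OF f]
  have [measurable]: "(\<lambda>s. s) \<in> borel_measurable (Iv L)" by (intro measurable_continuous_Iv continuous_intros)
  have iF: "f integrable_on {0<..<L}" by (rule integrable_on_lebesgue_on[OF f]) simp
  have int: "(f has_integral 0) {a..b}" if "0 < a" "a < b" "b < L" for a b
  proof -
    have i: "integrable (Iv L) (\<lambda>x. if a < x \<and> x < b then f x else 0)"
      by (rule Bochner_Integration.integrable_bound[OF f]) auto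
    have "((\<lambda>x. if a < x \<and> x < b then f x else 0) has_integral 0) {0<..<L}"
      using has_integral_integral_lebesgue_on[OF i] z[OF that] by simp
    then have "((\<lambda>x. if x \<in> {a<..<b} then f x else 0) has_integral 0) {0<..<L}" by simp
    then have "(f has_integral 0) {a<..<b}"
      by (subst (asm) has_integral_restrict) (use that in auto)
    then show ?thesis by (simp add: has_integral_Icc_iff_Ioo)
  qed
  have iab: "F integrable_on cbox a b" for a b
  proof -
    have "F integrable_on UNIV" unfolding F_def using iF by (simp only: integrable_restrict_UNIV)
    then show ?thesis by (rule integrable_on_subcbox) simp
  qed
  obtain N where N: "negligible N" "\<And>x e. \<lbrakk>x \<notin> N; 0 < e\<rbrakk> \<Longrightarrow>
         \<exists>d>0. \<forall>h. 0 < h \<and> h < d \<longrightarrow> norm(integral (cbox x (x + h *\<^sub>R One)) F /\<^sub>R h ^ DIM(real) - F x) < e"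
    using integrable_ccontinuous_explicit[of F, OF iab] by blast
  have zN: "f x = 0" if xx: "x \<notin> N" "0 < x" "x < L" for x
  proof (rule ccontr)
    assume "f x \<noteq> 0"
    then obtain d where d: "d > 0" "\<And>h. 0 < h \<Longrightarrow> h < d \<Longrightarrow> norm(integral (cbox x (x + h *\<^sub>R One)) F /\<^sub>R h ^ DIM(real) - F x) < \<bar>f x\<bar>"
      using N(2)[OF xx(1), of "\<bar>f x\<bar>"] by auto
    \<comment> \<open>Short enough for the differentiation estimate and for \<open>x + h\<close> to
      stay inside the interval.\<close>
    define h where "h = min (d/2) ((L - x)/2)"
    have h: "0 < h" "h < d" "x + h < L" using d xx by (auto simp: h_def min_def field_simps)
    have "integral {x..x+h} F = integral {x..x+h} f"
      by (rule integral_cong) (use h xx in \<open>auto simp: F_def\<close>)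
    also have "\<dots> = 0" using int[of x "x+h"] h xx by (simp add: integral_unique)
    finally show False using d(2)[OF h(1,2)] xx by (simp add: F_def)
  qed
  have "AE x in Iv L. x \<notin> N"
  proof -
    have "AE x in lebesgue. x \<notin> N" using N(1) by (simp add: AE_not_in negligible_iff_null_sets)
    then show ?thesis by (subst AE_restrict_space_iff) auto
  qed
  moreover have "AE x in Iv L. 0 < x \<and> x < L" by (rule AE_I2) simp
  ultimately show ?thesis by eventually_elim (use zN in auto)
qed

text \<open>Testing with bumps alone recovers the integral over every interior subinterval. This
  form serves both the uniqueness of weak derivatives and the completeness of the cosines.\<close>

lemma fundamental_lemma_bump:
  assumes f: "integrable (Iv L) f"
    and z: "\<And>m a b. 0 < a \<Longrightarrow> a < b \<Longrightarrow> b < L \<Longrightarrow> (\<integral>x. f x * bump m a b x \<partial>Iv L) = 0"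
  shows "AE x in Iv L. f x = 0"
proof (rule AE_zero_if_integral_intervals_zero[OF f])
  fix a b :: real assume ab: "0 < a" "a < b" "b < L"
  have "(\<lambda>m. 0) \<longlonglongrightarrow> (\<integral>x. (if a < x \<and> x < b then f x else 0) \<partial>Iv L)"
    using integral_bump_tendsto[OF f, of a b] z[OF ab] by simp
  then show "(\<integral>x. (if a < x \<and> x < b then f x else 0) \<partial>Iv L) = 0"
    using LIMSEQ_unique tendsto_const by metis
qed

end

subsection \<open>Weak derivatives and boundary values\<close>

lemma test_fn_DERIV: "test_fn L \<psi> \<Longrightarrow> (\<psi> has_real_derivative deriv \<psi> x) (at x)"
  unfolding test_fn_def by (metis DERIV_deriv_iff_real_differentiable funpow_0)

lemma test_fn_deriv_continuous: "test_fn L \<psi> \<Longrightarrow> continuous_on S (deriv \<psi>)"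
proof -
  assume "test_fn L \<psi>"
  then have "((deriv ^^ 1) \<psi>) differentiable (at x)" for x unfolding test_fn_def by blast
  then show ?thesis
    by (intro continuous_at_imp_continuous_on ballI differentiable_imp_continuous_within) simp
qed

lemma test_fn_continuous: "test_fn L \<psi> \<Longrightarrow> continuous_on S \<psi>"
  using test_fn_DERIV by (meson DERIV_isCont continuous_at_imp_continuous_on)

lemma test_fn_boundary: "test_fn L \<psi> \<Longrightarrow> \<psi> 0 = 0 \<and> \<psi> L = 0"
  unfolding test_fn_def by auto

context bounded_interval begin

lemma weak_deriv_iff: "weak_deriv L f g \<longleftrightarrow> integrable (Iv L) f \<and> integrable (Iv L) g \<and>
  (\<forall>\<psi>. test_fn L \<psi> \<longrightarrow> (\<integral>x. f x * deriv \<psi> x \<partial>Iv L) = - (\<integral>x. g x * \<psi> x \<partial>Iv L))"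
  by (simp add: weak_deriv_def set_integrable_iff)

lemma weak_deriv_cong_AE:
  assumes w: "weak_deriv L f g" and f: "AE x in Iv L. f x = f' x" and g: "AE x in Iv L. g x = g' x"
  shows "weak_deriv L f' g'"
proof -
  have i: "integrable (Iv L) f" "integrable (Iv L) g" using w by (auto simp: weak_deriv_iff)
  have m: "f' \<in> borel_measurable (Iv L)" "g' \<in> borel_measurable (Iv L)"
    using measurable_cong_AE_Iv[OF _ f] measurable_cong_AE_Iv[OF _ g] i by auto
  have i': "integrable (Iv L) f'" "integrable (Iv L) g'"
    by (rule integrable_cong_AE_imp[OF i(1) m(1) f], rule integrable_cong_AE_imp[OF i(2) m(2) g])
  have "(\<integral>x. f' x * deriv \<psi> x \<partial>Iv L) = - (\<integral>x. g' x * \<psi> x \<partial>Iv L)" if t: "test_fn L \<psi>" for \<psi>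
  proof -
    have [measurable]: "\<psi> \<in> borel_measurable (Iv L)" "deriv \<psi> \<in> borel_measurable (Iv L)"
      using test_fn_continuous[OF t] test_fn_deriv_continuous[OF t] measurable_continuous_Iv by blast+
    note [measurable] = m i[THEN borel_measurable_integrable]
    have "(\<integral>x. f' x * deriv \<psi> x \<partial>Iv L) = (\<integral>x. f x * deriv \<psi> x \<partial>Iv L)"
      by (rule integral_cong_AE) (use f in auto)
    moreover have "(\<integral>x. g' x * \<psi> x \<partial>Iv L) = (\<integral>x. g x * \<psi> x \<partial>Iv L)"
      by (rule integral_cong_AE) (use g in auto)
    ultimately show ?thesis using w t by (simp add: weak_deriv_iff)
  qed
  then show ?thesis using i' by (simp add: weak_deriv_iff)
qed

lemma weak_deriv_prim:
  assumes g: "integrable (Iv L) g"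
  shows "weak_deriv L (\<lambda>x. c + prim g x) g"
  unfolding weak_deriv_iff
proof (intro conjI allI impI)
  show ip: "integrable (Iv L) (\<lambda>x. c + prim g x)"
    using integrable_continuous_Iv[OF prim_continuous[OF g]] by simp
  show "integrable (Iv L) g" by fact
  fix \<psi> assume t: "test_fn L \<psi>"
  note c = test_fn_deriv_continuous[OF t]
  have "(\<integral>x. (c + prim g x) * deriv \<psi> x \<partial>Iv L) = c * (\<integral>x. deriv \<psi> x \<partial>Iv L) + (\<integral>x. prim g x * deriv \<psi> x \<partial>Iv L)"
    using integrable_continuous_Iv[OF c] integrable_mult_continuous[OF integrable_continuous_Iv[OF prim_continuous[OF g]] c]
    by (simp add: distrib_right)
  also have "\<dots> = - (\<integral>x. g x * \<psi> x \<partial>Iv L)"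
    using IBP_prim[OF g test_fn_DERIV[OF t] c] FTC_Iv[OF test_fn_DERIV[OF t] c] test_fn_boundary[OF t] by simp
  finally show "(\<integral>x. (c + prim g x) * deriv \<psi> x \<partial>Iv L) = - (\<integral>x. g x * \<psi> x \<partial>Iv L)" .
qed

lemma weak_deriv_lincomb:
  assumes "weak_deriv L f f'" "weak_deriv L g g'"
  shows "weak_deriv L (\<lambda>x. f x + c * g x) (\<lambda>x. f' x + c * g' x)"
  unfolding weak_deriv_iff
proof (intro conjI allI impI)
  have i: "integrable (Iv L) f" "integrable (Iv L) g" "integrable (Iv L) f'" "integrable (Iv L) g'"
    using assms by (auto simp: weak_deriv_iff)
  then show "integrable (Iv L) (\<lambda>x. f x + c * g x)" "integrable (Iv L) (\<lambda>x. f' x + c * g' x)" by auto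
  fix \<psi> assume t: "test_fn L \<psi>"
  note 1 = test_fn_continuous[OF t] test_fn_deriv_continuous[OF t]
  note 2 = i(1,2)[THEN integrable_mult_continuous, OF 1(2)] i(3,4)[THEN integrable_mult_continuous, OF 1(1)]
  show "(\<integral>x. (f x + c * g x) * deriv \<psi> x \<partial>Iv L) = - (\<integral>x. (f' x + c * g' x) * \<psi> x \<partial>Iv L)"
    using assms t 2 by (simp add: distrib_right weak_deriv_iff mult.assoc)
qed

lemma weak_deriv_unique:
  assumes "weak_deriv L f g" "weak_deriv L f h"
  shows "AE x in Iv L. g x = h x"
proof -
  have i: "integrable (Iv L) g" "integrable (Iv L) h" using assms by (auto simp: weak_deriv_iff)
  have "AE x in Iv L. g x - h x = 0"
  proof (rule fundamental_lemma_bump)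
    show "integrable (Iv L) (\<lambda>x. g x - h x)" using i by simp
    fix m a b assume "0 < (a::real)" "a < b" "b < L"
    then have "test_fn L (bump m a b)" by (rule test_fn_bump)
    then have "(\<integral>x. g x * bump m a b x \<partial>Iv L) = (\<integral>x. h x * bump m a b x \<partial>Iv L)"
      using assms by (simp add: weak_deriv_iff)
    then show "(\<integral>x. (g x - h x) * bump m a b x \<partial>Iv L) = 0"
      using i[THEN integrable_mult_continuous, OF bump_continuous] by (simp add: left_diff_distrib)
  qed
  then show ?thesis by simp
qed

text \<open>Zero mean makes the primitive vanish beyond \<open>hi\<close> as well as before
  \<open>lo\<close>. Taking \<open>\<theta>\<close> from \<open>bump_span\<close> makes all higher
  derivatives of the primitive available.\<close>

lemma test_fn_antiderivative:
  assumes th: "\<theta> \<in> bump_span" and lo: "0 < lo" "lo \<le> hi" "hi < L"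
    and z: "\<And>x. x \<notin> {lo..hi} \<Longrightarrow> \<theta> x = 0" and mean: "(\<integral>x. \<theta> x \<partial>Iv L) = 0"
  obtains \<eta> where "test_fn L \<eta>" "deriv \<eta> = \<theta>"
proof -
  have cont: "continuous_on S \<theta>" for S
    using bump_span_deriv[OF th] by (meson DERIV_isCont continuous_at_imp_continuous_on)
  define \<eta> where "\<eta> = (\<lambda>x. integral {0..x} \<theta>)"
  \<comment> \<open>The integral stops changing at \<open>hi\<close>, so its value at any
    \<open>x > hi\<close>, even beyond \<open>L\<close>, equals the value at \<open>L\<close>, which
    is the mean.\<close>
  have restr: "integral {0..x} \<theta> = integral {0..min x hi} \<theta>" for x
  proof -
    have "integral {0..x} \<theta> = integral {0..x} (\<lambda>s. if s \<in> {0..hi} then \<theta> s else 0)"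
      by (rule Henstock_Kurzweil_Integration.integral_cong) (use z lo in auto)
    also have "\<dots> = integral ({0..hi} \<inter> {0..x}) \<theta>" by (rule Henstock_Kurzweil_Integration.integral_restrict_Int)
    finally show ?thesis by (simp add: min.commute)
  qed
  have below: "\<eta> x = 0" if "x < lo" for x
  proof -
    have "integral {0..x} \<theta> = integral {0..x} (\<lambda>s. 0)"
      by (rule Henstock_Kurzweil_Integration.integral_cong) (use z that in auto)
    then show ?thesis by (simp add: \<eta>_def)
  qed
  have above: "\<eta> x = 0" if "x > hi" for x
  proof -
    have "\<eta> x = integral {0..L} \<theta>" using restr[of x] restr[of L] that lo by (simp add: \<eta>_def)
    also have "\<dots> = 0" using mean integral_Iv_eq[OF integrable_continuous_Iv[OF cont]] by simp
    finally show ?thesis .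
  qed
  have d: "(\<eta> has_real_derivative \<theta> x) (at x)" for x
  proof (cases "x < lo")
    case True
    have "((\<lambda>x. 0) has_real_derivative \<theta> x) (at x)" using z[of x] True by simp
    then show ?thesis
      by (rule has_field_derivative_transform_within_open[of _ _ _ "{..<lo}"]) (use True below in auto)
  next
    case False
    then have "(\<eta> has_real_derivative \<theta> x) (at x within {0..x+1})"
      unfolding \<eta>_def using lo by (intro integral_has_real_derivative cont) auto
    moreover have "at x within {0..x+1} = at x" using False lo by (intro at_within_interior) auto
    ultimately show ?thesis by simp
  qed
  have de: "deriv \<eta> = \<theta>" using d by (auto intro!: DERIV_imp_deriv)
  have "(deriv ^^ n) \<eta> differentiable at x" for n x
  proof (cases n)
    case 0 then show ?thesis using d real_differentiable_def by auto
  next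
    case (Suc k)
    then show ?thesis using bump_span_differentiable[OF th, of k x] de by (simp add: funpow_swap1)
  qed
  moreover have "\<eta> x = 0" if "x \<notin> {lo..hi}" for x using that below above by force
  ultimately have "test_fn L \<eta>" unfolding test_fn_def using lo by blast
  with de show ?thesis by (rule that[rotated])
qed

text \<open>The du Bois-Reymond argument: a bump minus the multiple of a fixed bump
  \<open>\<rho>\<close> with the same integral is the derivative of a test function, so
  \<open>h\<close> integrates to zero against it. The constant is the \<open>\<rho>\<close>-weighted
  mean of \<open>h\<close>.\<close>

lemma weak_deriv_zero_const:
  assumes w: "weak_deriv L h (\<lambda>x. 0)"
  shows "\<exists>c. AE x in Iv L. h x = c"
proof -
  have ih: "integrable (Iv L) h" using w by (simp add: weak_deriv_iff)
  define \<rho> where "\<rho> = bump 0 (L/3) (2*L/3)"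
  define I where "I = (\<integral>x. \<rho> x \<partial>Iv L)"
  have i\<rho>: "integrable (Iv L) \<rho>" unfolding \<rho>_def by (intro integrable_continuous_Iv bump_continuous)
  have "I \<noteq> 0"
  proof
    assume "I = 0"
    then have ae: "AE x in Iv L. \<rho> x = 0"
      using integral_nonneg_eq_0_iff_AE[OF i\<rho>] by (simp add: I_def \<rho>_def bump_nonneg)
    then have "AE x in lebesgue. x \<notin> {L/3<..<2*L/3}"
      by (subst (asm) AE_restrict_space_iff) (auto simp: \<rho>_def bump_cases elim!: eventually_mono split: if_splits)
    then have "{L/3<..<2*L/3} \<in> null_sets lebesgue" by (subst AE_iff_null_sets) simp_all
    then show False using L_pos by (simp add: null_sets_def)
  qed
  define c where "c = (\<integral>x. h x * \<rho> x \<partial>Iv L) / I"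
  have "AE x in Iv L. h x - c = 0"
  proof (rule fundamental_lemma_bump)
    show "integrable (Iv L) (\<lambda>x. h x - c)" using ih by simp
    fix m a b assume ab: "0 < (a::real)" "a < b" "b < L"
    define J where "J = (\<integral>x. bump m a b x \<partial>Iv L)"
    define \<theta> where "\<theta> = (\<lambda>x. bump m a b x + (- (J/I)) * \<rho> x)"
    have ib: "integrable (Iv L) (bump m a b)" by (intro integrable_continuous_Iv bump_continuous)
    have th: "\<theta> \<in> bump_span" unfolding \<theta>_def \<rho>_def by (intro bump_span.add bump_span_scale bump_in_span)
    have "(\<integral>x. \<theta> x \<partial>Iv L) = J + (- (J/I)) * I"
      unfolding \<theta>_def J_def I_def using ib i\<rho> by simp
    then have mean: "(\<integral>x. \<theta> x \<partial>Iv L) = 0" using \<open>I \<noteq> 0\<close> by simp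
    obtain \<eta> where \<eta>: "test_fn L \<eta>" "deriv \<eta> = \<theta>"
    proof (rule test_fn_antiderivative[OF th _ _ _ _ mean, of "min a (L/3)" "max b (2*L/3)"])
      show "\<theta> x = 0" if "x \<notin> {min a (L/3)..max b (2*L/3)}" for x
        using that by (auto simp: \<theta>_def \<rho>_def bump_cases)
    qed (use ab L_pos in auto)
    have 0: "(\<integral>x. h x * \<theta> x \<partial>Iv L) = 0" using w \<eta> by (auto simp: weak_deriv_iff)
    have i1: "integrable (Iv L) (\<lambda>x. h x * bump m a b x)" "integrable (Iv L) (\<lambda>x. h x * \<rho> x)"
      unfolding \<rho>_def by (intro integrable_mult_continuous ih bump_continuous)+
    have "(\<integral>x. h x * \<theta> x \<partial>Iv L) = (\<integral>x. h x * bump m a b x + (- (J/I)) * (h x * \<rho> x) \<partial>Iv L)"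
      by (simp add: \<theta>_def algebra_simps)
    also have "\<dots> = (\<integral>x. h x * bump m a b x \<partial>Iv L) + (- (J/I)) * (\<integral>x. h x * \<rho> x \<partial>Iv L)"
      using i1 by (subst Bochner_Integration.integral_add) auto
    finally have "(\<integral>x. h x * bump m a b x \<partial>Iv L) = c * J"
      using 0 by (simp add: c_def)
    then show "(\<integral>x. (h x - c) * bump m a b x \<partial>Iv L) = 0"
      using i1 ib by (simp add: left_diff_distrib J_def)
  qed
  then show ?thesis by (intro exI[of _ c]) simp
qed

text \<open>Subtracting \<open>prim g\<close> leaves a function with weak derivative zero. This
  supplies the continuous representative on which \<open>bval\<close> is evaluated.\<close>

lemma weak_deriv_absolutely_continuous:
  assumes "weak_deriv L f g"
  obtains c where "AE x in Iv L. f x = c + prim g x"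
proof -
  have g: "integrable (Iv L) g" using assms by (simp add: weak_deriv_iff)
  have "weak_deriv L (\<lambda>x. f x + (-1) * (0 + prim g x)) (\<lambda>x. g x + (-1) * g x)"
    by (rule weak_deriv_lincomb[OF assms weak_deriv_prim[OF g]])
  then have "weak_deriv L (\<lambda>x. f x - prim g x) (\<lambda>x. 0)" by simp
  from weak_deriv_zero_const[OF this] obtain c where "AE x in Iv L. f x - prim g x = c" ..
  then have "AE x in Iv L. f x = c + prim g x" by eventually_elim simp
  then show ?thesis by (rule that)
qed

text \<open>The indefinite integral of \<open>d\<close> vanishes identically, and by continuity its
  derivative at each point, endpoints included, is \<open>d x\<close>. This makes the continuous
  representative behind \<open>bval\<close> unique.\<close>

lemma continuous_AE_zero:
  assumes c: "continuous_on {0..L} d" and z: "AE x in Iv L. d x = (0::real)" and x: "x \<in> {0..L}"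
  shows "d x = 0"
proof -
  have i: "integrable (Iv L) d" by (rule integrable_continuous_Iv[OF c])
  have p: "prim d y = 0" for y
    unfolding prim_def by (rule integral_eq_zero_AE) (use z in \<open>auto elim: eventually_mono\<close>)
  have "((\<lambda>y. integral {0..y} d) has_vector_derivative d x) (at x within {0..L})"
    by (rule integral_has_vector_derivative[OF c x])
  then have "((\<lambda>y. 0::real) has_vector_derivative d x) (at x within {0..L})"
    by (rule has_vector_derivative_transform[rotated 2]) (use x p prim_eq_integral[OF i] in auto)
  moreover have "((\<lambda>y. 0::real) has_vector_derivative 0) (at x within {0..L})" by simp
  ultimately show ?thesis
    using vector_derivative_unique_within_closed_interval[OF L_pos, of x "\<lambda>y. 0::real" "d x" 0] x by simp
qed

section \<open>Boundary values and integration by parts for weak derivatives\<close>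

lemma bval_eqI:
  assumes h: "continuous_on {0..L} h" "AE y in Iv L. h y = g y" and x: "x \<in> {0..L}"
  shows "bval L g x = h x"
  unfolding bval_def
proof (rule the_equality)
  show "\<exists>h'. continuous_on {0..L} h' \<and> (AE y in Iv L. h' y = g y) \<and> h' x = h x"
    using h by blast
  fix v assume "\<exists>h'. continuous_on {0..L} h' \<and> (AE y in Iv L. h' y = g y) \<and> h' x = v"
  then obtain h' where h': "continuous_on {0..L} h'" "AE y in Iv L. h' y = g y" "h' x = v" by blast
  have "AE y in Iv L. h' y - h y = 0" using h(2) h'(2) by eventually_elim simp
  then have "h' x - h x = 0"
    by (rule continuous_AE_zero[OF continuous_on_diff[OF h'(1) h(1)] _ x])
  then show "v = h x" using h' by simp
qed

text \<open>\<open>bval\<close> at 0 is the integration constant of the continuous representative. A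
  zero boundary value thus makes the function almost everywhere equal to
  \<open>prim g\<close>.\<close>

lemma bval_weak_deriv:
  assumes w: "weak_deriv L f g"
  shows "AE x in Iv L. f x = bval L f 0 + prim g x" "bval L f L = bval L f 0 + (\<integral>x. g x \<partial>Iv L)"
proof -
  obtain c where c: "AE x in Iv L. f x = c + prim g x"
    by (rule weak_deriv_absolutely_continuous[OF w])
  have g: "integrable (Iv L) g" using w by (simp add: weak_deriv_iff)
  have h: "continuous_on {0..L} (\<lambda>x. c + prim g x)" by (intro continuous_intros prim_continuous[OF g])
  have e: "AE y in Iv L. c + prim g y = f y" using c by eventually_elim simp
  have b: "bval L f 0 = c" "bval L f L = c + (\<integral>x. g x \<partial>Iv L)"
    using bval_eqI[OF h e] L_pos by (auto simp: prim_0 prim_L)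
  show "AE x in Iv L. f x = bval L f 0 + prim g x" using c b by simp
  show "bval L f L = bval L f 0 + (\<integral>x. g x \<partial>Iv L)" using b by simp
qed

lemma bval_lincomb:
  assumes f: "weak_deriv L f f'" and g: "weak_deriv L g g'" and h: "AE y in Iv L. h y = f y + c * g y"
    and x: "x = 0 \<or> x = L"
  shows "bval L h x = bval L f x + c * bval L g x"
proof -
  have i: "integrable (Iv L) f'" "integrable (Iv L) g'" using f g by (auto simp: weak_deriv_iff)
  let ?h = "\<lambda>x. (bval L f 0 + prim f' x) + c * (bval L g 0 + prim g' x)"
  have "bval L h x = ?h x"
  proof (rule bval_eqI)
    show "continuous_on {0..L} ?h" by (intro continuous_intros prim_continuous i)
    show "AE y in Iv L. ?h y = h y"
      using bval_weak_deriv(1)[OF f] bval_weak_deriv(1)[OF g] h by eventually_elim simp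
  qed (use x L_pos in auto)
  then show ?thesis using x bval_weak_deriv(2)[OF f] bval_weak_deriv(2)[OF g] by (auto simp: prim_0 prim_L)
qed

text \<open>In contrast to the definition of weak derivatives, \<open>\<eta>\<close> need not vanish
  at the ends. The boundary data of the beam reach the cosine coefficients through these extra
  terms.\<close>

lemma IBP_weak:
  assumes w: "weak_deriv L f g"
    and d: "\<And>x. (\<eta> has_real_derivative \<eta>' x) (at x)" and c: "continuous_on UNIV \<eta>'"
  shows "(\<integral>x. g x * \<eta> x \<partial>Iv L) = bval L f L * \<eta> L - bval L f 0 * \<eta> 0 - (\<integral>x. f x * \<eta>' x \<partial>Iv L)"
proof -
  have g: "integrable (Iv L) g" and f: "integrable (Iv L) f" using w by (auto simp: weak_deriv_iff)
  have c': "continuous_on {0..L} \<eta>'" using c continuous_on_subset by blast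
  have ip: "integrable (Iv L) (prim g)" by (intro integrable_continuous_Iv prim_continuous g)
  note [measurable] = borel_measurable_integrable[OF f] borel_measurable_integrable[OF ip] measurable_continuous_Iv[OF c']
  have "(\<integral>x. f x * \<eta>' x \<partial>Iv L) = (\<integral>x. bval L f 0 * \<eta>' x + prim g x * \<eta>' x \<partial>Iv L)"
    by (rule integral_cong_AE) (use bval_weak_deriv(1)[OF w] in \<open>auto elim!: eventually_mono simp: algebra_simps\<close>)
  also have "\<dots> = bval L f 0 * (\<integral>x. \<eta>' x \<partial>Iv L) + (\<integral>x. prim g x * \<eta>' x \<partial>Iv L)"
    using integrable_continuous_Iv[OF c'] integrable_mult_continuous[OF ip c'] by simp
  also have "\<dots> = bval L f 0 * (\<eta> L - \<eta> 0) + prim g L * \<eta> L - (\<integral>x. g x * \<eta> x \<partial>Iv L)"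
    using FTC_Iv[OF d c'] IBP_prim[OF g d c] by simp
  finally show ?thesis using bval_weak_deriv(2)[OF w] by (simp add: prim_L algebra_simps)
qed

text \<open>Any one witness justifies the choice in \<open>wderiv\<close>, and uniqueness makes the
  choice immaterial almost everywhere.\<close>

lemma wderiv_props:
  assumes "L2 L g" "weak_deriv L f g"
  shows "L2 L (wderiv L f)" "weak_deriv L f (wderiv L f)" "AE x in Iv L. wderiv L f x = g x"
proof -
  have "L2 L (wderiv L f) \<and> weak_deriv L f (wderiv L f)"
    unfolding wderiv_def by (rule someI[of _ g]) (use assms in simp)
  then show "L2 L (wderiv L f)" "weak_deriv L f (wderiv L f)" by auto
  then show "AE x in Iv L. wderiv L f x = g x" using assms weak_deriv_unique by blast
qed

section \<open>Iterated weak derivatives\<close>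

lemma dx_Suc: "dx L (Suc j) f = wderiv L (dx L j f)"
  by (simp add: dx_def)

lemma dx_0 [simp]: "dx L 0 f = f"
  by (simp add: dx_def)

lemma dx_add: "dx L (i + j) f = dx L i (dx L j f)"
  by (simp add: dx_def funpow_add)

text \<open>Bridge from an explicit chain \<open>D\<close> of weak derivatives to the chosen ones.
  Asking for \<open>f\<close> to agree with \<open>D 0\<close> only almost everywhere lets a
  function inherit the derivatives of a better representative.\<close>

lemma dx_chain:
  assumes f: "L2 L f" "AE x in Iv L. f x = D 0 x"
    and D: "\<And>j. j \<le> k \<Longrightarrow> L2 L (D j)" "\<And>j. j < k \<Longrightarrow> weak_deriv L (D j) (D (Suc j))"
  shows "j \<le> k \<Longrightarrow> L2 L (dx L j f) \<and> (AE x in Iv L. dx L j f x = D j x)"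
    and "Suc j \<le> k \<Longrightarrow> weak_deriv L (dx L j f) (dx L (Suc j) f)"
    and "Hk L k f"
proof -
  have 1: "j \<le> k \<Longrightarrow> L2 L (dx L j f) \<and> (AE x in Iv L. dx L j f x = D j x)" for j
  proof (induction j)
    case 0 then show ?case using f by simp
  next
    case (Suc j)
    then have "AE x in Iv L. dx L j f x = D j x" by simp
    then have ae: "AE x in Iv L. D j x = dx L j f x" by (rule AE_symmetric)
    have "weak_deriv L (dx L j f) (D (Suc j))"
      by (rule weak_deriv_cong_AE[OF D(2) ae]) (use Suc in auto)
    then show ?case using wderiv_props[of "D (Suc j)" "dx L j f"] D(1)[of "Suc j"] Suc by (simp add: dx_Suc)
  qed
  have 2: "weak_deriv L (dx L j f) (dx L (Suc j) f)" if "Suc j \<le> k" for j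
  proof (rule weak_deriv_cong_AE[OF D(2)[of j]])
    show "AE x in Iv L. D j x = dx L j f x" by (rule AE_symmetric) (use 1[of j] that in simp)
    show "AE x in Iv L. D (Suc j) x = dx L (Suc j) f x" by (rule AE_symmetric) (use 1[of "Suc j"] that in simp)
  qed (use that in simp)
  show "j \<le> k \<Longrightarrow> L2 L (dx L j f) \<and> (AE x in Iv L. dx L j f x = D j x)" by (rule 1)
  show "Suc j \<le> k \<Longrightarrow> weak_deriv L (dx L j f) (dx L (Suc j) f)" by (rule 2)
  show "Hk L k f" unfolding Hk_def
    by (rule exI[of _ "\<lambda>j. dx L j f"]) (use 1 2 in auto)
qed

lemma Hk_dx:
  assumes "Hk L k f"
  shows "j \<le> k \<Longrightarrow> L2 L (dx L j f)" "Suc j \<le> k \<Longrightarrow> weak_deriv L (dx L j f) (dx L (Suc j) f)"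
proof -
  obtain D where D: "D 0 = f" "\<And>j. j \<le> k \<Longrightarrow> L2 L (D j)" "\<And>j. j < k \<Longrightarrow> weak_deriv L (D j) (D (Suc j))"
    using assms unfolding Hk_def by blast
  have f: "L2 L f" "AE x in Iv L. f x = D 0 x" using D(1) D(2)[of 0] by auto
  show "j \<le> k \<Longrightarrow> L2 L (dx L j f)" "Suc j \<le> k \<Longrightarrow> weak_deriv L (dx L j f) (dx L (Suc j) f)"
    using dx_chain[of f D k, OF f D(2,3)] by auto
qed

lemma Hk_L2: "Hk L k f \<Longrightarrow> L2 L f"
  using Hk_dx(1)[of k f 0] by simp

text \<open>A choice of representatives need not be linear, so linearity of \<open>dx\<close> holds
  only almost everywhere; boundary values, being independent of the representative, are linear
  exactly.\<close>

lemma dx_lincomb: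
  assumes f: "Hk L k f" and g: "Hk L k g" and h: "L2 L h" "AE x in Iv L. h x = f x + c * g x"
  shows "Hk L k h"
    and "j \<le> k \<Longrightarrow> AE x in Iv L. dx L j h x = dx L j f x + c * dx L j g x"
    and "j < k \<Longrightarrow> x = 0 \<or> x = L \<Longrightarrow> bval L (dx L j h) x = bval L (dx L j f) x + c * bval L (dx L j g) x"
proof -
  let ?D = "\<lambda>j x. dx L j f x + c * dx L j g x"
  have D: "\<And>j. j \<le> k \<Longrightarrow> L2 L (?D j)" "\<And>j. j < k \<Longrightarrow> weak_deriv L (?D j) (?D (Suc j))"
    by (auto intro!: weak_deriv_lincomb Hk_dx[OF f] Hk_dx[OF g])
  have h0: "AE x in Iv L. h x = ?D 0 x" using h by simp
  note ch = dx_chain[of h ?D k, OF h(1) h0 D]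
  show "Hk L k h" by (rule ch(3))
  show ae: "j \<le> k \<Longrightarrow> AE x in Iv L. dx L j h x = dx L j f x + c * dx L j g x" for j using ch(1)[of j] by blast
  show "j < k \<Longrightarrow> x = 0 \<or> x = L \<Longrightarrow> bval L (dx L j h) x = bval L (dx L j f) x + c * bval L (dx L j g) x"
    by (rule bval_lincomb[OF Hk_dx(2)[OF f, of j] Hk_dx(2)[OF g, of j]]) (use ae[of j] in auto)
qed

subsection \<open>Neumann cosine series\<close>


definition freq :: "nat \<Rightarrow> real" where "freq n = real n * pi / L"

text \<open>Normalises the cosines in L^2: the constant mode has mean square 1, all others
  1/2.\<close>

definition amp :: "nat \<Rightarrow> real" where "amp n = sqrt ((if n = 0 then 1 else 2) / L)"

definition cs :: "nat \<Rightarrow> real \<Rightarrow> real" where "cs n x = amp n * cos (freq n * x)"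

definition sn :: "nat \<Rightarrow> real \<Rightarrow> real" where "sn n x = amp n * sin (freq n * x)"

definition coef :: "nat \<Rightarrow> (real \<Rightarrow> real) \<Rightarrow> real" where
  "coef n f = (\<integral>x. f x * cs n x \<partial>Iv L)"

lemma amp_pos: "0 < amp n" using L_pos by (simp add: amp_def)

lemma amp_sq: "(amp n)^2 = (if n = 0 then 1 else 2) / L" using L_pos by (simp add: amp_def)

lemma freq_0 [simp]: "freq 0 = 0" by (simp add: freq_def)

lemma freq_L: "freq n * L = real n * pi" using L_pos by (simp add: freq_def)

lemma cs_DERIV: "(cs n has_real_derivative - freq n * sn n x) (at x)"
  unfolding cs_def[abs_def] sn_def by (auto intro!: derivative_eq_intros)

lemma sn_DERIV: "(sn n has_real_derivative freq n * cs n x) (at x)"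
  unfolding sn_def[abs_def] cs_def by (auto intro!: derivative_eq_intros)

lemma cs_continuous: "continuous_on S (cs n)"
  unfolding cs_def[abs_def] by (intro continuous_intros)

lemma sn_continuous: "continuous_on S (sn n)"
  unfolding sn_def[abs_def] by (intro continuous_intros)

lemma sn_0: "sn n 0 = 0" by (simp add: sn_def)

lemma sn_L: "sn n L = 0"
  by (simp add: sn_def freq_L sin_npi)

lemma cs_0: "cs n 0 = amp n" by (simp add: cs_def)

lemma cs_L: "cs n L = amp n * (-1)^n" by (simp add: cs_def freq_L cos_npi)

lemma freq_eq_iff: "(freq m)^2 = (freq n)^2 \<longleftrightarrow> m = n"
  using L_pos by (auto simp: freq_def power2_eq_iff field_simps)

lemma cs_orthonormal: "(\<integral>x. cs m x * cs n x \<partial>Iv L) = (if m = n then 1 else 0)"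
proof (cases "m = n")
  case False
  \<comment> \<open>The Wronskian of two eigenfunctions: its derivative is the difference of the
    eigenvalues times their product, and it vanishes at both ends because the sines do.\<close>
  let ?F = "\<lambda>x. freq n * cs m x * sn n x - freq m * sn m x * cs n x"
  have d: "(?F has_real_derivative ((freq n)^2 - (freq m)^2) * (cs m x * cs n x)) (at x)" for x
    by (auto intro!: derivative_eq_intros cs_DERIV sn_DERIV simp: algebra_simps power2_eq_square)
  have "(\<integral>x. ((freq n)^2 - (freq m)^2) * (cs m x * cs n x) \<partial>Iv L) = ?F L - ?F 0"
    by (rule FTC_Iv[OF d]) (intro continuous_intros cs_continuous)
  then have "((freq n)^2 - (freq m)^2) * (\<integral>x. cs m x * cs n x \<partial>Iv L) = 0"
    by (simp add: sn_0 sn_L)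
  then show ?thesis using False freq_eq_iff[of n m] by auto
next
  case True
  show ?thesis
  proof (cases "n = 0")
    case True
    have "cs 0 x * cs 0 x = 1 / L" for x
      using amp_sq[of 0] by (simp add: cs_def power2_eq_square)
    then show ?thesis using \<open>m = n\<close> True L_pos by simp
  next
    case False
    \<comment> \<open>The double-angle antiderivative of the squared cosine; the linear term alone
      contributes to the integral.\<close>
    let ?F = "\<lambda>x. x / L + cs n x * sn n x / (2 * freq n)"
    have f: "freq n \<noteq> 0" using False L_pos by (simp add: freq_def)
    have id: "(cs n x)^2 + (sn n x)^2 = 2 / L" for x
    proof -
      have "(cs n x)^2 + (sn n x)^2 = (amp n)^2 * ((cos (freq n * x))^2 + (sin (freq n * x))^2)"
        by (simp only: cs_def sn_def power_mult_distrib distrib_left)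
      then show ?thesis using False by (simp add: amp_sq)
    qed
    have d: "(?F has_real_derivative cs n x * cs n x) (at x)" for x
    proof -
      have "(?F has_real_derivative 1 / L + (- freq n * sn n x * sn n x + freq n * cs n x * cs n x) / (2 * freq n)) (at x)"
        by (rule DERIV_cong[OF DERIV_add[OF DERIV_cdivide[OF DERIV_ident] DERIV_cdivide[OF DERIV_mult[OF cs_DERIV sn_DERIV]]]]) simp
      moreover have "1 / L + (- freq n * sn n x * sn n x + freq n * cs n x * cs n x) / (2 * freq n) = cs n x * cs n x"
      proof -
        have "- freq n * sn n x * sn n x + freq n * cs n x * cs n x = freq n * ((cs n x)^2 - (sn n x)^2)"
          by (simp add: algebra_simps power2_eq_square)
        then have "(- freq n * sn n x * sn n x + freq n * cs n x * cs n x) / (2 * freq n) = ((cs n x)^2 - (sn n x)^2) / 2"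
          using f by simp
        moreover have "1 / L = ((cs n x)^2 + (sn n x)^2) / 2" using id[of x] by simp
        ultimately have "1 / L + (- freq n * sn n x * sn n x + freq n * cs n x * cs n x) / (2 * freq n) = (cs n x)^2"
          by (simp only: field_simps)
        then show ?thesis by (simp only: power2_eq_square)
      qed
      ultimately show ?thesis by simp
    qed
    have "(\<integral>x. cs n x * cs n x \<partial>Iv L) = ?F L - ?F 0"
      by (rule FTC_Iv[OF d]) (intro continuous_intros cs_continuous)
    then show ?thesis using \<open>m = n\<close> L_pos by (simp add: sn_0 sn_L)
  qed
qed

section \<open>Cosine coefficients and Bessel's inequality\<close>

lemma coef_integrable: "integrable (Iv L) f \<Longrightarrow> integrable (Iv L) (\<lambda>x. f x * cs n x)"
  by (rule integrable_mult_continuous[OF _ cs_continuous])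

lemma coef_add: "integrable (Iv L) f \<Longrightarrow> integrable (Iv L) g \<Longrightarrow> coef n (\<lambda>x. f x + g x) = coef n f + coef n g"
  using coef_integrable[of f n] coef_integrable[of g n] by (simp add: coef_def distrib_right)

lemma coef_diff: "integrable (Iv L) f \<Longrightarrow> integrable (Iv L) g \<Longrightarrow> coef n (\<lambda>x. f x - g x) = coef n f - coef n g"
  using coef_integrable[of f n] coef_integrable[of g n] by (simp add: coef_def left_diff_distrib)

lemma coef_cmult: "coef n (\<lambda>x. c * f x) = c * coef n f"
  by (simp add: coef_def mult.assoc)

lemma coef_divide: "coef n (\<lambda>x. f x / c) = coef n f / c"
  using coef_cmult[of n "1/c" f] by simp

lemma coef_cong_AE:
  assumes "AE x in Iv L. f x = g x" "integrable (Iv L) f"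
  shows "coef n f = coef n g"
proof -
  have "g \<in> borel_measurable (Iv L)" using measurable_cong_AE_Iv[OF _ assms(1)] assms(2) by auto
  then show ?thesis unfolding coef_def using assms borel_measurable_integrable[OF assms(2)] measurable_continuous_Iv[OF cs_continuous]
    by (intro integral_cong_AE) (auto elim!: eventually_mono)
qed

lemma coef_sum:
  "finite I \<Longrightarrow> (\<And>i. i \<in> I \<Longrightarrow> integrable (Iv L) (f i)) \<Longrightarrow> coef n (\<lambda>x. \<Sum>i\<in>I. f i x) = (\<Sum>i\<in>I. coef n (f i))"
  by (induction I rule: finite_induct) (auto simp: coef_add, auto simp: coef_def)

lemma integrable_cs: "integrable (Iv L) (cs n)" by (intro integrable_continuous_Iv cs_continuous)

lemma coef_cs: "coef n (cs m) = (if m = n then 1 else 0)"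
  by (simp add: coef_def cs_orthonormal)

lemma coef_finite_sum: "finite I \<Longrightarrow> coef n (\<lambda>x. \<Sum>i\<in>I. a i * cs i x) = (if n \<in> I then a n else 0)"
  by (subst coef_sum) (auto simp: integrable_cs coef_cmult coef_cs if_distrib sum.delta cong: if_cong)

lemma L2_finite_sum: "L2 L (\<lambda>x. \<Sum>i\<in>I. a i * cs i x)"
  by (intro L2_continuous continuous_intros cs_continuous)

lemma integral_mult_finite_sum:
  assumes "finite I" "L2 L f"
  shows "(\<integral>x. f x * (\<Sum>i\<in>I. a i * cs i x) \<partial>Iv L) = (\<Sum>i\<in>I. a i * coef i f)"
proof -
  have "(\<integral>x. f x * (\<Sum>i\<in>I. a i * cs i x) \<partial>Iv L) = (\<integral>x. (\<Sum>i\<in>I. a i * (f x * cs i x)) \<partial>Iv L)"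
    by (simp add: sum_distrib_left algebra_simps)
  also have "\<dots> = (\<Sum>i\<in>I. \<integral>x. a i * (f x * cs i x) \<partial>Iv L)"
    by (rule Bochner_Integration.integral_sum)
       (use coef_integrable[OF L2_integrable[OF assms(2)]] in auto)
  finally show ?thesis by (simp add: coef_def)
qed

lemma integral_finite_sum_sq:
  assumes "finite I"
  shows "(\<integral>x. (\<Sum>i\<in>I. a i * cs i x)^2 \<partial>Iv L) = (\<Sum>i\<in>I. (a i)^2)"
  using integral_mult_finite_sum[OF assms L2_finite_sum[of a I], of a] assms
  by (simp add: power2_eq_square coef_finite_sum cong: sum.cong)

lemma bessel_finite:
  assumes f: "L2 L f" and I: "finite I"
  shows "(\<Sum>i\<in>I. (coef i f)^2) \<le> (\<integral>x. (f x)^2 \<partial>Iv L)"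
proof -
  let ?S = "\<lambda>x. \<Sum>i\<in>I. coef i f * cs i x"
  have S: "L2 L ?S" by (rule L2_finite_sum)
  have i: "integrable (Iv L) (\<lambda>x. (f x)^2)" "integrable (Iv L) (\<lambda>x. (?S x)^2)"
    "integrable (Iv L) (\<lambda>x. f x * ?S x)"
    using f S L2_mult_integrable[OF f S] unfolding L2_def by auto
  have "0 \<le> (\<integral>x. (f x - ?S x)^2 \<partial>Iv L)" by simp
  also have "\<dots> = (\<integral>x. (f x)^2 + (?S x)^2 - 2 * (f x * ?S x) \<partial>Iv L)"
    by (simp add: power2_diff mult.assoc)
  also have "\<dots> = (\<integral>x. (f x)^2 \<partial>Iv L) + (\<integral>x. (?S x)^2 \<partial>Iv L) - 2 * (\<integral>x. f x * ?S x \<partial>Iv L)"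
    using i by simp
  also have "\<dots> = (\<integral>x. (f x)^2 \<partial>Iv L) - (\<Sum>i\<in>I. (coef i f)^2)"
    using integral_finite_sum_sq[OF I, of "\<lambda>i. coef i f"] integral_mult_finite_sum[OF I f, of "\<lambda>i. coef i f"]
    by (simp add: power2_eq_square)
  finally show ?thesis by simp
qed

lemma bessel:
  assumes f: "L2 L f"
  shows "summable (\<lambda>n. (coef n f)^2)" "(\<Sum>n. (coef n f)^2) \<le> (L2norm L f)^2"
proof -
  show s: "summable (\<lambda>n. (coef n f)^2)"
    by (rule summableI_nonneg_bounded[of _ "\<integral>x. (f x)^2 \<partial>Iv L"]) (use bessel_finite[OF f] in auto)
  show "(\<Sum>n. (coef n f)^2) \<le> (L2norm L f)^2"
    unfolding L2norm_sq by (rule suminf_le_const[OF s]) (use bessel_finite[OF f] in auto)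
qed

lemma coef_sq_le: "L2 L f \<Longrightarrow> (coef n f)^2 \<le> (L2norm L f)^2"
  using bessel_finite[of f "{n}"] by (simp add: L2norm_sq)

lemma abs_coef_le: "L2 L f \<Longrightarrow> \<bar>coef n f\<bar> \<le> L2norm L f"
  using coef_sq_le[of f n] by (simp add: abs_le_square_iff[symmetric])

text \<open>Cauchy-Schwarz against constants, read off from the coefficient bound:
  \<open>cs 0\<close> is the constant \<open>1 / sqrt L\<close>.\<close>

lemma L1_le_L2norm:
  assumes f: "L2 L f"
  shows "(\<integral>x. \<bar>f x\<bar> \<partial>Iv L) \<le> sqrt L * L2norm L f"
proof -
  have "(\<integral>x. \<bar>f x\<bar> * (1 / sqrt L) \<partial>Iv L) \<le> L2norm L f"
    using abs_coef_le[OF L2_abs[OF f], of 0] L_pos by (simp add: coef_def cs_def amp_def real_sqrt_divide L2norm_def)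
  then have "(\<integral>x. \<bar>f x\<bar> \<partial>Iv L) * (1 / sqrt L) \<le> L2norm L f" by simp
  then show ?thesis using L_pos by (simp add: field_simps)
qed

text \<open>A further factor cos(pi x / L) turns mode \<open>n\<close> into the average of modes
  \<open>n - 1\<close> and \<open>n + 1\<close>, hence the induction on the power with
  \<open>n\<close> arbitrary. Mode 0 has no lower neighbour; there the extra factor simply is mode
  1.\<close>

lemma cos_powers_orthogonal:
  assumes f: "integrable (Iv L) f" and z: "\<And>n. coef n f = 0"
  shows "(\<integral>x. f x * (cos (pi / L * x) ^ m * cos (freq n * x)) \<partial>Iv L) = 0"
proof (induction m arbitrary: n)
  case 0
  have "coef n f = amp n * (\<integral>x. f x * cos (freq n * x) \<partial>Iv L)"
    unfolding coef_def cs_def by (subst integral_mult_right_zero[symmetric]) (simp add: algebra_simps)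
  then show ?case using z[of n] amp_pos[of n] by simp
next
  case (Suc m)
  have int: "integrable (Iv L) (\<lambda>x. f x * (cos (pi / L * x) ^ m * cos (freq n * x)))" for n
    by (intro integrable_mult_continuous f continuous_intros)
  show ?case
  proof (cases n)
    case 0
    have "freq 1 = pi / L" by (simp add: freq_def)
    then show ?thesis using Suc.IH[of 1] 0 by (simp add: mult.commute)
  next
    case (Suc k)
    have e: "cos (pi / L * x) * cos (freq n * x) = (cos (freq k * x) + cos (freq (Suc n) * x)) / 2" for x
    proof -
      have "freq k * x = freq n * x - pi / L * x" "freq (Suc n) * x = freq n * x + pi / L * x"
        using Suc L_pos by (auto simp: freq_def field_simps)
      then show ?thesis by (simp add: cos_add cos_diff)
    qed
    have "(\<integral>x. f x * (cos (pi / L * x) ^ Suc m * cos (freq n * x)) \<partial>Iv L) =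
      (\<integral>x. (f x * (cos (pi / L * x) ^ m * cos (freq k * x)) + f x * (cos (pi / L * x) ^ m * cos (freq (Suc n) * x))) / 2 \<partial>Iv L)"
    proof (rule Bochner_Integration.integral_cong[OF refl])
      fix x
      have "f x * (cos (pi / L * x) ^ Suc m * cos (freq n * x)) = f x * cos (pi / L * x) ^ m * (cos (pi / L * x) * cos (freq n * x))"
        by simp
      also have "\<dots> = (f x * (cos (pi / L * x) ^ m * cos (freq k * x)) + f x * (cos (pi / L * x) ^ m * cos (freq (Suc n) * x))) / 2"
        unfolding e by (simp add: algebra_simps)
      finally show "f x * (cos (pi / L * x) ^ Suc m * cos (freq n * x)) = \<dots>" .
    qed
    then show ?thesis using int Suc.IH by simp
  qed
qed

text \<open>The substitution y = cos(pi x / L) maps the interval one-to-one onto [-1,1], so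
  Weierstrass approximation in y gives uniform approximation of a bump by polynomials in that
  cosine, all orthogonal to \<open>f\<close>. Uniform closeness suffices because \<open>f\<close> is
  integrable.\<close>

lemma cosine_completeness:
  assumes f: "integrable (Iv L) f" and z: "\<And>n. coef n f = 0"
  shows "AE x in Iv L. f x = 0"
proof (rule fundamental_lemma_bump[OF f])
  fix m :: nat and a b :: real
  define h where "h = bump m a b"
  have hc: "continuous_on S h" for S unfolding h_def by (rule bump_continuous)
  have ih: "integrable (Iv L) (\<lambda>x. f x * h x)" by (rule integrable_mult_continuous[OF f hc])
  have "\<bar>\<integral>x. f x * h x \<partial>Iv L\<bar> \<le> e" if e: "e > 0" for e
  proof -
    \<comment> \<open>The summand 1 keeps \<open>K\<close> positive when \<open>f\<close> vanishes
      almost everywhere.\<close>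
    define K where "K = (\<integral>x. \<bar>f x\<bar> \<partial>Iv L) + 1"
    have K: "K > 0" unfolding K_def by (rule add_nonneg_pos) simp_all
    have c: "continuous_on {-1..1} (\<lambda>y. h (L / pi * arccos y))"
      by (rule continuous_on_compose2[OF hc[of UNIV]]) (auto intro!: continuous_intros)
    obtain g where g: "real_polynomial_function g" "\<And>y. y \<in> {-1..1} \<Longrightarrow> \<bar>h (L / pi * arccos y) - g y\<bar> < e / K"
      using Stone_Weierstrass_real_polynomial_function[OF compact_Icc c, of "e/K"] e K by auto
    obtain q N where q: "g = (\<lambda>y. \<Sum>i\<le>N. q i * y ^ i)"
      using real_polynomial_function_imp_sum[OF g(1)] by blast
    define G where "G = (\<lambda>x. g (cos (pi / L * x)))"
    have Gc: "continuous_on {0..L} G" unfolding G_def q by (intro continuous_intros)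
    have close: "\<bar>h x - G x\<bar> \<le> e / K" if "0 < x" "x < L" for x
    proof -
      have "arccos (cos (pi / L * x)) = pi / L * x" using that by (intro arccos_cos) (auto simp: field_simps)
      then show ?thesis using g(2)[of "cos (pi / L * x)"] L_pos unfolding G_def by simp
    qed
    have "(\<integral>x. f x * G x \<partial>Iv L) = (\<integral>x. (\<Sum>i\<le>N. q i * (f x * (cos (pi / L * x) ^ i * cos (freq 0 * x)))) \<partial>Iv L)"
      by (simp add: G_def q sum_distrib_left algebra_simps)
    also have "\<dots> = (\<Sum>i\<le>N. \<integral>x. q i * (f x * (cos (pi / L * x) ^ i * cos (freq 0 * x))) \<partial>Iv L)"
      by (rule Bochner_Integration.integral_sum) (intro integrable_mult_right integrable_mult_continuous f continuous_intros)
    also have "\<dots> = 0" using cos_powers_orthogonal[OF f z, of _ 0] by simp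
    finally have G0: "(\<integral>x. f x * G x \<partial>Iv L) = 0" .
    have iG: "integrable (Iv L) (\<lambda>x. f x * G x)" by (rule integrable_mult_continuous[OF f Gc])
    have "(\<integral>x. f x * h x \<partial>Iv L) = (\<integral>x. f x * h x - f x * G x \<partial>Iv L)"
      using ih iG G0 by simp
    also have "\<bar>\<dots>\<bar> \<le> (\<integral>x. \<bar>f x * h x - f x * G x\<bar> \<partial>Iv L)" by simp
    also have "\<dots> \<le> (\<integral>x. \<bar>f x\<bar> * (e / K) \<partial>Iv L)"
    proof (rule integral_mono)
      show "integrable (Iv L) (\<lambda>x. \<bar>f x * h x - f x * G x\<bar>)" using ih iG by simp
      show "integrable (Iv L) (\<lambda>x. \<bar>f x\<bar> * (e / K))" using f by simp
      fix x assume "x \<in> space (Iv L)"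
      then have "\<bar>h x - G x\<bar> \<le> e / K" using close by simp
      then show "\<bar>f x * h x - f x * G x\<bar> \<le> \<bar>f x\<bar> * (e / K)"
        unfolding right_diff_distrib[symmetric] abs_mult by (rule mult_left_mono) simp
    qed
    also have "\<dots> = (K - 1) * (e / K)" by (simp add: K_def)
    also have "\<dots> \<le> e" using K e by (simp add: field_simps)
    finally show ?thesis .
  qed
  then have "\<bar>\<integral>x. f x * h x \<partial>Iv L\<bar> \<le> 0" by (rule field_le_epsilon) simp
  then show "(\<integral>x. f x * bump m a b x \<partial>Iv L) = 0" by (simp add: h_def)
qed

lemma AE_eq_if_coef_eq:
  assumes "integrable (Iv L) f" "integrable (Iv L) g" "\<And>n. coef n f = coef n g"
  shows "AE x in Iv L. f x = g x"
  using cosine_completeness[of "\<lambda>x. f x - g x"] assms by (simp add: coef_diff)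

section \<open>Riesz-Fischer theorem and Parseval's identity\<close>

lemma L2_Fatou:
  assumes u: "\<And>j. L2 L (u j)" and lim: "AE x in Iv L. (\<lambda>j::nat. u j x) \<longlonglongrightarrow> G x"
    and G [measurable]: "G \<in> borel_measurable (Iv L)" and C: "\<And>j. (\<integral>x. (u j x)^2 \<partial>Iv L) \<le> C"
  shows "L2 L G" "(\<integral>x. (G x)^2 \<partial>Iv L) \<le> C"
proof -
  have [measurable]: "u j \<in> borel_measurable (Iv L)" for j using u by (simp add: L2_def)
  have C0: "0 \<le> C" by (rule order_trans[OF _ C[of 0]]) simp
  have n: "(\<integral>\<^sup>+x. ennreal ((u j x)^2) \<partial>Iv L) \<le> ennreal C" for j
    using u[of j] C[of j] by (subst nn_integral_eq_integral) (auto simp: L2_def ennreal_leI)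
  have "(\<integral>\<^sup>+x. ennreal ((G x)^2) \<partial>Iv L) = (\<integral>\<^sup>+x. liminf (\<lambda>j. ennreal ((u j x)^2)) \<partial>Iv L)"
  proof (rule nn_integral_cong_AE)
    show "AE x in Iv L. ennreal ((G x)^2) = liminf (\<lambda>j. ennreal ((u j x)^2))"
      using lim
    proof eventually_elim
      case (elim x)
      then have "(\<lambda>j. ennreal ((u j x)^2)) \<longlonglongrightarrow> ennreal ((G x)^2)" by (intro tendsto_ennrealI tendsto_power)
      then show ?case by (intro lim_imp_Liminf[symmetric]) simp_all
    qed
  qed
  also have "\<dots> \<le> liminf (\<lambda>j. \<integral>\<^sup>+x. ennreal ((u j x)^2) \<partial>Iv L)"
    by (rule nn_integral_liminf) simp
  also have "\<dots> \<le> ennreal C"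
    by (rule Liminf_le) (simp_all add: n)
  finally have le: "(\<integral>\<^sup>+x. ennreal ((G x)^2) \<partial>Iv L) \<le> ennreal C" .
  have i: "integrable (Iv L) (\<lambda>x. (G x)^2)"
    by (rule integrableI_bounded) (use le in \<open>auto simp: order_le_less_trans\<close>)
  then show "L2 L G" by (simp add: L2_def)
  show "(\<integral>x. (G x)^2 \<partial>Iv L) \<le> C"
    using le C0 i by (subst (asm) nn_integral_eq_integral) auto
qed

text \<open>Partial sums taken along indices with geometrically small tails converge almost everywhere,
  so Fatou's lemma supplies all norm bounds.\<close>

lemma riesz_fischer:
  assumes a: "summable (\<lambda>n. (a n :: real)^2)"
  obtains G where "L2 L G" "\<And>n. coef n G = a n" "(L2norm L G)^2 \<le> (\<Sum>n. (a n)^2)"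
proof -
  define tl where "tl N = (\<Sum>n. (a (n + N))^2)" for N
  define S where "S N x = (\<Sum>n<N. a n * cs n x)" for N x
  have LS: "L2 L (S N)" for N unfolding S_def[abs_def] by (rule L2_finite_sum)
  have tl: "(\<Sum>n\<in>{N..<M}. (a n)^2) \<le> tl N" if "N \<le> M" for N M
  proof -
    have "(\<Sum>n\<in>{N..<M}. (a n)^2) = (\<Sum>n<M-N. (a (n + N))^2)"
      using that by (intro sum.reindex_bij_witness[of _ "\<lambda>n. n + N" "\<lambda>n. n - N"]) auto
    also have "\<dots> \<le> tl N" unfolding tl_def
      by (rule sum_le_suminf) (use summable_ignore_initial_segment[OF a] in auto)
    finally show ?thesis .
  qed
  have tl_anti: "tl M \<le> tl N" if "N \<le> M" for N M
  proof -
    have "tl N = tl M + (\<Sum>n<M-N. (a (n + N))^2)"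
      using suminf_split_initial_segment[OF summable_ignore_initial_segment[OF a, of N], of "M-N"] that
      by (simp add: tl_def)
    then show ?thesis by (simp add: sum_nonneg)
  qed
  have "tl \<longlonglongrightarrow> 0" unfolding tl_def[abs_def] using suminf_exist_split2[OF a] .
  then have ex: "\<exists>N. tl N \<le> (1/4)^k" for k
    using order_tendstoD(2)[of tl 0 sequentially "(1/4)^k"] by (auto simp: eventually_sequentially intro: less_imp_le)
  \<comment> \<open>The least index brings the tail below 4^-k, so successive differences are at
    most 2^-k in norm, which is summable. Adding \<open>k\<close> guarantees \<open>n < r k\<close>
    for \<open>n < k\<close>, so mode \<open>n\<close> is eventually included in the partial
    sums.\<close>
  define r where "r k = k + (LEAST N. tl N \<le> (1/4)^k)" for k
  have r_tl: "tl (r k) \<le> (1/4)^k" for k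
  proof -
    have "tl (LEAST N. tl N \<le> (1/4)^k) \<le> (1/4)^k" using LeastI_ex[OF ex[of k]] .
    then show ?thesis using tl_anti[of "LEAST N. tl N \<le> (1/4)^k" "r k"] by (simp add: r_def)
  qed
  have r_Suc: "r k \<le> r (Suc k)" for k
  proof -
    have "tl (LEAST N. tl N \<le> (1/4)^Suc k) \<le> (1/4)^Suc k" using LeastI_ex[OF ex[of "Suc k"]] .
    also have "\<dots> \<le> (1/4)^k" by simp
    finally have "(LEAST N. tl N \<le> (1/4)^k) \<le> (LEAST N. tl N \<le> (1/4)^Suc k)" by (rule Least_le)
    then show ?thesis by (simp add: r_def)
  qed
  have r_mono: "r j \<le> r k" if "j \<le> k" for j k using lift_Suc_mono_le[of r, OF r_Suc that] .
  have diff: "(\<integral>x. (S (r k) x - S (r j) x)^2 \<partial>Iv L) \<le> (1/4)^j" if "j \<le> k" for j k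
  proof -
    have "S (r k) x - S (r j) x = (\<Sum>n\<in>{r j..<r k}. a n * cs n x)" for x
      unfolding S_def using sum_diff_nat_ivl[of 0 "r j" "r k" "\<lambda>n. a n * cs n x"] r_mono[OF that]
      by (simp add: lessThan_atLeast0)
    then have "(\<integral>x. (S (r k) x - S (r j) x)^2 \<partial>Iv L) = (\<Sum>n\<in>{r j..<r k}. (a n)^2)"
      by (simp add: integral_finite_sum_sq)
    also have "\<dots> \<le> tl (r j)" by (rule tl[OF r_mono[OF that]])
    also have "\<dots> \<le> (1/4)^j" by (rule r_tl)
    finally show ?thesis .
  qed
  define g where "g k x = S (r (Suc k)) x - S (r k) x" for k x
  have Lg: "L2 L (g k)" for k unfolding g_def[abs_def] by (intro L2_diff LS)
  have ng: "L2norm L (g k) \<le> (1/2)^k" for k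
  proof -
    have "L2norm L (g k) \<le> sqrt ((1/4)^k)"
      unfolding L2norm_def g_def using diff[of k "Suc k"] by (intro real_sqrt_le_mono) simp
    also have "sqrt ((1/4::real)^k) = (1/2)^k" by (simp add: real_sqrt_power real_sqrt_divide)
    finally show ?thesis .
  qed
  have sg: "summable (\<lambda>k. \<integral>x. \<bar>g k x\<bar> \<partial>Iv L)"
  proof (rule summable_comparison_test[OF exI[of _ 0]])
    show "\<forall>k\<ge>0. norm (\<integral>x. \<bar>g k x\<bar> \<partial>Iv L) \<le> sqrt L * (1/2)^k"
    proof (intro allI impI)
      fix k
      have "(\<integral>x. \<bar>g k x\<bar> \<partial>Iv L) \<le> sqrt L * L2norm L (g k)" by (rule L1_le_L2norm[OF Lg])
      also have "\<dots> \<le> sqrt L * (1/2)^k" using ng[of k] L_pos by (intro mult_left_mono) auto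
      finally show "norm (\<integral>x. \<bar>g k x\<bar> \<partial>Iv L) \<le> sqrt L * (1/2)^k" by simp
    qed
    show "summable (\<lambda>k. sqrt L * (1/2)^k)" by (intro summable_mult summable_geometric) simp
  qed
  have mg [measurable]: "g k \<in> borel_measurable (Iv L)" for k using Lg[of k] by (simp add: L2_def)
  have "(\<integral>\<^sup>+x. (\<Sum>k. ennreal \<bar>g k x\<bar>) \<partial>Iv L) = (\<Sum>k. \<integral>\<^sup>+x. ennreal \<bar>g k x\<bar> \<partial>Iv L)"
    by (rule nn_integral_suminf) simp
  also have "\<dots> = (\<Sum>k. ennreal (\<integral>x. \<bar>g k x\<bar> \<partial>Iv L))"
    using L2_integrable[OF Lg] by (subst nn_integral_eq_integral) auto
  also have "\<dots> \<noteq> \<infinity>" using sg by (simp add: suminf_ennreal_eq[OF _ summable_sums])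
  finally have "AE x in Iv L. (\<Sum>k. ennreal \<bar>g k x\<bar>) \<noteq> \<infinity>"
    by (intro nn_integral_PInf_AE) simp_all
  then have conv: "AE x in Iv L. summable (\<lambda>k. g k x)"
  proof eventually_elim
    case (elim x)
    then have "summable (\<lambda>k. \<bar>g k x\<bar>)" by (intro summable_suminf_not_top) auto
    then show ?case by (rule summable_rabs_cancel)
  qed
  define G where "G x = S (r 0) x + (\<Sum>k. g k x)" for x
  have mS [measurable]: "S N \<in> borel_measurable (Iv L)" for N using LS[of N] by (simp add: L2_def)
  have mG [measurable]: "G \<in> borel_measurable (Iv L)" unfolding G_def[abs_def] by measurable
  have lim: "AE x in Iv L. (\<lambda>k. S (r k) x) \<longlonglongrightarrow> G x"
    using conv
  proof eventually_elim
    case (elim x)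
    have "S (r 0) x + (\<Sum>k<n. g k x) = S (r n) x" for n
      unfolding g_def by (subst sum_lessThan_telescope) simp
    then show ?case using tendsto_add[OF tendsto_const summable_LIMSEQ[OF elim], of "S (r 0) x"]
      by (simp add: G_def)
  qed
  have b0: "(\<integral>x. (S (r j) x)^2 \<partial>Iv L) \<le> (\<Sum>n. (a n)^2)" for j
    unfolding S_def by (subst integral_finite_sum_sq) (auto intro: sum_le_suminf[OF a])
  have LG: "L2 L G" and nG: "(\<integral>x. (G x)^2 \<partial>Iv L) \<le> (\<Sum>n. (a n)^2)"
    using L2_Fatou[OF LS lim mG b0] by auto
  have cG: "coef n G = a n" for n
  proof -
    have "(coef n G - a n)^2 \<le> (1/4)^k" if "n < k" for k
    proof -
      \<comment> \<open>Fatou is applied a second time, now to differences from a fixed partial sum: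
        this bounds the error of the coefficient by the tail.\<close>
      have l: "AE x in Iv L. (\<lambda>j. S (r (j + k)) x - S (r k) x) \<longlonglongrightarrow> G x - S (r k) x"
        using lim by eventually_elim (intro tendsto_intros LIMSEQ_ignore_initial_segment)
      have b: "(\<integral>x. (G x - S (r k) x)^2 \<partial>Iv L) \<le> (1/4)^k"
        by (rule L2_Fatou(2)[OF _ l]) (auto intro!: LS diff)
      have "n < r k" using that by (simp add: r_def)
      then have "coef n (S (r k)) = a n" unfolding S_def[abs_def] by (subst coef_finite_sum) auto
      then have "coef n G - a n = coef n (\<lambda>x. G x - S (r k) x)"
        using LG LS by (simp add: coef_diff L2_integrable)
      then show ?thesis using coef_sq_le[OF L2_diff[OF LG LS], of n "r k"] b by (simp add: L2norm_sq)
    qed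
    moreover have "(\<lambda>k. (1/4::real)^k) \<longlonglongrightarrow> 0" by (intro LIMSEQ_power_zero) simp
    ultimately have "(coef n G - a n)^2 \<le> 0"
      by (intro LIMSEQ_le_const[of "\<lambda>k. (1/4::real)^k" 0]) (auto intro!: exI[of _ "Suc n"])
    then show ?thesis by simp
  qed
  show ?thesis by (rule that[OF LG cG]) (use nG in \<open>simp add: L2norm_sq\<close>)
qed

text \<open>Bessel gives one inequality. For the other, the function rebuilt from the coefficients
  satisfies the norm bound and, by completeness, is \<open>f\<close> almost everywhere.\<close>

lemma parseval:
  assumes f: "L2 L f"
  shows "(L2norm L f)^2 = (\<Sum>n. (coef n f)^2)"
proof (rule antisym)
  obtain G where G: "L2 L G" "\<And>n. coef n G = coef n f" "(L2norm L G)^2 \<le> (\<Sum>n. (coef n f)^2)"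
    using riesz_fischer[OF bessel(1)[OF f]] by blast
  have "AE x in Iv L. f x = G x" using AE_eq_if_coef_eq[OF f[THEN L2_integrable] G(1)[THEN L2_integrable]] G(2) by simp
  then have "L2norm L f = L2norm L G" using L2norm_cong_AE f G(1) by blast
  then show "(L2norm L f)^2 \<le> (\<Sum>n. (coef n f)^2)" using G(3) by simp
  show "(\<Sum>n. (coef n f)^2) \<le> (L2norm L f)^2" by (rule bessel(2)[OF f])
qed

definition fser :: "(nat \<Rightarrow> real) \<Rightarrow> real \<Rightarrow> real" where
  "fser a = (SOME G. L2 L G \<and> (\<forall>n. coef n G = a n))"

lemma fser:
  assumes "summable (\<lambda>n. (a n :: real)^2)"
  shows L2_fser: "L2 L (fser a)" and coef_fser: "coef n (fser a) = a n"
proof -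
  have "\<exists>G. L2 L G \<and> (\<forall>n. coef n G = a n)" by (rule riesz_fischer[OF assms]) blast
  then have "L2 L (fser a) \<and> (\<forall>n. coef n (fser a) = a n)" unfolding fser_def by (rule someI_ex)
  then show "L2 L (fser a)" "coef n (fser a) = a n" by auto
qed


text \<open>Two integrations by parts. In the first the boundary terms carry the sine, which
  vanishes at both ends, so the values of \<open>z\<close> drop out and only its Neumann data
  remain.\<close>

lemma coef_dx2:
  assumes z: "Hk L 2 z"
  shows "coef n (dx L 2 z) =
    amp n * (bval L (dx L 1 z) L * (-1)^n - bval L (dx L 1 z) 0) - ((freq n)^2) * coef n z"
proof -
  have w1: "weak_deriv L z (dx L 1 z)" using Hk_dx(2)[OF z, of 0] by simp
  have w2: "weak_deriv L (dx L 1 z) (dx L 2 z)" using Hk_dx(2)[OF z, of 1] by (simp add: numeral_2_eq_2)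
  have "(\<integral>x. dx L 1 z x * sn n x \<partial>Iv L) = bval L z L * sn n L - bval L z 0 * sn n 0 - (\<integral>x. z x * (freq n * cs n x) \<partial>Iv L)"
    by (rule IBP_weak[OF w1 sn_DERIV]) (intro continuous_intros cs_continuous)
  also have "(\<integral>x. z x * (freq n * cs n x) \<partial>Iv L) = freq n * coef n z"
    unfolding coef_def by (subst integral_mult_right_zero[symmetric]) (simp add: algebra_simps)
  finally have 1: "(\<integral>x. dx L 1 z x * sn n x \<partial>Iv L) = - freq n * coef n z" by (simp add: sn_0 sn_L)
  have "coef n (dx L 2 z) = bval L (dx L 1 z) L * cs n L - bval L (dx L 1 z) 0 * cs n 0 - (\<integral>x. dx L 1 z x * (- freq n * sn n x) \<partial>Iv L)"
    unfolding coef_def by (rule IBP_weak[OF w2 cs_DERIV]) (intro continuous_intros sn_continuous)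
  also have "(\<integral>x. dx L 1 z x * (- freq n * sn n x) \<partial>Iv L) = - freq n * (\<integral>x. dx L 1 z x * sn n x \<partial>Iv L)"
    by (subst integral_mult_right_zero[symmetric]) (simp add: algebra_simps)
  finally show ?thesis unfolding 1 by (simp add: cs_0 cs_L algebra_simps power2_eq_square)
qed

lemma Sbar_coef_dx2: "Sbar L z \<Longrightarrow> coef n (dx L 2 z) = - ((freq n)^2) * coef n z"
  by (simp add: Sbar_def coef_dx2)

text \<open>The second-derivative formula applied to \<open>dx L 2 z\<close>, whose Neumann data are
  the third derivative of \<open>z\<close>. Equal values at both ends produce the factor
  \<open>(-1)^n - 1\<close>, which is zero for even \<open>n\<close>.\<close>

lemma coef_dx4:
  assumes S: "Sbar L z" and H: "Hk L 4 z"
    and b: "bval L (dx L 3 z) 0 = \<beta>" "bval L (dx L 3 z) L = \<beta>"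
  shows "coef n (dx L 4 z) = amp n * (\<beta> * ((-1)^n - 1)) + (freq n)^4 * coef n z"
proof -
  have H2: "Hk L 2 (dx L 2 z)" unfolding Hk_def
  proof (intro exI[of _ "\<lambda>j. dx L (j + 2) z"] conjI allI impI)
    show "L2 L (dx L (j + 2) z)" if "j \<le> 2" for j using Hk_dx(1)[OF H, of "j+2"] that by simp
    show "weak_deriv L (dx L (j + 2) z) (dx L (Suc j + 2) z)" if "j < 2" for j
      using Hk_dx(2)[OF H, of "j+2"] that by simp
  qed (simp add: numeral_2_eq_2)
  have "dx L 2 (dx L 2 z) = dx L 4 z" "dx L 1 (dx L 2 z) = dx L 3 z"
    by (simp_all only: dx_add[symmetric]) (simp_all add: eval_nat_numeral)
  then show ?thesis using coef_dx2[OF H2, of n] b Sbar_coef_dx2[OF S, of n]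
    by (simp add: algebra_simps power_add[symmetric] power2_eq_square power4_eq_xxxx)
qed

lemma coef_const: "coef n (\<lambda>x. c) = (if n = 0 then c / amp 0 else 0)"
proof -
  have "coef n (\<lambda>x. (c / amp 0) * cs 0 x) = (if n = 0 then c / amp 0 else 0)"
    unfolding coef_cmult coef_cs by simp
  then show ?thesis using amp_pos[of 0] by (simp add: cs_def)
qed

text \<open>Integrating the candidate second derivative twice from \<open>0\<close> builds a function with zero
  Neumann data; its coefficients agree with those of \<open>u\<close>, so no sine series is needed.\<close>

lemma Sbar_if_coef_decay:
  assumes u: "L2 L u" and s: "summable (\<lambda>n. (freq n)^4 * (coef n u)^2)"
  shows "Sbar L u"
proof -
  have s': "summable (\<lambda>n. (- ((freq n)^2) * coef n u)^2)"
    using s by (simp add: power_mult_distrib power_mult[symmetric])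
  define G where "G = fser (\<lambda>n. - ((freq n)^2) * coef n u)"
  have G: "L2 L G" "\<And>n. coef n G = - ((freq n)^2) * coef n u"
    unfolding G_def by (rule L2_fser[OF s'], rule coef_fser[OF s'])
  have iG: "integrable (Iv L) G" by (rule L2_integrable[OF G(1)])
  have "coef 0 G = amp 0 * (\<integral>x. G x \<partial>Iv L)" by (simp add: coef_def cs_def)
  \<comment> \<open>Since \<open>freq 0 = 0\<close>, the candidate second derivative has mean zero;
    its primitive from 0 therefore vanishes at \<open>L\<close> too.\<close>
  then have G0: "(\<integral>x. G x \<partial>Iv L) = 0" using G(2)[of 0] amp_pos[of 0] by simp
  define v where "v = prim G"
  have vc: "continuous_on {0..L} v" unfolding v_def by (rule prim_continuous[OF iG])
  have iv: "integrable (Iv L) v" by (rule integrable_continuous_Iv[OF vc])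
  \<comment> \<open>Comparison of second derivatives says nothing about mode 0; this constant of
    integration makes the zeroth coefficients agree.\<close>
  define \<gamma> where "\<gamma> = amp 0 * (coef 0 u - coef 0 (prim v))"
  define z where "z = (\<lambda>x. \<gamma> + prim v x)"
  have zc: "continuous_on {0..L} z" unfolding z_def by (intro continuous_intros prim_continuous iv)
  define D where "D = (\<lambda>j::nat. if j = 0 then z else if j = 1 then v else G)"
  have D1: "L2 L (D j)" for j unfolding D_def using G zc vc by (auto intro: L2_continuous)
  have D2: "weak_deriv L (D j) (D (Suc j))" if "j < 2" for j
  proof -
    have "weak_deriv L z v" unfolding z_def by (rule weak_deriv_prim[OF iv])
    moreover have "weak_deriv L v G" using weak_deriv_prim[OF iG, of 0] by (simp add: v_def)
    ultimately show ?thesis using that by (auto simp: D_def less_2_cases_iff)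
  qed
  have bv: "bval L (dx L 1 f) 0 = 0 \<and> bval L (dx L 1 f) L = 0" if "AE x in Iv L. dx L 1 f x = D 1 x" for f
  proof -
    have e: "AE x in Iv L. v x = dx L 1 f x" using that by eventually_elim (simp add: D_def)
    show ?thesis using bval_eqI[OF vc e] L_pos G0 by (simp add: v_def prim_0 prim_L)
  qed
  have zD: "AE x in Iv L. z x = D 0 x" by (simp add: D_def)
  note cz = dx_chain[of z D 2, OF L2_continuous[OF zc] zD D1 D2]
  have Sz: "Sbar L z" unfolding Sbar_def using cz(3) cz(1)[of 1] bv[of z] by simp
  have "coef n z = coef n u" for n
  proof (cases "n = 0")
    case True
    have "coef 0 z = coef 0 (\<lambda>x. \<gamma>) + coef 0 (prim v)"
      unfolding z_def using prim_continuous[OF iv] by (intro coef_add) (simp_all add: integrable_continuous_Iv)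
    then show ?thesis using True amp_pos[of 0] by (simp add: coef_const \<gamma>_def)
  next
    case False
    have "coef n (dx L 2 z) = coef n G"
      using cz(1)[of 2] L2_integrable by (intro coef_cong_AE) (auto simp: D_def)
    then have "(freq n)^2 * coef n z = (freq n)^2 * coef n u" using Sbar_coef_dx2[OF Sz, of n] G(2)[of n] by simp
    then show ?thesis using False L_pos by (simp add: freq_def)
  qed
  then have uD: "AE x in Iv L. u x = D 0 x"
    unfolding D_def using AE_eq_if_coef_eq[OF L2_integrable[OF u] integrable_continuous_Iv[OF zc]] by simp
  note cu = dx_chain[of u D 2, OF u uD D1 D2]
  show "Sbar L u" unfolding Sbar_def using cu(3) cu(1)[of 1] bv[of u] by simp
qed

text \<open>A Poincare inequality: the first derivative vanishes at 0, hence is pointwise at most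
  the L^1 norm of the second. It bounds odd derivatives without expanding them in sines.\<close>

lemma L2norm_dx1_le:
  assumes S: "Sbar L u"
  shows "(L2norm L (dx L 1 u))^2 \<le> L^2 * (L2norm L (dx L 2 u))^2"
proof -
  have H: "Hk L 2 u" using S by (simp add: Sbar_def)
  have w: "weak_deriv L (dx L 1 u) (dx L 2 u)" using Hk_dx(2)[OF H, of 1] by (simp add: numeral_2_eq_2)
  have l: "L2 L (dx L 1 u)" "L2 L (dx L 2 u)" using Hk_dx(1)[OF H] by auto
  let ?N = "sqrt L * L2norm L (dx L 2 u)"
  have "(L2norm L (dx L 1 u))^2 \<le> (\<integral>x. ?N^2 \<partial>Iv L)"
    unfolding L2norm_sq
  proof (rule integral_mono_AE)
    show "integrable (Iv L) (\<lambda>x. (dx L 1 u x)^2)" using l by (simp add: L2_def)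
    show "AE x in Iv L. (dx L 1 u x)^2 \<le> ?N^2"
      using bval_weak_deriv(1)[OF w]
    proof eventually_elim
      case (elim x)
      then have "\<bar>dx L 1 u x\<bar> \<le> (\<integral>x. \<bar>dx L 2 u x\<bar> \<partial>Iv L)"
        using S prim_bound[OF L2_integrable[OF l(2)], of x] by (simp add: Sbar_def)
      also have "\<dots> \<le> ?N" by (rule L1_le_L2norm[OF l(2)])
      finally have "\<bar>dx L 1 u x\<bar> \<le> \<bar>?N\<bar>" by simp
      then show ?case by (simp only: abs_le_square_iff)
    qed
  qed simp
  also have "\<dots> = L^2 * (L2norm L (dx L 2 u))^2"
    using L_pos by (simp add: power_mult_distrib power2_eq_square)
  finally show ?thesis .
qed

section \<open>Sobolev norms and weighted sums of squared coefficients\<close>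

lemma Hnorm_sq: "(Hnorm L k f)^2 = (\<Sum>j\<le>k. (L2norm L (dx L j f))^2)"
  unfolding Hnorm_def by (simp add: sum_nonneg)

lemma Hnorm_nonneg: "0 \<le> Hnorm L k f"
  unfolding Hnorm_def by (simp add: sum_nonneg)

lemma coef_decay_interpolate:
  assumes u: "L2 L u" and s: "summable (\<lambda>n. (freq n)^8 * (coef n u)^2)"
  shows "summable (\<lambda>n. (freq n)^4 * (coef n u)^2)"
    and "(\<Sum>n. (freq n)^4 * (coef n u)^2) \<le> (\<Sum>n. (1 + (freq n)^8) * (coef n u)^2)"
proof -
  have le: "k^4 \<le> 1 + k^8" for k :: real
    using le_one_plus_square[of "k^4"] by (simp add: power_mult[symmetric])
  have b: "(freq n)^4 * (coef n u)^2 \<le> (1 + (freq n)^8) * (coef n u)^2" for n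
    by (rule mult_right_mono[OF le]) simp
  have s': "summable (\<lambda>n. (1 + (freq n)^8) * (coef n u)^2)"
    unfolding distrib_right using summable_add[OF bessel(1)[OF u] s] by simp
  show s4: "summable (\<lambda>n. (freq n)^4 * (coef n u)^2)"
    by (rule summable_comparison_test'[OF s', of 0]) (use b in simp)
  show "(\<Sum>n. (freq n)^4 * (coef n u)^2) \<le> (\<Sum>n. (1 + (freq n)^8) * (coef n u)^2)"
    by (rule suminf_le[OF b s4 s'])
qed

lemma L2norm_dx2_sum:
  assumes u: "L2 L u" and s: "summable (\<lambda>n. (freq n)^4 * (coef n u)^2)"
  shows "(L2norm L (dx L 2 u))^2 = (\<Sum>n. (freq n)^4 * (coef n u)^2)"
proof -
  have S: "Sbar L u" by (rule Sbar_if_coef_decay[OF u s])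
  have "L2 L (dx L 2 u)" using S Hk_dx(1)[of 2 u 2] by (simp add: Sbar_def)
  from parseval[OF this] show ?thesis
    by (simp add: Sbar_coef_dx2[OF S] power_mult_distrib power_mult[symmetric])
qed

lemma sum_weight_split:
  assumes u: "L2 L u" and s: "summable (\<lambda>n. (freq n)^m * (coef n u)^2)"
  shows "(\<Sum>n. (1 + (freq n)^m) * (coef n u)^2) = (L2norm L u)^2 + (\<Sum>n. (freq n)^m * (coef n u)^2)"
  unfolding distrib_right parseval[OF u] using suminf_add[OF bessel(1)[OF u] s] by simp

text \<open>The constant is the one that the fourth-order estimate requires, so that both fit the
  common hypothesis of \<open>controlled_Hnorm\<close>.\<close>

lemma Hnorm2_le:
  assumes u: "L2 L u" and s: "summable (\<lambda>n. (freq n)^4 * (coef n u)^2)"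
  shows "(Hnorm L 2 u)^2 \<le> (2 + 2 * L^2) * (\<Sum>n. (1 + (freq n)^4) * (coef n u)^2)"
proof -
  note d = L2norm_dx1_le[OF Sbar_if_coef_decay[OF u s]] L2norm_dx2_sum[OF u s]
  define A B where "A = (L2norm L u)^2" and "B = (\<Sum>n. (freq n)^4 * (coef n u)^2)"
  have "{..2::nat} = {0,1,2}" by auto
  then have "(Hnorm L 2 u)^2 = A + (L2norm L (dx L 1 u))^2 + B"
    by (simp add: Hnorm_sq d(2) A_def B_def)
  also have "\<dots> \<le> A + L^2 * B + B" using d by (simp add: B_def)
  also have "\<dots> \<le> (2 + 2 * L^2) * (A + B)"
  proof -
    have "0 \<le> A" "0 \<le> L^2 * A" "0 \<le> L^2 * B" "0 \<le> B"
      using d(2) by (auto simp: A_def B_def simp flip: d(2))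
    then show ?thesis by (simp add: algebra_simps)
  qed
  finally show ?thesis unfolding A_def B_def sum_weight_split[OF u s] .
qed

text \<open>The second-order result is applied to \<open>u\<close> and then to
  \<open>dx L 2 u\<close>. The zero Neumann data of the latter are exactly the vanishing third
  derivatives of \<open>u\<close> at the ends.\<close>

lemma H4_if_coef_decay:
  assumes u: "L2 L u" and s: "summable (\<lambda>n. (freq n)^8 * (coef n u)^2)"
  shows "Sbar L u" "Hk L 4 u" "bval L (dx L 3 u) 0 = 0" "bval L (dx L 3 u) L = 0"
    and "(Hnorm L 4 u)^2 \<le> (2 + 2 * L^2) * (\<Sum>n. (1 + (freq n)^8) * (coef n u)^2)"
proof -
  note s4 = coef_decay_interpolate[OF u s]
  show S: "Sbar L u" by (rule Sbar_if_coef_decay[OF u s4(1)])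
  have H2: "Hk L 2 u" using S by (simp add: Sbar_def)
  have u2: "L2 L (dx L 2 u)" by (rule Hk_dx(1)[OF H2]) simp
  have c2: "(freq n)^4 * (coef n (dx L 2 u))^2 = (freq n)^8 * (coef n u)^2" for n
    by (simp add: Sbar_coef_dx2[OF S] power_mult_distrib power_mult[symmetric] power_add[symmetric] mult.assoc[symmetric])
  have s2: "summable (\<lambda>n. (freq n)^4 * (coef n (dx L 2 u))^2)" unfolding c2 by (rule s)
  have S2: "Sbar L (dx L 2 u)" by (rule Sbar_if_coef_decay[OF u2 s2])
  then have H22: "Hk L 2 (dx L 2 u)" by (simp add: Sbar_def)
  have sh: "dx L j (dx L 2 u) = dx L (j + 2) u" for j by (simp only: dx_add)
  show "Hk L 4 u" unfolding Hk_def
  proof (intro exI[of _ "\<lambda>j. dx L j u"] conjI allI impI)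
    show "L2 L (dx L j u)" if "j \<le> 4" for j
    proof (cases "j \<le> 2")
      case True then show ?thesis using Hk_dx(1)[OF H2, of j] by simp
    next
      case False
      then have "j - 2 + 2 = j" by simp
      then show ?thesis using Hk_dx(1)[OF H22, of "j - 2"] that sh[of "j - 2"] by simp
    qed
    show "weak_deriv L (dx L j u) (dx L (Suc j) u)" if "j < 4" for j
    proof (cases "j < 2")
      case True then show ?thesis using Hk_dx(2)[OF H2, of j] by simp
    next
      case False
      then obtain i where i: "j = i + 2" by (metis add.commute le_Suc_ex not_less)
      then show ?thesis using Hk_dx(2)[OF H22, of i] that sh[of i] sh[of "Suc i"] by simp
    qed
  qed simp
  have d3: "dx L 1 (dx L 2 u) = dx L 3 u" "dx L 2 (dx L 2 u) = dx L 4 u" by (simp_all only: dx_add[symmetric]) (simp_all add: eval_nat_numeral)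
  show "bval L (dx L 3 u) 0 = 0" "bval L (dx L 3 u) L = 0" using S2 d3 by (auto simp: Sbar_def)
  define A B C where "A = (L2norm L u)^2" and "B = (\<Sum>n. (freq n)^4 * (coef n u)^2)"
    and "C = (\<Sum>n. (freq n)^8 * (coef n u)^2)"
  have 2: "(L2norm L (dx L 2 u))^2 = B" unfolding B_def by (rule L2norm_dx2_sum[OF u s4(1)])
  have 4: "(L2norm L (dx L 4 u))^2 = C" using L2norm_dx2_sum[OF u2 s2] by (simp only: d3 c2 C_def)
  have 1: "(L2norm L (dx L 1 u))^2 \<le> L^2 * B" using L2norm_dx1_le[OF S] 2 by simp
  have 3: "(L2norm L (dx L 3 u))^2 \<le> L^2 * C" using L2norm_dx1_le[OF S2] 4 by (simp only: d3)
  have B: "B \<le> A + C" using s4(2) unfolding sum_weight_split[OF u s] by (simp add: A_def B_def C_def)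
  have "{..4::nat} = {0,1,2,3,4}" by auto
  then have "(Hnorm L 4 u)^2 = A + (L2norm L (dx L 1 u))^2 + B + (L2norm L (dx L 3 u))^2 + C"
    by (simp add: Hnorm_sq A_def 2 4)
  also have "\<dots> \<le> A + L^2 * B + B + L^2 * C + C" using 1 3 by simp
  also have "\<dots> \<le> A + L^2 * (A + C) + (A + C) + L^2 * C + C"
    using B mult_left_mono[OF B, of "L^2"] by simp
  also have "\<dots> \<le> (2 + 2 * L^2) * (A + C)"
  proof -
    have "0 \<le> L^2 * A" by (simp add: A_def)
    then show ?thesis by (simp add: algebra_simps)
  qed
  finally show "(Hnorm L 4 u)^2 \<le> (2 + 2 * L^2) * (\<Sum>n. (1 + (freq n)^8) * (coef n u)^2)"
    unfolding A_def C_def sum_weight_split[OF u s] .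
qed

lemma L2norm_add_sq:
  assumes "L2 L f" "L2 L g" "AE x in Iv L. h x = f x + c * g x" "L2 L h"
  shows "(L2norm L h)^2 \<le> 2 * (L2norm L f)^2 + 2 * c^2 * (L2norm L g)^2"
proof -
  have i: "integrable (Iv L) (\<lambda>x. (f x)^2)" "integrable (Iv L) (\<lambda>x. (g x)^2)" "integrable (Iv L) (\<lambda>x. (h x)^2)"
    using assms by (auto simp: L2_def)
  have ineq: "(a + c * b)^2 \<le> 2 * a^2 + 2 * c^2 * b^2" for a b :: real
    using sum_squares_bound[of a "c * b"] unfolding power2_sum power_mult_distrib by linarith
  have "(\<integral>x. (h x)^2 \<partial>Iv L) \<le> (\<integral>x. 2 * (f x)^2 + 2 * c^2 * (g x)^2 \<partial>Iv L)"
    by (rule integral_mono_AE) (use i assms(3) ineq in \<open>auto elim!: eventually_mono\<close>)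
  then show ?thesis using i by (simp add: L2norm_sq)
qed

lemma Hnorm_add_sq:
  assumes "Hk L k f" "Hk L k g" "AE x in Iv L. h x = f x + c * g x" "L2 L h"
  shows "(Hnorm L k h)^2 \<le> 2 * (Hnorm L k f)^2 + 2 * c^2 * (Hnorm L k g)^2"
proof -
  note l = dx_lincomb[OF assms(1,2,4,3)]
  have "(Hnorm L k h)^2 \<le> (\<Sum>j\<le>k. 2 * (L2norm L (dx L j f))^2 + 2 * c^2 * (L2norm L (dx L j g))^2)"
    unfolding Hnorm_sq
    by (rule sum_mono, rule L2norm_add_sq)
       (use l(2) Hk_dx(1)[OF assms(1)] Hk_dx(1)[OF assms(2)] Hk_dx(1)[OF l(1)] in auto)
  then show ?thesis by (simp add: Hnorm_sq sum.distrib sum_distrib_left)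
qed

text \<open>Classical derivatives are weak ones; this feeds the explicit cubic lift into the weak
  calculus.\<close>

lemma weak_deriv_C1:
  assumes d: "\<And>x. (f has_real_derivative f' x) (at x)" and c: "continuous_on UNIV f'"
  shows "weak_deriv L f f'"
  unfolding weak_deriv_iff
proof (intro conjI allI impI)
  have cf: "continuous_on {0..L} f" using d by (meson DERIV_isCont continuous_at_imp_continuous_on)
  have cf': "continuous_on {0..L} f'" using c continuous_on_subset by blast
  show i: "integrable (Iv L) f" "integrable (Iv L) f'" using cf cf' by (auto intro: integrable_continuous_Iv)
  fix \<psi> assume t: "test_fn L \<psi>"
  have i2: "integrable (Iv L) (\<lambda>x. f' x * \<psi> x)" "integrable (Iv L) (\<lambda>x. f x * deriv \<psi> x)"
    by (auto intro!: integrable_mult_continuous i test_fn_continuous[OF t] test_fn_deriv_continuous[OF t])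
  have "(\<integral>x. f' x * \<psi> x + f x * deriv \<psi> x \<partial>Iv L) = f L * \<psi> L - f 0 * \<psi> 0"
  proof (rule FTC_Iv[where F="\<lambda>x. f x * \<psi> x"])
    show "((\<lambda>x. f x * \<psi> x) has_real_derivative f' x * \<psi> x + f x * deriv \<psi> x) (at x)" for x
      using DERIV_mult[OF d test_fn_DERIV[OF t], of x] by (simp add: mult.commute)
  qed (intro continuous_intros cf cf' test_fn_continuous[OF t] test_fn_deriv_continuous[OF t])
  then show "(\<integral>x. f x * deriv \<psi> x \<partial>Iv L) = - (\<integral>x. f' x * \<psi> x \<partial>Iv L)"
    using i2 test_fn_boundary[OF t] by simp
qed

end

subsection \<open>Single modes\<close>

lemma at_within_atLeastAtMost_eq_atLeast:
  fixes t :: real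
  assumes "t < T"
  shows "at t within {0..T} = at t within {0..}"
  by (rule at_within_nhd[of t "{..<T}"]) (use assms in auto)

lemma at_within_atLeast_interior: "(0::real) < t \<Longrightarrow> at t within {0..} = at t"
  by (rule at_within_interior) simp

text \<open>Variation of constants with the integrating factor exp(-r t).\<close>

lemma linear_ode_complex:
  fixes F :: "real \<Rightarrow> complex" and r u0 :: complex
  assumes F: "continuous_on {0..} F"
  obtains u where "u 0 = u0"
    "\<And>t. 0 \<le> t \<Longrightarrow> (u has_vector_derivative (r * u t + F t)) (at t within {0..})"
proof -
  define g where "g = (\<lambda>s. exp (- (r * of_real s)) * F s)"
  define u where "u = (\<lambda>t. exp (r * of_real t) * (u0 + integral {0..t} g))"
  have "(u has_vector_derivative (r * u t + F t)) (at t within {0..})" if t: "0 \<le> t" for t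
  proof -
    have cg: "continuous_on {0..t+1} g" unfolding g_def
      by (intro continuous_intros continuous_on_subset[OF F]) auto
    have "((\<lambda>t. integral {0..t} g) has_vector_derivative g t) (at t within {0..t+1})"
      by (rule integral_has_vector_derivative[OF cg]) (use t in auto)
    then have i: "((\<lambda>t. u0 + integral {0..t} g) has_vector_derivative g t) (at t within {0..})"
      using at_within_atLeastAtMost_eq_atLeast[of t "t+1"] by (auto intro!: derivative_eq_intros)
    have e: "((\<lambda>t. exp (r * of_real t)) has_vector_derivative (r * exp (r * of_real t))) (at t within {0..})"
      by (rule has_vector_derivative_real_field) (auto intro!: derivative_eq_intros)
    have "(u has_vector_derivative (exp (r * of_real t) * g t + r * exp (r * of_real t) * (u0 + integral {0..t} g))) (at t within {0..})"
      unfolding u_def by (rule has_vector_derivative_mult[OF e i])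
    moreover have "exp (r * of_real t) * g t = F t"
      by (simp add: g_def exp_minus)
    ultimately show ?thesis by (simp add: u_def algebra_simps)
  qed
  moreover have "u 0 = u0" by (simp add: u_def)
  ultimately show ?thesis using that by blast
qed

text \<open>Factoring the characteristic polynomial over the complex numbers treats oscillating,
  critical and overdamped modes alike.\<close>

lemma mode_ode_exists:
  fixes F :: "real \<Rightarrow> real"
  assumes F: "continuous_on {0..} F"
  obtains y y1 where "y 0 = a" "y1 0 = p"
    "\<And>t. 0 \<le> t \<Longrightarrow> (y has_real_derivative y1 t) (at t within {0..})"
    "\<And>t. 0 \<le> t \<Longrightarrow> (y1 has_real_derivative (F t - b * y1 t - w * y t)) (at t within {0..})"
proof -
  define d where "d = csqrt (of_real (b^2 - 4 * w))"
  define r1 r2 where "r1 = (- of_real b + d) / 2" and "r2 = (- of_real b - d) / 2"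
  have sum: "r1 + r2 = - of_real b" by (simp add: r1_def r2_def field_simps)
  have "r1 * r2 = (of_real b ^ 2 - d^2) / 4" by (simp add: r1_def r2_def field_simps power2_eq_square)
  then have prod: "r1 * r2 = of_real w" by (simp add: d_def)
  have "continuous_on {0..} (\<lambda>t. complex_of_real (F t))" by (intro continuous_intros F)
  \<comment> \<open>The operator factors as (d/dt - r1)(d/dt - r2). The inner unknown is
    \<open>u = z' - r2 z\<close>, so its initial value must be \<open>p - r2 a\<close> for
    \<open>z\<close> to start at \<open>a\<close> with velocity \<open>p\<close>.\<close>
  from linear_ode_complex[OF this, of "of_real p - r2 * of_real a" r1]
  obtain u where u0: "u 0 = of_real p - r2 * of_real a"
    and u: "\<And>t. 0 \<le> t \<Longrightarrow> (u has_vector_derivative (r1 * u t + of_real (F t))) (at t within {0..})" by blast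
  have "continuous_on {0..} u"
    unfolding continuous_on_eq_continuous_within using u has_vector_derivative_continuous by fastforce
  from linear_ode_complex[OF this, of "of_real a" r2]
  obtain z where z0: "z 0 = of_real a"
    and z: "\<And>t. 0 \<le> t \<Longrightarrow> (z has_vector_derivative (r2 * z t + u t)) (at t within {0..})" by blast
  define z1 where "z1 = (\<lambda>t. r2 * z t + u t)"
  have z1: "(z1 has_vector_derivative (of_real (F t) - of_real b * z1 t - of_real w * z t)) (at t within {0..})" if "0 \<le> t" for t
  proof -
    have "(z1 has_vector_derivative (r2 * (r2 * z t + u t) + (r1 * u t + of_real (F t)))) (at t within {0..})"
      unfolding z1_def
      by (intro has_vector_derivative_add u that bounded_linear.has_vector_derivative[OF bounded_linear_mult_right] z)
    moreover have "r2 * (r2 * z t + u t) + (r1 * u t + of_real (F t)) = of_real (F t) + (r1 + r2) * z1 t - r1 * r2 * z t"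
      by (simp add: z1_def algebra_simps)
    ultimately show ?thesis unfolding sum prod by simp
  qed
  show ?thesis
  proof (rule that[of "\<lambda>t. Re (z t)" "\<lambda>t. Re (z1 t)"])
    show "Re (z 0) = a" by (simp add: z0)
    show "Re (z1 0) = p" by (simp add: z1_def z0 u0)
    fix t :: real assume t: "0 \<le> t"
    show "((\<lambda>t. Re (z t)) has_real_derivative Re (z1 t)) (at t within {0..})"
      unfolding has_real_derivative_iff_has_vector_derivative z1_def
      by (rule bounded_linear.has_vector_derivative[OF bounded_linear_Re z[OF t]])
    have "((\<lambda>t. Re (z1 t)) has_vector_derivative Re (of_real (F t) - of_real b * z1 t - of_real w * z t)) (at t within {0..})"
      by (rule bounded_linear.has_vector_derivative[OF bounded_linear_Re z1[OF t]])
    then show "((\<lambda>t. Re (z1 t)) has_real_derivative F t - b * Re (z1 t) - w * Re (z t)) (at t within {0..})"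
      unfolding has_real_derivative_iff_has_vector_derivative by simp
  qed
qed

section \<open>Energy estimates for a single mode\<close>

lemma nonincreasing_halfline:
  fixes E :: "real \<Rightarrow> real"
  assumes d: "\<And>t. 0 \<le> t \<Longrightarrow> t \<le> T \<Longrightarrow> (E has_real_derivative E' t) (at t within {0..})"
    and n: "\<And>t. 0 \<le> t \<Longrightarrow> t \<le> T \<Longrightarrow> E' t \<le> 0" and T: "0 \<le> T"
  shows "E T \<le> E 0"
proof (rule DERIV_nonpos_imp_decreasing_open[OF T])
  fix x assume x: "0 < x" "x < T"
  show "\<exists>y. DERIV E x :> y \<and> y \<le> 0"
    using d[of x] n[of x] x at_within_atLeast_interior[of x] by auto
next
  have "continuous (at x within {0..T}) E" if "x \<in> {0..T}" for x
    using DERIV_continuous[OF d[of x]] that by (auto intro: continuous_within_subset)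
  then show "continuous_on {0..T} E" by (simp add: continuous_on_eq_continuous_within)
qed

text \<open>Gronwall's inequality with the factor \<open>exp (- t)\<close> built in. The cross terms
  in \<open>y1 * y2\<close> cancel and damping only decreases the energy. Young's inequality bounds
  the work of the forcing by \<open>(y2 t)^2 + K\<close>; the derivative of the factor absorbs this
  because \<open>K\<close> is part of the bracket. In use, \<open>y1\<close> is the time derivative
  of a mode.\<close>

lemma mode_energy:
  fixes y1 y2 F' :: "real \<Rightarrow> real"
  assumes b: "0 \<le> b" and w: "0 \<le> w" and T: "0 \<le> T"
    and d1: "\<And>t. 0 \<le> t \<Longrightarrow> (y1 has_real_derivative y2 t) (at t within {0..})"
    and d2: "\<And>t. 0 \<le> t \<Longrightarrow> (y2 has_real_derivative (F' t - b * y2 t - w * y1 t)) (at t within {0..})"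
    and K: "\<And>t. 0 \<le> t \<Longrightarrow> t \<le> T \<Longrightarrow> (F' t)^2 \<le> K"
  shows "(y2 T)^2 + w * (y1 T)^2 \<le> exp T * ((y2 0)^2 + w * (y1 0)^2 + K)"
proof -
  let ?E = "\<lambda>t. exp (- t) * ((y2 t)^2 + w * (y1 t)^2 + K)"
  let ?E' = "\<lambda>t. exp (- t) * (2 * y2 t * (F' t - b * y2 t - w * y1 t) + w * (2 * y1 t * y2 t))
      - exp (- t) * ((y2 t)^2 + w * (y1 t)^2 + K)"
  have "?E T \<le> ?E 0"
  proof (rule nonincreasing_halfline[OF _ _ T, of ?E ?E'])
    fix t assume t: "0 \<le> t" "t \<le> T"
    show "(?E has_real_derivative ?E' t) (at t within {0..})"
      by (auto intro!: derivative_eq_intros d1[OF t(1)] d2[OF t(1)])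
    have "2 * y2 t * F' t \<le> (y2 t)^2 + (F' t)^2" using sum_squares_bound[of "y2 t" "F' t"] by simp
    then have "2 * y2 t * F' t \<le> (y2 t)^2 + K" using K[OF t] by linarith
    moreover have "0 \<le> b * (y2 t)^2" "0 \<le> w * (y1 t)^2" using b w by auto
    ultimately have "2 * y2 t * (F' t - b * y2 t - w * y1 t) + w * (2 * y1 t * y2 t) \<le> (y2 t)^2 + w * (y1 t)^2 + K"
      by (simp add: algebra_simps power2_eq_square)
    then show "?E' t \<le> 0" by simp
  qed
  then have "exp T * (exp (- T) * ((y2 T)^2 + w * (y1 T)^2 + K)) \<le> exp T * ((y2 0)^2 + w * (y1 0)^2 + K)"
    by (intro mult_left_mono) auto
  moreover have "exp T * (exp (- T) * X) = X" for X by (simp add: exp_minus)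
  moreover have "0 \<le> K" using K[of 0] T by (meson order_trans zero_le_power2 order_refl)
  ultimately show ?thesis by simp
qed

lemma increment_bound_halfline:
  fixes y :: "real \<Rightarrow> real"
  assumes d: "\<And>t. 0 \<le> t \<Longrightarrow> (y has_real_derivative y1 t) (at t within {0..})"
    and B: "\<And>t. 0 \<le> t \<Longrightarrow> t \<le> T \<Longrightarrow> \<bar>y1 t\<bar> \<le> B"
    and s: "0 \<le> s" "s \<le> T" "0 \<le> t" "t \<le> T"
  shows "\<bar>y t - y s\<bar> \<le> B * \<bar>t - s\<bar>"
proof -
  have "norm (y t - y s) \<le> B * norm (t - s)"
  proof (rule field_differentiable_bound[of "{0..T}"])
    fix z assume "z \<in> {0..T}"
    then show "(y has_field_derivative y1 z) (at z within {0..T})" "norm (y1 z) \<le> B"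
      using d[of z] B[of z] by (auto intro: DERIV_subset)
  qed (use s in auto)
  then show ?thesis by simp
qed

text \<open>For the zero mode the stiffness is 0 and the energy does not see \<open>y\<close>. Hence
  the energy is used only to kill \<open>y1\<close>, after which \<open>y\<close> keeps its initial
  value.\<close>

lemma mode_ode_unique:
  fixes y y1 :: "real \<Rightarrow> real"
  assumes b: "0 \<le> b" and w: "0 \<le> w"
    and d1: "\<And>t. 0 \<le> t \<Longrightarrow> (y has_real_derivative y1 t) (at t within {0..})"
    and d2: "\<And>t. 0 \<le> t \<Longrightarrow> (y1 has_real_derivative (- b * y1 t - w * y t)) (at t within {0..})"
    and i: "y 0 = 0" "y1 0 = 0" and t: "0 \<le> t"
  shows "y t = 0" "y1 t = 0"
proof -
  have z: "y1 T = 0" if T: "0 \<le> T" for T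
  proof -
    let ?E = "\<lambda>t. (y1 t)^2 + w * (y t)^2"
    have "?E T \<le> ?E 0"
    proof (rule nonincreasing_halfline[OF _ _ T, of ?E "\<lambda>t. - 2 * b * (y1 t)^2"])
      fix t :: real assume t: "0 \<le> t"
      show "(?E has_real_derivative - 2 * b * (y1 t)^2) (at t within {0..})"
        by (auto intro!: derivative_eq_intros d1[OF t] d2[OF t] simp: algebra_simps power2_eq_square)
      show "- 2 * b * (y1 t)^2 \<le> 0" using b by simp
    qed
    moreover have "0 \<le> w * (y T)^2" using w by simp
    moreover have "?E 0 = 0" by (simp add: i)
    ultimately have "(y1 T)^2 \<le> 0" by linarith
    then show ?thesis by simp
  qed
  then show "y1 t = 0" using t by blast
  have "\<bar>y t - y 0\<bar> \<le> 0 * \<bar>t - 0\<bar>"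
    by (rule increment_bound_halfline[OF d1, of t]) (use z t in auto)
  then show "y t = 0" using i by simp
qed

subsection \<open>Paths of cosine series\<close>

context bounded_interval begin

lemma L2norm_le_Hnorm: "L2norm L u \<le> Hnorm L k u"
proof -
  have "(L2norm L (dx L 0 u))^2 \<le> (\<Sum>j\<le>k. (L2norm L (dx L j u))^2)"
    by (rule member_le_sum) auto
  then show ?thesis unfolding Hnorm_def by (simp add: real_le_rsqrt)
qed

lemma deriv_path_L2norm:
  assumes "deriv_path (Hnorm L k) u v"
  shows "deriv_path (L2norm L) u v"
  unfolding deriv_path_def
proof (intro allI impI)
  fix t0 :: real assume "0 \<le> t0"
  then have "((\<lambda>t. Hnorm L k (\<lambda>x. (u t x - u t0 x) / (t - t0) - v t0 x)) \<longlongrightarrow> 0) (at t0 within {0..})"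
    using assms by (simp add: deriv_path_def)
  then show "((\<lambda>t. L2norm L (\<lambda>x. (u t x - u t0 x) / (t - t0) - v t0 x)) \<longlongrightarrow> 0) (at t0 within {0..})"
    by (rule tendsto_sandwich[OF _ _ tendsto_const, rotated 2]) (auto simp: L2norm_le_Hnorm)
qed

text \<open>A coefficient is a linear functional bounded by the L^2 norm, so it carries norm
  derivatives of paths to ordinary derivatives.\<close>

lemma coef_deriv_path:
  fixes u v :: "real \<Rightarrow> real \<Rightarrow> real"
  assumes d: "deriv_path (L2norm L) u v"
    and u: "\<And>t. 0 \<le> t \<Longrightarrow> L2 L (u t)" and v: "\<And>t. 0 \<le> t \<Longrightarrow> L2 L (v t)" and s: "0 \<le> s"
  shows "((\<lambda>t. coef n (u t)) has_real_derivative coef n (v s)) (at s within {0..})"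
  unfolding has_field_derivative_iff
proof (rule Lim_transform)
  show "((\<lambda>t. coef n (v s)) \<longlongrightarrow> coef n (v s)) (at s within {0..})" by simp
  let ?h = "\<lambda>t x::real. (u t x - u s x) / (t - s) - v s x"
  have "((\<lambda>t. L2norm L (?h t)) \<longlongrightarrow> 0) (at s within {0..})"
    using d s by (simp add: deriv_path_def)
  then have "((\<lambda>t. (coef n (u t) - coef n (u s)) / (t - s) - coef n (v s)) \<longlongrightarrow> 0) (at s within {0..})"
  proof (rule Lim_null_comparison[rotated])
    show "\<forall>\<^sub>F t in at s within {0..}. norm ((coef n (u t) - coef n (u s)) / (t - s) - coef n (v s)) \<le> L2norm L (?h t)"
      unfolding eventually_at_filter
    proof (intro always_eventually allI impI)
      fix t :: real assume "t \<in> {0..}"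
      then have t: "0 \<le> t" by simp
      have l: "L2 L (\<lambda>x. (u t x - u s x) / (t - s))" by (intro L2_divide L2_diff u s t)
      have "coef n (?h t) = (coef n (u t) - coef n (u s)) / (t - s) - coef n (v s)"
        using l u[OF t] u[OF s] v[OF s] by (simp add: coef_diff coef_divide L2_integrable)
      then show "norm ((coef n (u t) - coef n (u s)) / (t - s) - coef n (v s)) \<le> L2norm L (?h t)"
        using abs_coef_le[OF L2_diff[OF l v[OF s]], of n] by simp
    qed
  qed
  then show "((\<lambda>t. (coef n (u t) - coef n (u s)) / (t - s) - coef n (v s)) \<longlongrightarrow> 0) (at s within {0..})" .
qed

text \<open>Tannery's theorem, that is, dominated convergence for series. The bound excludes
  \<open>t = s\<close> because \<open>Q\<close> may be a difference quotient, and it is asked for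
  only up to \<open>s + 1\<close> because the limit is local.\<close>

lemma weighted_sum_tendsto_0:
  fixes Q :: "real \<Rightarrow> nat \<Rightarrow> real"
  assumes lim: "\<And>n. ((\<lambda>t. Q t n) \<longlongrightarrow> 0) (at s within {0..})" and s: "0 \<le> s"
    and M: "summable M" and wt: "\<And>n. 0 \<le> wt n"
    and b: "\<And>t n. 0 \<le> t \<Longrightarrow> t \<le> s + 1 \<Longrightarrow> t \<noteq> s \<Longrightarrow> wt n * (Q t n)^2 \<le> M n"
  shows "((\<lambda>t. \<Sum>n. wt n * (Q t n)^2) \<longlongrightarrow> 0) (at s within {0..})"
proof -
  \<comment> \<open>Tannery's theorem requires a nontrivial filter; points to the right of
    \<open>s\<close> provide one, also at \<open>s = 0\<close>.\<close>
  have ne: "at s within {0..} \<noteq> bot"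
  proof -
    have "at s within {s..s+1} \<noteq> bot" by (simp add: at_within_Icc_at_right)
    moreover have "at s within {s..s+1} \<le> at s within {0..}" by (rule at_le) (use s in auto)
    ultimately show ?thesis by (metis bot.extremum_uniqueI)
  qed
  have near: "\<forall>\<^sub>F t in at s within {0..}. 0 \<le> t \<and> t \<le> s + 1 \<and> t \<noteq> s"
    unfolding eventually_at by (rule exI[of _ 1]) (auto simp: dist_real_def)
  have "((\<lambda>t. \<Sum>n. wt n * (Q t n)^2) \<longlongrightarrow> (\<Sum>n::nat. 0::real)) (at s within {0..})"
  proof (rule tannerys_theorem[THEN conjunct2, THEN conjunct2, OF _ _ M ne])
    show "((\<lambda>t. wt n * (Q t n)^2) \<longlongrightarrow> 0) (at s within {0..})" for n
      using tendsto_mult[OF tendsto_const tendsto_power[OF lim[of n], of 2], of "wt n"] by simp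
    have "\<forall>\<^sub>F (n::nat, t) in at_top \<times>\<^sub>F (at s within {0..}). 0 \<le> t \<and> t \<le> s + 1 \<and> t \<noteq> s"
      using near by (subst eventually_prod2) (auto simp: trivial_limit_at_top_linorder)
    then show "\<forall>\<^sub>F (n, t) in at_top \<times>\<^sub>F (at s within {0..}). norm (wt n * (Q t n)^2) \<le> M n"
      by eventually_elim (auto simp: abs_mult wt b)
  qed
  then show ?thesis by simp
qed

text \<open>The solution is a cosine series plus a multiple of a fixed lift \<open>w\<close> of the boundary data;
  this predicate lets the three norms of the solution space be treated uniformly.\<close>

definition controlled :: "((real \<Rightarrow> real) \<Rightarrow> real) \<Rightarrow> (nat \<Rightarrow> real) \<Rightarrow> (real \<Rightarrow> real) \<Rightarrow> bool" where
  "controlled N wt w \<longleftrightarrow> (\<forall>n. 1 \<le> wt n) \<and> (\<forall>u. 0 \<le> N u) \<and>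
    (\<exists>C. \<forall>u h c. L2 L u \<longrightarrow> summable (\<lambda>n. wt n * (coef n u)^2) \<longrightarrow>
       h = (\<lambda>x. u x + c * w x) \<longrightarrow> (N h)^2 \<le> C * (\<Sum>n. wt n * (coef n u)^2) + C * c^2)"

text \<open>Reduces convergence in any of the controlled norms to convergence of each coefficient
  under a common summable majorant.\<close>

lemma controlled_tendsto_0:
  fixes u :: "real \<Rightarrow> real \<Rightarrow> real"
  assumes N: "controlled N wt w" and s: "0 \<le> s"
    and u: "\<And>t. 0 \<le> t \<Longrightarrow> L2 L (u t)"
    and lim: "\<And>n. ((\<lambda>t. coef n (u t)) \<longlongrightarrow> 0) (at s within {0..})"
    and M: "summable M" 
    and b: "\<And>t n. 0 \<le> t \<Longrightarrow> t \<le> s + 1 \<Longrightarrow> t \<noteq> s \<Longrightarrow> wt n * (coef n (u t))^2 \<le> M n"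
    and c: "(c \<longlongrightarrow> 0) (at s within {0..})"
  shows "((\<lambda>t. N (\<lambda>x. u t x + c t * w x)) \<longlongrightarrow> 0) (at s within {0..})"
proof -
  have wt: "1 \<le> wt n" for n using N by (simp add: controlled_def)
  have N0: "0 \<le> N u" for u using N by (simp add: controlled_def)
  have "\<exists>C. \<forall>u h c. L2 L u \<longrightarrow> summable (\<lambda>n. wt n * (coef n u)^2) \<longrightarrow>
       h = (\<lambda>x. u x + c * w x) \<longrightarrow> (N h)^2 \<le> C * (\<Sum>n. wt n * (coef n u)^2) + C * c^2"
    using N unfolding controlled_def by (elim conjE)
  then obtain C where C0: "\<forall>u h c. L2 L u \<longrightarrow> summable (\<lambda>n. wt n * (coef n u)^2) \<longrightarrow>
       h = (\<lambda>x. u x + c * w x) \<longrightarrow> (N h)^2 \<le> C * (\<Sum>n. wt n * (coef n u)^2) + C * c^2" ..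
  have C: "(N (\<lambda>x. u x + c * w x))^2 \<le> C * (\<Sum>n. wt n * (coef n u)^2) + C * c^2"
    if "L2 L u" "summable (\<lambda>n. wt n * (coef n u)^2)" for u c
    using C0 that by simp
  have wt0: "0 \<le> wt n" for n using wt[of n] by simp
  have "((\<lambda>t. C * (\<Sum>n. wt n * (coef n (u t))^2) + C * (c t)^2) \<longlongrightarrow> C * 0 + C * 0^2) (at s within {0..})"
    by (intro tendsto_intros weighted_sum_tendsto_0[OF lim s M wt0 b] c)
  then have l: "((\<lambda>t. C * (\<Sum>n. wt n * (coef n (u t))^2) + C * (c t)^2) \<longlongrightarrow> 0) (at s within {0..})" by simp
  have near: "\<forall>\<^sub>F t in at s within {0..}. 0 \<le> t \<and> t \<le> s + 1 \<and> t \<noteq> s"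
    unfolding eventually_at by (rule exI[of _ 1]) (auto simp: dist_real_def)
  have "((\<lambda>t. (N (\<lambda>x. u t x + c t * w x))^2) \<longlongrightarrow> 0) (at s within {0..})"
  proof (rule tendsto_sandwich[OF _ _ tendsto_const l])
    show "\<forall>\<^sub>F t in at s within {0..}. (N (\<lambda>x. u t x + c t * w x))^2 \<le> C * (\<Sum>n. wt n * (coef n (u t))^2) + C * (c t)^2"
      using near
    proof eventually_elim
      case (elim t)
      have "summable (\<lambda>n. wt n * (coef n (u t))^2)"
        by (rule summable_comparison_test'[OF M, of 0]) (use b elim wt0 in \<open>simp add: abs_mult\<close>)
      then show ?case using C[OF u] elim by simp
    qed
  qed simp
  then have "((\<lambda>t. sqrt ((N (\<lambda>x. u t x + c t * w x))^2)) \<longlongrightarrow> sqrt 0) (at s within {0..})"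
    by (rule tendsto_real_sqrt)
  then show ?thesis using N0 by simp
qed

lemma cont_path_fser:
  assumes N: "controlled N wt w"
    and y: "\<And>n t. 0 \<le> t \<Longrightarrow> continuous (at t within {0..}) (y n)"
    and M: "\<And>T. 0 \<le> T \<Longrightarrow> summable (M T)"
    and b: "\<And>T t n. 0 \<le> t \<Longrightarrow> t \<le> T \<Longrightarrow> wt n * (y n t)^2 \<le> M T n"
    and c: "\<And>t. 0 \<le> t \<Longrightarrow> continuous (at t within {0..}) c"
  shows "cont_path N (\<lambda>t x. fser (\<lambda>n. y n t) x + c t * w x)"
  unfolding cont_path_def
proof (intro allI impI)
  fix s :: real assume s: "0 \<le> s"
  have wt: "1 \<le> wt n" for n using N by (simp add: controlled_def)
  have sq: "summable (\<lambda>n. (y n t)^2)" if "0 \<le> t" for t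
  proof (rule summable_comparison_test'[OF M[OF that], of 0])
    fix n
    have "1 * (y n t)^2 \<le> wt n * (y n t)^2" by (rule mult_right_mono[OF wt]) simp
    then show "norm ((y n t)^2) \<le> M t n" using b[of t t n] that by simp
  qed
  let ?u = "\<lambda>t x. fser (\<lambda>n. y n t) x - fser (\<lambda>n. y n s) x"
  have cf: "coef n (?u t) = y n t - y n s" if "0 \<le> t" for t n
    using fser[OF sq[OF that]] fser[OF sq[OF s]] by (simp add: coef_diff L2_integrable)
  have "((\<lambda>t. N (\<lambda>x. ?u t x + (c t - c s) * w x)) \<longlongrightarrow> 0) (at s within {0..})"
  proof (rule controlled_tendsto_0[OF N s])
    show "L2 L (?u t)" if "0 \<le> t" for t using fser[OF sq[OF that]] fser[OF sq[OF s]] by auto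
    have near: "\<forall>\<^sub>F t in at s within {0..}. 0 \<le> t"
      unfolding eventually_at by (rule exI[of _ 1]) auto
    show "((\<lambda>t. coef n (?u t)) \<longlongrightarrow> 0) (at s within {0..})" for n
    proof (rule Lim_transform_eventually)
      show "((\<lambda>t. y n t - y n s) \<longlongrightarrow> 0) (at s within {0..})"
        using y[OF s, of n] by (simp add: continuous_within LIM_zero_iff)
      show "\<forall>\<^sub>F t in at s within {0..}. y n t - y n s = coef n (?u t)"
        using near by eventually_elim (simp add: cf)
    qed
    show "((\<lambda>t. c t - c s) \<longlongrightarrow> 0) (at s within {0..})"
      using c[OF s] by (simp add: continuous_within LIM_zero_iff)
    \<comment> \<open>The factor 4 comes from (a - b)^2 <= 2 a^2 + 2 b^2 with both squares below the
      same majorant.\<close>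
    show "summable (\<lambda>n. 4 * M (s + 1) n)" using M[of "s+1"] s by (simp add: summable_mult)
    fix t n assume t: "0 \<le> t" "t \<le> s + 1"
    have "(y n t - y n s)^2 \<le> 2 * (y n t)^2 + 2 * (y n s)^2"
      using sum_squares_bound[of "y n t" "- y n s"] by (simp add: power2_diff)
    then have "wt n * (y n t - y n s)^2 \<le> wt n * (2 * (y n t)^2 + 2 * (y n s)^2)"
      using wt[of n] by (intro mult_left_mono) auto
    then show "wt n * (coef n (?u t))^2 \<le> 4 * M (s + 1) n"
      using b[of t "s+1" n] b[of s "s+1" n] t s by (simp add: cf algebra_simps)
  qed
  then show "((\<lambda>t. N (\<lambda>x. (fser (\<lambda>n. y n t) x + c t * w x) - (fser (\<lambda>n. y n s) x + c s * w x))) \<longlongrightarrow> 0) (at s within {0..})"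
    by (simp add: algebra_simps)
qed

text \<open>The mean value inequality bounds difference quotients of \<open>y n\<close> by the
  supremum of \<open>y' n\<close>. A majorant for the derivative in the weight of \<open>N\<close>
  therefore suffices, while \<open>y\<close> itself need only be square-summable.\<close>

lemma deriv_path_fser:
  assumes N: "controlled N wt w"
    and y: "\<And>n t. 0 \<le> t \<Longrightarrow> (y n has_real_derivative y' n t) (at t within {0..})"
    and sy: "\<And>t. 0 \<le> t \<Longrightarrow> summable (\<lambda>n. (y n t)^2)"
    and M: "\<And>T. 0 \<le> T \<Longrightarrow> summable (M T)"
    and b: "\<And>T t n. 0 \<le> t \<Longrightarrow> t \<le> T \<Longrightarrow> wt n * (y' n t)^2 \<le> M T n"
    and c: "\<And>t. 0 \<le> t \<Longrightarrow> (c has_real_derivative c' t) (at t within {0..})"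
  shows "deriv_path N (\<lambda>t x. fser (\<lambda>n. y n t) x + c t * w x) (\<lambda>t x. fser (\<lambda>n. y' n t) x + c' t * w x)"
  unfolding deriv_path_def
proof (intro allI impI)
  fix s :: real assume s: "0 \<le> s"
  have wt: "1 \<le> wt n" for n using N by (simp add: controlled_def)
  have sq: "summable (\<lambda>n. (y' n t)^2)" if "0 \<le> t" for t
  proof (rule summable_comparison_test'[OF M[OF that], of 0])
    fix n
    have "1 * (y' n t)^2 \<le> wt n * (y' n t)^2" by (rule mult_right_mono[OF wt]) simp
    then show "norm ((y' n t)^2) \<le> M t n" using b[of t t n] that by simp
  qed
  let ?u = "\<lambda>t x. (fser (\<lambda>n. y n t) x - fser (\<lambda>n. y n s) x) / (t - s) - fser (\<lambda>n. y' n s) x"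
  let ?q = "\<lambda>t n. (y n t - y n s) / (t - s) - y' n s"
  let ?d = "\<lambda>t. (c t - c s) / (t - s) - c' s"
  have Lu: "L2 L (?u t)" if "0 \<le> t" for t
    by (intro L2_diff L2_divide L2_fser sy sq that s)
  have cf: "coef n (?u t) = ?q t n" if "0 \<le> t" for t n
  proof -
    have "L2 L (\<lambda>x. (fser (\<lambda>n. y n t) x - fser (\<lambda>n. y n s) x) / (t - s))"
      using fser[OF sy[OF that]] fser[OF sy[OF s]] by auto
    then show ?thesis using fser[OF sy[OF that]] fser[OF sy[OF s]] fser[OF sq[OF s]]
      by (simp add: coef_diff coef_divide L2_integrable)
  qed
  have "((\<lambda>t. N (\<lambda>x. ?u t x + ?d t * w x)) \<longlongrightarrow> 0) (at s within {0..})"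
  proof (rule controlled_tendsto_0[OF N s Lu])
    have near: "\<forall>\<^sub>F t in at s within {0..}. 0 \<le> t"
      unfolding eventually_at by (rule exI[of _ 1]) auto
    show "((\<lambda>t. coef n (?u t)) \<longlongrightarrow> 0) (at s within {0..})" for n
    proof (rule Lim_transform_eventually)
      show "((\<lambda>t. ?q t n) \<longlongrightarrow> 0) (at s within {0..})"
        using y[OF s, of n] by (simp add: has_field_derivative_iff LIM_zero_iff)
      show "\<forall>\<^sub>F t in at s within {0..}. ?q t n = coef n (?u t)"
        using near by eventually_elim (simp add: cf)
    qed
    show "(?d \<longlongrightarrow> 0) (at s within {0..})"
      using c[OF s] by (simp add: has_field_derivative_iff LIM_zero_iff)
    show "summable (\<lambda>n. 4 * M (s + 1) n)" using M[of "s+1"] s by (simp add: summable_mult)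
    fix t n assume t: "0 \<le> t" "t \<le> s + 1" "t \<noteq> s"
    \<comment> \<open>The weighted majorant of \<open>y'\<close> read as a pointwise bound, uniform
      up to time \<open>s + 1\<close>.\<close>
    let ?B = "sqrt (M (s + 1) n / wt n)"
    have wp: "0 < wt n" using wt[of n] by simp
    have B: "\<bar>y' n r\<bar> \<le> ?B" if "0 \<le> r" "r \<le> s + 1" for r
      using b[OF that, of n] wp by (intro real_le_rsqrt) (simp add: field_simps)
    have "\<bar>y n t - y n s\<bar> \<le> ?B * \<bar>t - s\<bar>"
      by (rule increment_bound_halfline[OF y B, of "s + 1"]) (use s t in auto)
    then have "\<bar>(y n t - y n s) / (t - s)\<bar> \<le> ?B" using t by (simp add: divide_simps)
    moreover have "\<bar>y' n s\<bar> \<le> ?B" using B[of s] s by simp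
    ultimately have "\<bar>?q t n\<bar> \<le> 2 * ?B" by linarith
    then have "(?q t n)^2 \<le> (2 * ?B)^2" by (metis abs_ge_zero power2_abs power_mono)
    moreover have "0 \<le> M (s + 1) n" 
      by (rule order_trans[OF _ b[of s "s+1" n]]) (use wp s in auto)
    ultimately have "(?q t n)^2 \<le> 4 * (M (s + 1) n / wt n)" using wp by (simp add: power_mult_distrib)
    then have "wt n * (?q t n)^2 \<le> 4 * M (s + 1) n" using wp by (simp add: field_simps)
    then show "wt n * (coef n (?u t))^2 \<le> 4 * M (s + 1) n" using cf[OF t(1)] by simp
  qed
  moreover have "?u t x + ?d t * w x = ((fser (\<lambda>n. y n t) x + c t * w x) - (fser (\<lambda>n. y n s) x + c s * w x)) / (t - s) - (fser (\<lambda>n. y' n s) x + c' s * w x)" for t x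
    by (simp add: diff_divide_distrib add_divide_distrib algebra_simps)
  ultimately show "((\<lambda>t. N (\<lambda>x. ((fser (\<lambda>n. y n t) x + c t * w x) - (fser (\<lambda>n. y n s) x + c s * w x)) / (t - s) - (fser (\<lambda>n. y' n s) x + c' s * w x))) \<longlongrightarrow> 0) (at s within {0..})"
    by simp
qed

section \<open>The three norms of the solution space are controlled\<close>

lemma controlled_L2norm:
  assumes w: "L2 L w"
  shows "controlled (L2norm L) (\<lambda>n. 1) w"
  unfolding controlled_def
proof (intro conjI exI[of _ "2 + 2 * (L2norm L w)^2"] allI impI)
  fix u h c assume u: "L2 L u" and h: "h = (\<lambda>x. u x + c * w x)"
  have "L2 L h" unfolding h by (intro L2_add L2_cmult u w)
  then have "(L2norm L h)^2 \<le> 2 * (L2norm L u)^2 + 2 * c^2 * (L2norm L w)^2"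
    by (rule L2norm_add_sq[OF u w, rotated]) (simp add: h)
  also have "\<dots> \<le> (2 * (L2norm L u)^2 + 2 * c^2 * (L2norm L w)^2) + (2 * (L2norm L w)^2 * (L2norm L u)^2 + 2 * c^2)"
    by simp
  also have "\<dots> = (2 + 2 * (L2norm L w)^2) * (L2norm L u)^2 + (2 + 2 * (L2norm L w)^2) * c^2"
    by (simp add: algebra_simps)
  finally show "(L2norm L h)^2 \<le> (2 + 2 * (L2norm L w)^2) * (\<Sum>n. 1 * (coef n u)^2) + (2 + 2 * (L2norm L w)^2) * c^2"
    by (simp add: parseval[OF u])
qed simp_all

lemma controlled_Hnorm:
  assumes w: "Hk L k w"
    and e: "\<And>u. L2 L u \<Longrightarrow> summable (\<lambda>n. (freq n)^m * (coef n u)^2) \<Longrightarrow>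
      Hk L k u \<and> (Hnorm L k u)^2 \<le> (2 + 2 * L^2) * (\<Sum>n. (1 + (freq n)^m) * (coef n u)^2)"
    and m: "even m"
  shows "controlled (Hnorm L k) (\<lambda>n. 1 + (freq n)^m) w"
  unfolding controlled_def
proof (intro conjI exI[of _ "4 + 4 * L^2 + 2 * (Hnorm L k w)^2"] allI impI)
  show "1 \<le> 1 + (freq n)^m" for n using m by (simp add: zero_le_even_power)
  fix u h c assume u: "L2 L u" and h: "h = (\<lambda>x. u x + c * w x)"
    and s: "summable (\<lambda>n. (1 + (freq n)^m) * (coef n u)^2)"
  let ?S = "\<Sum>n. (1 + (freq n)^m) * (coef n u)^2"
  have "summable (\<lambda>n. (1 + (freq n)^m) * (coef n u)^2 - (coef n u)^2)"
    by (rule summable_diff[OF s bessel(1)[OF u]])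
  then have "summable (\<lambda>n. (freq n)^m * (coef n u)^2)" by (simp add: algebra_simps)
  note 1 = e[OF u this]
  have S: "0 \<le> ?S" by (rule suminf_nonneg[OF s]) (use m in \<open>simp add: zero_le_even_power\<close>)
  have "L2 L h" unfolding h by (intro L2_add L2_cmult u Hk_L2[OF w])
  then have "(Hnorm L k h)^2 \<le> 2 * (Hnorm L k u)^2 + 2 * c^2 * (Hnorm L k w)^2"
    by (rule Hnorm_add_sq[OF conjunct1[OF 1] w, rotated]) (simp add: h)
  also have "\<dots> \<le> 2 * ((2 + 2 * L^2) * ?S) + 2 * c^2 * (Hnorm L k w)^2" using 1 by simp
  \<comment> \<open>Nonnegative mixed terms are added so that one constant multiplies both the
    series and \<open>c^2\<close>.\<close>
  also have "\<dots> \<le> (2 * ((2 + 2 * L^2) * ?S) + 2 * c^2 * (Hnorm L k w)^2) + (2 * (Hnorm L k w)^2 * ?S + (4 + 4 * L^2) * c^2)"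
    using S by simp
  also have "\<dots> = (4 + 4 * L^2 + 2 * (Hnorm L k w)^2) * ?S + (4 + 4 * L^2 + 2 * (Hnorm L k w)^2) * c^2"
    by (simp add: algebra_simps)
  finally show "(Hnorm L k h)^2 \<le> (4 + 4 * L^2 + 2 * (Hnorm L k w)^2) * ?S + (4 + 4 * L^2 + 2 * (Hnorm L k w)^2) * c^2" .
qed (simp add: Hnorm_nonneg)

lemma controlled_Hnorm2: "Hk L 2 w \<Longrightarrow> controlled (Hnorm L 2) (\<lambda>n. 1 + (freq n)^4) w"
  by (rule controlled_Hnorm) (use Hnorm2_le Sbar_if_coef_decay in \<open>auto simp: Sbar_def\<close>)

lemma controlled_Hnorm4: "Hk L 4 w \<Longrightarrow> controlled (Hnorm L 4) (\<lambda>n. 1 + (freq n)^8) w"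
  by (rule controlled_Hnorm) (use H4_if_coef_decay in auto)

end

subsection \<open>The damped beam equation\<close>

lemma Hk_mono:
  assumes "Hk L k f" "j \<le> k"
  shows "Hk L j f"
proof -
  obtain D where "D 0 = f" "\<forall>i\<le>k. L2 L (D i)" "\<forall>i<k. weak_deriv L (D i) (D (Suc i))"
    using assms(1) unfolding Hk_def by blast
  then show ?thesis unfolding Hk_def using assms(2) by (intro exI[of _ D]) auto
qed

locale damped_beam = bounded_interval +
  fixes hs g mu sig kappa :: real and f phi0 p0 :: "real \<Rightarrow> real"
  assumes hs: "hs > 0" and g: "g > 0" and mu: "mu > 0" and sig: "sig > 0" and kappa: "kappa \<ge> 0"
    and phi0_Sbar: "Sbar L phi0" and phi0_H4: "Hk L 4 phi0" and p0_Sbar: "Sbar L p0"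
    and f_C3: "C3_Rplus f"
    and compat: "bval L (dx L 3 phi0) 0 = - f 0 / sig" "bval L (dx L 3 phi0) L = - f 0 / sig"
begin

section \<open>Modal form of the equation, uniqueness and the zero mode\<close>

definition damp :: "nat \<Rightarrow> real" where "damp n = mu * (freq n)^2 + kappa"

definition stiff :: "nat \<Rightarrow> real" where "stiff n = g * hs * (freq n)^2 + sig * hs * (freq n)^4"

lemma damp_nonneg: "0 \<le> damp n" using mu kappa by (simp add: damp_def)

lemma stiff_nonneg: "0 \<le> stiff n" using g hs sig by (simp add: stiff_def)

lemma speed_sq: "(sqrt (g * hs))^2 = g * hs" using g hs by simp

text \<open>The factor \<open>sig\<close> of the fourth derivative cancels the
  \<open>1 / sig\<close> in the boundary condition, so the third-derivative data become the forcing
  \<open>hs * amp n * ((-1)^n - 1) * f t\<close>.\<close>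

lemma rhs_coef:
  assumes u: "Sbar L u" "Hk L 4 u" and v: "Sbar L v"
    and b: "bval L (dx L 3 u) 0 = - f t / sig" "bval L (dx L 3 u) L = - f t / sig"
  shows "L2 L (\<lambda>x. (sqrt (g * hs))^2 * dx L 2 u x - sig * hs * dx L 4 u x + mu * dx L 2 v x - kappa * v x)"
    and "coef n (\<lambda>x. (sqrt (g * hs))^2 * dx L 2 u x - sig * hs * dx L 4 u x + mu * dx L 2 v x - kappa * v x)
      = hs * amp n * ((-1)^n - 1) * f t - damp n * coef n v - stiff n * coef n u"
proof -
  have l: "L2 L (dx L 2 u)" "L2 L (dx L 4 u)" "L2 L (dx L 2 v)" "L2 L v"
    using Hk_dx(1)[OF u(2)] Hk_dx(1)[of 2 v] Hk_L2[of 2 v] v by (auto simp: Sbar_def)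
  note m = L2_cmult[OF l(1), of "(sqrt (g * hs))^2"] L2_cmult[OF l(2), of "sig * hs"] L2_cmult[OF l(3), of mu] L2_cmult[OF l(4), of kappa]
  note m1 = L2_diff[OF m(1,2)]
  note m2 = L2_add[OF m1 m(3)]
  show "L2 L (\<lambda>x. (sqrt (g * hs))^2 * dx L 2 u x - sig * hs * dx L 4 u x + mu * dx L 2 v x - kappa * v x)"
    by (rule L2_diff[OF m2 m(4)])
  have "coef n (\<lambda>x. (sqrt (g * hs))^2 * dx L 2 u x - sig * hs * dx L 4 u x + mu * dx L 2 v x - kappa * v x)
    = (sqrt (g * hs))^2 * coef n (dx L 2 u) - sig * hs * coef n (dx L 4 u) + mu * coef n (dx L 2 v) - kappa * coef n v"
    using m m1 m2 by (simp only: coef_diff coef_add coef_cmult L2_integrable)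
  also have "\<dots> = hs * amp n * ((-1)^n - 1) * f t - damp n * coef n v - stiff n * coef n u"
  proof -
    have "sig * hs * (amp n * (- f t / sig * ((-1)^n - 1))) = - (hs * amp n * ((-1)^n - 1) * f t)"
      using sig by (simp add: field_simps)
    then have E: "sig * hs * coef n (dx L 4 u) = - (hs * amp n * ((-1)^n - 1) * f t) + sig * hs * ((freq n)^4 * coef n u)"
      unfolding coef_dx4[OF u b] distrib_left by simp
    show ?thesis
      unfolding E Sbar_coef_dx2[OF u(1)] Sbar_coef_dx2[OF v] speed_sq damp_def stiff_def
      by (simp add: algebra_simps)
  qed
  finally show "coef n (\<lambda>x. (sqrt (g * hs))^2 * dx L 2 u x - sig * hs * dx L 4 u x + mu * dx L 2 v x - kappa * v x)
      = hs * amp n * ((-1)^n - 1) * f t - damp n * coef n v - stiff n * coef n u" .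
qed

text \<open>Testing the equation against the cosines leaves one scalar equation per mode. Uniqueness
  and conservation of the mean draw on a solution only through this lemma.\<close>

lemma solution_coef:
  assumes "is_solution L hs g mu sig kappa f phi0 p0 psi psit"
  shows "0 \<le> t \<Longrightarrow> ((\<lambda>t. coef n (psi t)) has_real_derivative coef n (psit t)) (at t within {0..})"
    and "0 \<le> t \<Longrightarrow> ((\<lambda>t. coef n (psit t)) has_real_derivative
       (hs * amp n * ((-1)^n - 1) * f t - damp n * coef n (psit t) - stiff n * coef n (psi t))) (at t within {0..})"
    and "coef n (psi 0) = coef n phi0" "coef n (psit 0) = coef n p0"
    and "0 \<le> t \<Longrightarrow> L2 L (psi t)" "0 \<le> t \<Longrightarrow> L2 L (psit t)"
proof -
  have S: "\<And>t. 0 \<le> t \<Longrightarrow> Sbar L (psi t) \<and> Hk L 4 (psi t)" "\<And>t. 0 \<le> t \<Longrightarrow> Sbar L (psit t)"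
    and d: "deriv_path (Hnorm L 2) psi psit"
    and i: "AE x in Iv L. psi 0 x = phi0 x" "AE x in Iv L. psit 0 x = p0 x"
    and b: "\<And>t. 0 \<le> t \<Longrightarrow> bval L (dx L 3 (psi t)) 0 = - f t / sig \<and> bval L (dx L 3 (psi t)) L = - f t / sig"
    using assms unfolding is_solution_def by auto
  obtain psitt where L: "\<And>t. 0 \<le> t \<Longrightarrow> L2 L (psitt t)" and dt: "deriv_path (L2norm L) psit psitt"
    and pde: "\<And>t. 0 \<le> t \<Longrightarrow> AE x in Iv L. psitt t x = (sqrt (g * hs))^2 * dx L 2 (psi t) x - sig * hs * dx L 4 (psi t) x
                        + mu * dx L 2 (psit t) x - kappa * psit t x"
    using assms unfolding is_solution_def by blast
  have l: "L2 L (psi t)" "L2 L (psit t)" if "0 \<le> t" for t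
    using S(1)[OF that] S(2)[OF that] Hk_L2[of 4] Hk_L2[of 2] by (auto simp: Sbar_def)
  show "0 \<le> t \<Longrightarrow> L2 L (psi t)" "0 \<le> t \<Longrightarrow> L2 L (psit t)" using l by auto
  show "0 \<le> t \<Longrightarrow> ((\<lambda>t. coef n (psi t)) has_real_derivative coef n (psit t)) (at t within {0..})"
    by (rule coef_deriv_path[OF deriv_path_L2norm[OF d] l])
  have e: "coef n (psitt t) = hs * amp n * ((-1)^n - 1) * f t - damp n * coef n (psit t) - stiff n * coef n (psi t)" if "0 \<le> t"
    using coef_cong_AE[OF pde[OF that] L2_integrable[OF L[OF that]], of n]
      rhs_coef(2)[of "psi t" "psit t" t n] S(1)[OF that] S(2)[OF that] b[OF that] by simp
  show "((\<lambda>t. coef n (psit t)) has_real_derivative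
       (hs * amp n * ((-1)^n - 1) * f t - damp n * coef n (psit t) - stiff n * coef n (psi t))) (at t within {0..})" if "0 \<le> t"
    using coef_deriv_path[OF dt l(2) L that, of n] unfolding e[OF that] .
  show "coef n (psi 0) = coef n phi0" "coef n (psit 0) = coef n p0"
    using coef_cong_AE[OF i(1) L2_integrable[OF l(1)]] coef_cong_AE[OF i(2) L2_integrable[OF l(2)]] by auto
qed

lemma solution_unique:
  assumes psi: "is_solution L hs g mu sig kappa f phi0 p0 psi psit"
    and phi: "is_solution L hs g mu sig kappa f phi0 p0 phi phit" and t: "0 \<le> t"
  shows "AE x in Iv L. psi t x = phi t x"
proof (rule AE_eq_if_coef_eq)
  note A = solution_coef[OF psi] and B = solution_coef[OF phi]
  show "integrable (Iv L) (psi t)" "integrable (Iv L) (phi t)" using A(5) B(5) t L2_integrable by auto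
  fix n
  have "coef n (psi t) - coef n (phi t) = 0"
  proof (rule mode_ode_unique(1)[of "damp n" "stiff n" "\<lambda>t. coef n (psi t) - coef n (phi t)" "\<lambda>t. coef n (psit t) - coef n (phit t)"])
    fix t :: real assume t: "0 \<le> t"
    show "((\<lambda>t. coef n (psi t) - coef n (phi t)) has_real_derivative coef n (psit t) - coef n (phit t)) (at t within {0..})"
      by (intro DERIV_diff A(1) B(1) t)
    show "((\<lambda>t. coef n (psit t) - coef n (phit t)) has_real_derivative
       - damp n * (coef n (psit t) - coef n (phit t)) - stiff n * (coef n (psi t) - coef n (phi t))) (at t within {0..})"
      by (rule DERIV_cong[OF DERIV_diff[OF A(2)[OF t] B(2)[OF t]]]) (simp add: algebra_simps)
  qed (simp_all add: A B t damp_nonneg stiff_nonneg)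
  then show "coef n (psi t) = coef n (phi t)" by simp
qed

text \<open>For \<open>n = 0\<close> the forcing factor \<open>(-1)^n - 1\<close> vanishes, the
  third derivative being equal at both ends. The zero mode thus solves a homogeneous equation with
  zero initial data.\<close>

lemma solution_mean_zero:
  assumes phi: "is_solution L hs g mu sig kappa f phi0 p0 phi phit"
    and z: "(\<integral>x. phi0 x \<partial>Iv L) = 0" "(\<integral>x. p0 x \<partial>Iv L) = 0" and t: "0 \<le> t"
  shows "(\<integral>x. phi t x \<partial>Iv L) = 0" "(\<integral>x. phit t x \<partial>Iv L) = 0"
proof -
  have c: "coef 0 u = amp 0 * (\<integral>x. u x \<partial>Iv L)" for u by (simp add: coef_def cs_def)
  note A = solution_coef[OF phi]
  have d: "((\<lambda>t. coef 0 (phit t)) has_real_derivative - damp 0 * coef 0 (phit t) - stiff 0 * coef 0 (phi t)) (at t within {0..})"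
    if "0 \<le> t" for t using A(2)[OF that, of 0] by simp
  have "coef 0 (phi t) = 0" "coef 0 (phit t) = 0"
    using mode_ode_unique[OF damp_nonneg stiff_nonneg A(1) d _ _ t] A(3,4) z by (auto simp: c)
  then show "(\<integral>x. phi t x \<partial>Iv L) = 0" "(\<integral>x. phit t x \<partial>Iv L) = 0" using amp_pos[of 0] by (auto simp: c)
qed

text \<open>Chosen so that \<open>lift' = x (L - x) / (2 sig)\<close>: zero Neumann data, third derivative
  \<open>- 1 / sig\<close> and vanishing fourth derivative.\<close>

definition lift :: "real \<Rightarrow> real" where "lift x = (3 * L * x^2 - 2 * x^3) / (12 * sig)"

text \<open>The last identity is the fourth-derivative formula for a function whose fourth
  derivative is zero: it expresses the boundary forcing through the coefficients of the
  lift.\<close>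

lemma lift_props:
  shows lift_Sbar: "Sbar L lift" and lift_H4: "Hk L 4 lift"
    and lift_bval: "bval L (dx L 3 lift) 0 = - 1 / sig" "bval L (dx L 3 lift) L = - 1 / sig"
    and lift_coef: "amp n * (- 1 / sig * ((-1)^n - 1)) + (freq n)^4 * coef n lift = 0"
proof -
  define D where "D = (\<lambda>j::nat. if j = 0 then lift else if j = 1 then (\<lambda>x. (L * x - x^2) / (2 * sig))
    else if j = 2 then (\<lambda>x. (L - 2 * x) / (2 * sig)) else if j = 3 then (\<lambda>x. - 1 / sig) else (\<lambda>x. 0))"
  have c: "continuous_on S (D j)" for S j
    unfolding D_def lift_def[abs_def] using sig by (auto intro!: continuous_intros)
  have d: "(D j has_real_derivative D (Suc j) x) (at x)" if "j < 4" for j x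
  proof -
    have "j = 0 \<or> j = 1 \<or> j = 2 \<or> j = 3" using that by auto
    then show ?thesis using sig
      by (auto simp: D_def lift_def[abs_def] field_simps power2_eq_square intro!: derivative_eq_intros)
  qed
  have w: "weak_deriv L (D j) (D (Suc j))" if "j < 4" for j
    by (rule weak_deriv_C1[OF d[OF that] c])
  have 0: "AE x in Iv L. lift x = D 0 x" by (simp add: D_def)
  have l0: "L2 L lift" using L2_continuous[OF c[of _ 0]] by (simp add: D_def)
  note ch = dx_chain[of lift D 4, OF l0 0 L2_continuous[OF c] w]
  have bv: "bval L (dx L j lift) x = D j x" if "j \<le> 4" "x \<in> {0..L}" for j x
    by (rule bval_eqI[OF c AE_symmetric that(2)]) (use ch(1)[OF _ that(1)] in auto)
  show H: "Hk L 4 lift" by (rule ch(3)) simp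
  then have "Hk L 2 lift" by (rule Hk_mono) simp
  then show S: "Sbar L lift" unfolding Sbar_def using bv[of 1] L_pos by (simp add: D_def power2_eq_square)
  show b: "bval L (dx L 3 lift) 0 = - 1 / sig" "bval L (dx L 3 lift) L = - 1 / sig"
    using bv[of 3] L_pos by (simp_all add: D_def)
  have "coef n (dx L 4 lift) = coef n (D 4)"
    using ch(1)[of 4] L2_integrable by (intro coef_cong_AE) auto
  also have "\<dots> = 0" by (simp add: D_def coef_def)
  finally show "amp n * (- 1 / sig * ((-1)^n - 1)) + (freq n)^4 * coef n lift = 0"
    using coef_dx4[OF S H b, of n] by simp
qed

end

section \<open>Bounds on a single mode, uniform over compact time intervals\<close>

lemma sum3_sq_le: "(x + y + z)^2 \<le> 3 * (x^2 + y^2 + (z::real)^2)"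
  using sum_squares_bound[of x y] sum_squares_bound[of y z] sum_squares_bound[of x z]
  by (simp add: power2_eq_square algebra_simps)

lemma sq_le_increment: "x^2 \<le> 2 * y^2 + 2 * (x - (y::real))^2"
proof -
  have "0 \<le> (x - 2 * y)^2" by simp
  then show ?thesis by (simp add: power2_eq_square algebra_simps)
qed

lemma drop_weight:
  fixes k z B :: real
  assumes "(1 + k ^ m) * z^2 \<le> B" "even m"
  shows "z^2 \<le> B"
proof -
  have "0 \<le> k ^ m * z^2" using assms(2) by (simp add: zero_le_even_power)
  then show ?thesis using assms(1) by (simp add: distrib_right)
qed

context damped_beam begin

text \<open>Collects the constants from the bounds on \<open>damp^2\<close>, \<open>stiff\<close>
  and \<open>stiff^2\<close>, so that one constant serves all three.\<close>

definition coeff_bd :: real where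
  "coeff_bd = 2 * mu^2 + 2 * kappa^2 + 4 * (g * hs)^2 + 2 * (sig * hs)^2 + g * hs + sig * hs"

lemma coeff_bd_nonneg: "0 \<le> coeff_bd"
  using hs g sig by (simp add: coeff_bd_def add_nonneg_nonneg)

lemma freq_sq_le: "(freq n)^2 \<le> 1 + (freq n)^4"
  using le_one_plus_square[of "(freq n)^2"] by (simp add: power_mult[symmetric])

lemma damp_sq_le: "(damp n)^2 \<le> coeff_bd * (1 + (freq n)^4)"
proof -
  have "(damp n)^2 \<le> 2 * (mu * (freq n)^2)^2 + 2 * kappa^2"
    using sum_squares_bound[of "mu * (freq n)^2" kappa] by (simp add: damp_def power2_sum)
  also have "\<dots> = 2 * mu^2 * (freq n)^4 + 2 * kappa^2 * 1"
    by (simp add: power_mult_distrib power_mult[symmetric])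
  also have "\<dots> \<le> coeff_bd * (freq n)^4 + coeff_bd * 1"
    by (intro add_mono mult_right_mono) (use hs g sig in \<open>simp_all add: coeff_bd_def add_nonneg_nonneg\<close>)
  finally show ?thesis by (simp add: algebra_simps)
qed

lemma stiff_le: "stiff n \<le> coeff_bd * (1 + (freq n)^4)"
proof -
  have "stiff n \<le> g * hs * (1 + (freq n)^4) + sig * hs * (1 + (freq n)^4)"
    unfolding stiff_def by (intro add_mono mult_left_mono freq_sq_le) (use hs g sig in auto)
  also have "\<dots> = (g * hs + sig * hs) * (1 + (freq n)^4)" by (simp add: algebra_simps)
  also have "\<dots> \<le> coeff_bd * (1 + (freq n)^4)"
    by (intro mult_right_mono) (simp_all add: coeff_bd_def)
  finally show ?thesis .
qed

lemma stiff_sq_le: "(stiff n)^2 \<le> coeff_bd * (1 + (freq n)^8)"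
proof -
  have k: "(freq n)^4 \<le> 1 + (freq n)^8"
    using le_one_plus_square[of "(freq n)^4"] by (simp add: power_mult[symmetric])
  have "(stiff n)^2 \<le> 2 * (g * hs * (freq n)^2)^2 + 2 * (sig * hs * (freq n)^4)^2"
    using sum_squares_bound[of "g * hs * (freq n)^2" "sig * hs * (freq n)^4"] by (simp add: stiff_def power2_sum)
  also have "\<dots> = 2 * (g * hs)^2 * (freq n)^4 + 2 * (sig * hs)^2 * (freq n)^8"
    by (simp add: power_mult_distrib power_mult[symmetric])
  also have "\<dots> \<le> 2 * (g * hs)^2 * (1 + (freq n)^8) + 2 * (sig * hs)^2 * (1 + (freq n)^8)"
    by (intro add_mono mult_left_mono k) simp_all
  also have "\<dots> = (2 * (g * hs)^2 + 2 * (sig * hs)^2) * (1 + (freq n)^8)" by (simp add: algebra_simps)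
  also have "\<dots> \<le> coeff_bd * (1 + (freq n)^8)"
    by (intro mult_right_mono) (use hs g sig in \<open>simp_all add: coeff_bd_def\<close>)
  finally show ?thesis .
qed

text \<open>Majorants for \<open>y''\<close>, \<open>y'\<close> and \<open>y\<close> in turn:
  \<open>K\<close> bounds the squared forcing and its squared derivative, \<open>P\<close> and
  \<open>A\<close> the weighted initial velocity and position. For fixed \<open>T\<close> all three
  are linear in \<open>K\<close>, \<open>P\<close>, \<open>A\<close>, so summability over the modes
  is inherited.\<close>

definition bd2 where "bd2 T K P A = exp T * (4 * K + 4 * coeff_bd * P + 3 * coeff_bd * A)"
definition bd1 where "bd1 T K P A = 2 * P + 2 * T^2 * bd2 T K P A + bd2 T K P A / (sig * hs)"
definition bd0 where "bd0 T K P A = 2 * A + 2 * T^2 * bd1 T K P A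
  + 3 * (K + coeff_bd * bd1 T K P A + bd2 T K P A) / (sig * hs)^2"

text \<open>The energy of the time derivative controls \<open>y''\<close> and \<open>y'\<close>; the equation itself then
  controls the stiffness term and thereby \<open>y\<close> with the full fourth-order weight.\<close>

lemma mode_bounds:
  fixes y y1 F F' :: "real \<Rightarrow> real" and n :: nat
  defines "y2 \<equiv> \<lambda>t. F t - damp n * y1 t - stiff n * y t"
  assumes y: "\<And>t. 0 \<le> t \<Longrightarrow> (y has_real_derivative y1 t) (at t within {0..})"
    and y1: "\<And>t. 0 \<le> t \<Longrightarrow> (y1 has_real_derivative y2 t) (at t within {0..})"
    and F: "\<And>t. 0 \<le> t \<Longrightarrow> (F has_real_derivative F' t) (at t within {0..})"
    and K: "\<And>t. 0 \<le> t \<Longrightarrow> t \<le> T \<Longrightarrow> (F t)^2 \<le> K" "\<And>t. 0 \<le> t \<Longrightarrow> t \<le> T \<Longrightarrow> (F' t)^2 \<le> K"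
    and A: "(1 + (freq n)^8) * (y 0)^2 \<le> A" and P: "(1 + (freq n)^4) * (y1 0)^2 \<le> P"
    and t: "0 \<le> t" "t \<le> T"
  shows "(y2 t)^2 \<le> bd2 T K P A"
    and "(1 + (freq n)^4) * (y1 t)^2 \<le> bd1 T K P A"
    and "(1 + (freq n)^8) * (y t)^2 \<le> bd0 T K P A"
proof -
  let ?M2 = "bd2 T K P A" and ?M1 = "bd1 T K P A"
  have T: "0 \<le> T" using t by simp
  have sh: "0 < sig * hs" using sig hs by simp
  have y2: "(y2 has_real_derivative (F' t - damp n * y2 t - stiff n * y1 t)) (at t within {0..})" if "0 \<le> t" for t
    unfolding y2_def by (intro DERIV_diff DERIV_cmult F y y1[unfolded y2_def] that)
  have K0: "0 \<le> K" using K(1)[of 0] T by (meson order_trans zero_le_power2 order_refl)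
  have scale: "X * z^2 \<le> coeff_bd * B" if "X \<le> coeff_bd * W" "W * z^2 \<le> B" for X W z B :: real
  proof -
    have "X * z^2 \<le> coeff_bd * W * z^2" using that by (intro mult_right_mono) auto
    also have "\<dots> \<le> coeff_bd * B" using that(2) coeff_bd_nonneg by (simp add: mult.assoc mult_left_mono)
    finally show ?thesis .
  qed
  \<comment> \<open>The equation at time 0 expresses \<open>y2 0\<close> through the data: damping
    costs the weight k^4 on the velocity, stiffness the weight k^8 on the position.\<close>
  have init: "(y2 0)^2 + stiff n * (y1 0)^2 + K \<le> 4 * K + 4 * coeff_bd * P + 3 * coeff_bd * A"
  proof -
    have "(y2 0)^2 \<le> 3 * ((F 0)^2 + (damp n)^2 * (y1 0)^2 + (stiff n)^2 * (y 0)^2)"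
      using sum3_sq_le[of "F 0" "- damp n * y1 0" "- stiff n * y 0"] by (simp add: y2_def power_mult_distrib)
    moreover have "(F 0)^2 \<le> K" using K(1)[of 0] T by simp
    moreover have "(damp n)^2 * (y1 0)^2 \<le> coeff_bd * P" by (rule scale[OF damp_sq_le P])
    moreover have "(stiff n)^2 * (y 0)^2 \<le> coeff_bd * A" by (rule scale[OF stiff_sq_le A])
    moreover have "stiff n * (y1 0)^2 \<le> coeff_bd * P" by (rule scale[OF stiff_le P])
    ultimately have "(y2 0)^2 + stiff n * (y1 0)^2 + K \<le> 4 * K + 4 * (coeff_bd * P) + 3 * (coeff_bd * A)"
      by (simp add: algebra_simps)
    then show ?thesis by (simp add: mult.assoc)
  qed
  have energy: "(y2 s)^2 + stiff n * (y1 s)^2 \<le> ?M2" if "0 \<le> s" "s \<le> T" for s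
  proof -
    have "(y2 s)^2 + stiff n * (y1 s)^2 \<le> exp s * ((y2 0)^2 + stiff n * (y1 0)^2 + K)"
      by (rule mode_energy[OF damp_nonneg stiff_nonneg _ y1 y2]) (use that K in auto)
    also have "\<dots> \<le> exp T * (4 * K + 4 * coeff_bd * P + 3 * coeff_bd * A)"
      by (rule mult_mono[OF _ init]) (use that K0 stiff_nonneg in auto)
    finally show ?thesis by (simp add: bd2_def)
  qed
  have M2: "(y2 s)^2 \<le> ?M2" if "0 \<le> s" "s \<le> T" for s
  proof -
    have "0 \<le> stiff n * (y1 s)^2" using stiff_nonneg by simp
    then show ?thesis using energy[OF that] by linarith
  qed
  have M20: "0 \<le> ?M2" using M2[OF t] by (meson order_trans zero_le_power2)
  \<comment> \<open>The stiffness energy gives the k^4 part, but nothing for mode 0; the unweighted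
    part comes from integrating the bound on \<open>y2\<close> in time.\<close>
  have M1: "(1 + (freq n)^4) * (y1 s)^2 \<le> ?M1" if "0 \<le> s" "s \<le> T" for s
  proof -
    have "\<bar>y1 s - y1 0\<bar> \<le> sqrt ?M2 * \<bar>s - 0\<bar>"
      by (rule increment_bound_halfline[OF y1, of T]) (use that T M2 in \<open>auto intro: real_le_rsqrt\<close>)
    also have "\<dots> \<le> sqrt ?M2 * T" using that M20 by (intro mult_left_mono) auto
    finally have "(y1 s - y1 0)^2 \<le> (sqrt ?M2 * T)^2" by (metis abs_ge_zero power2_abs power_mono)
    then have "(y1 s - y1 0)^2 \<le> T^2 * ?M2" using M20 by (simp add: power_mult_distrib mult.commute)
    moreover have "(y1 0)^2 \<le> P" by (rule drop_weight[OF P]) simp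
    ultimately have 1: "(y1 s)^2 \<le> 2 * P + 2 * T^2 * ?M2" using sq_le_increment[of "y1 s" "y1 0"] by linarith
    have "sig * hs * (freq n)^4 * (y1 s)^2 \<le> stiff n * (y1 s)^2"
      using g hs by (intro mult_right_mono) (auto simp: stiff_def)
    also have "\<dots> \<le> ?M2" using energy[OF that] zero_le_power2[of "y2 s"] by linarith
    finally have "(freq n)^4 * (y1 s)^2 \<le> ?M2 / (sig * hs)" using sh by (simp add: field_simps)
    then show ?thesis using 1 by (simp add: bd1_def distrib_right)
  qed
  have y1_le: "(y1 s)^2 \<le> ?M1" if "0 \<le> s" "s \<le> T" for s
    by (rule drop_weight[OF M1[OF that]]) simp
  have M10: "0 \<le> ?M1" using y1_le[OF t] by (meson order_trans zero_le_power2)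
  have "(1 + (freq n)^8) * (y t)^2 \<le> bd0 T K P A"
  proof -
    have "\<bar>y t - y 0\<bar> \<le> sqrt ?M1 * \<bar>t - 0\<bar>"
      by (rule increment_bound_halfline[OF y, of T]) (use t T y1_le in \<open>auto intro: real_le_rsqrt\<close>)
    also have "\<dots> \<le> sqrt ?M1 * T" using t M10 by (intro mult_left_mono) auto
    finally have "(y t - y 0)^2 \<le> (sqrt ?M1 * T)^2" by (metis abs_ge_zero power2_abs power_mono)
    then have "(y t - y 0)^2 \<le> T^2 * ?M1" using M10 by (simp add: power_mult_distrib mult.commute)
    moreover have "(y 0)^2 \<le> A" by (rule drop_weight[OF A]) simp
    ultimately have 1: "(y t)^2 \<le> 2 * A + 2 * T^2 * ?M1" using sq_le_increment[of "y t" "y 0"] by linarith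
    have "(sig * hs)^2 * (freq n)^8 = (sig * hs * (freq n)^4)^2"
      by (simp add: power_mult_distrib power_mult[symmetric])
    also have "\<dots> \<le> (stiff n)^2" using g hs sig by (intro power_mono) (auto simp: stiff_def)
    finally have "(sig * hs)^2 * (freq n)^8 * (y t)^2 \<le> (stiff n)^2 * (y t)^2" by (rule mult_right_mono) simp
    \<comment> \<open>The equation is solved for the stiffness term. The damping term is of order
      k^2 \<open>y1\<close>, just what the weighted bound on \<open>y1\<close> covers.\<close>
    also have "\<dots> = (F t + - damp n * y1 t + - y2 t)^2" by (simp add: y2_def power_mult_distrib)
    also have "\<dots> \<le> 3 * ((F t)^2 + (- damp n * y1 t)^2 + (- y2 t)^2)" by (rule sum3_sq_le)
    also have "\<dots> = 3 * ((F t)^2 + (damp n)^2 * (y1 t)^2 + (y2 t)^2)" by (simp add: power_mult_distrib)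
    also have "\<dots> \<le> 3 * (K + coeff_bd * ?M1 + ?M2)"
      using K(1)[OF t] M2[OF t] scale[OF damp_sq_le M1[OF t]] by simp
    finally have 2: "(sig * hs)^2 * (freq n)^8 * (y t)^2 \<le> 3 * (K + coeff_bd * ?M1 + ?M2)" .
    have "0 < (sig * hs)^2" using sh by (rule zero_less_power)
    then have "(freq n)^8 * (y t)^2 \<le> 3 * (K + coeff_bd * ?M1 + ?M2) / (sig * hs)^2"
      using 2 by (simp only: pos_le_divide_eq ac_simps)
    then show ?thesis using 1 by (simp add: bd0_def distrib_right)
  qed
  then show "(1 + (freq n)^8) * (y t)^2 \<le> bd0 T K P A" .
  show "(y2 t)^2 \<le> bd2 T K P A" by (rule M2[OF t])
  show "(1 + (freq n)^4) * (y1 t)^2 \<le> bd1 T K P A" by (rule M1[OF t])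
qed

lemma summable_bds:
  assumes "summable K" "summable P" "summable A"
  shows "summable (\<lambda>n. bd2 T (K n) (P n) (A n))" "summable (\<lambda>n. bd1 T (K n) (P n) (A n))"
    "summable (\<lambda>n. bd0 T (K n) (P n) (A n))"
proof -
  show 2: "summable (\<lambda>n. bd2 T (K n) (P n) (A n))" unfolding bd2_def
    by (intro summable_add summable_mult assms)
  show 1: "summable (\<lambda>n. bd1 T (K n) (P n) (A n))" unfolding bd1_def
    by (intro summable_add summable_mult summable_divide assms 2)
  show "summable (\<lambda>n. bd0 T (K n) (P n) (A n))" unfolding bd0_def
    by (intro summable_add summable_mult summable_divide assms 2 1)
qed

lemma bounded_on_compact_interval:
  assumes "\<And>t. 0 \<le> t \<Longrightarrow> continuous (at t within {0..}) (h :: real \<Rightarrow> real)"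
  obtains B where "0 \<le> B" "\<And>t. 0 \<le> t \<Longrightarrow> t \<le> T \<Longrightarrow> \<bar>h t\<bar> \<le> B"
proof -
  have "continuous_on {0..T} h"
    unfolding continuous_on_eq_continuous_within
    by (intro ballI continuous_within_subset[OF assms, of _ "{0..T}"]) auto
  then have "bounded (h ` {0..T})" by (intro compact_imp_bounded compact_continuous_image) auto
  then obtain B where B: "\<And>t. t \<in> {0..T} \<Longrightarrow> norm (h t) \<le> B" unfolding bounded_iff by blast
  show ?thesis
  proof (rule that[of "\<bar>B\<bar>"])
    show "\<bar>h t\<bar> \<le> \<bar>B\<bar>" if "0 \<le> t" "t \<le> T" for t using B[of t] that by simp
  qed simp
qed

end

lemma summable_weighted_sq:
  fixes w z M :: "nat \<Rightarrow> real"
  assumes M: "summable M" and w: "\<And>n. 0 \<le> w n" and b: "\<And>n. (1 + w n) * (z n)^2 \<le> M n"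
  shows "summable (\<lambda>n. (z n)^2)" "summable (\<lambda>n. w n * (z n)^2)"
proof -
  have "(z n)^2 \<le> M n" "w n * (z n)^2 \<le> M n" for n
  proof -
    have "(z n)^2 + w n * (z n)^2 \<le> M n" using b[of n] by (simp add: distrib_right)
    moreover have "0 \<le> w n * (z n)^2" using w by simp
    moreover have "0 \<le> (z n)^2" by (rule zero_le_power2)
    ultimately show "(z n)^2 \<le> M n" "w n * (z n)^2 \<le> M n" by linarith+
  qed
  then show "summable (\<lambda>n. (z n)^2)" "summable (\<lambda>n. w n * (z n)^2)"
    by (auto intro!: summable_comparison_test'[OF M, of 0] simp: w)
qed

context damped_beam begin

section \<open>Existence\<close>

lemma coef_lift_dx2: "coef n (dx L 2 lift) = - ((freq n)^2) * coef n lift"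
  by (rule Sbar_coef_dx2[OF lift_Sbar])

text \<open>Compatibility at time 0: subtracting \<open>f 0 * lift\<close> cancels the boundary term
  of \<open>coef_dx4\<close>, so k^4 times the remaining coefficient is that of the fourth
  derivative of \<open>phi0\<close>, to which Bessel applies.\<close>

lemma initial_position_decay:
  "summable (\<lambda>n. (1 + (freq n)^8) * (coef n phi0 - f 0 * coef n lift)^2)"
proof -
  have L: "L2 L (\<lambda>x. phi0 x - f 0 * lift x)"
    using Hk_L2[OF phi0_H4] Hk_L2[OF lift_H4] by auto
  have c: "coef n (\<lambda>x. phi0 x - f 0 * lift x) = coef n phi0 - f 0 * coef n lift" for n
    using Hk_L2[OF phi0_H4] Hk_L2[OF lift_H4] by (simp add: coef_diff coef_cmult L2_integrable L2_cmult)
  have "(freq n)^4 * (coef n phi0 - f 0 * coef n lift) = coef n (dx L 4 phi0)" for n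
  proof -
    have "f 0 * (amp n * (- 1 / sig * ((-1)^n - 1)) + (freq n)^4 * coef n lift) = 0" using lift_coef[of n] by simp
    then show ?thesis using coef_dx4[OF phi0_Sbar phi0_H4 compat, of n] by (simp add: algebra_simps)
  qed
  then have "((freq n)^4 * (coef n phi0 - f 0 * coef n lift))^2 = (coef n (dx L 4 phi0))^2" for n by simp
  then have "(coef n (dx L 4 phi0))^2 = (freq n)^8 * (coef n phi0 - f 0 * coef n lift)^2" for n
    by (simp add: power_mult_distrib power_mult[symmetric])
  then show ?thesis
    using summable_add[OF bessel(1)[OF L] bessel(1)[OF Hk_dx(1)[OF phi0_H4, of 4]]] by (simp add: c distrib_right)
qed

text \<open>Both functions have zero Neumann data, so any multiple of the lift may be subtracted;
  the multiple used is f'(0).\<close>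

lemma initial_velocity_decay:
  "summable (\<lambda>n. (1 + (freq n)^4) * (coef n p0 - c * coef n lift)^2)"
proof -
  have p0: "Hk L 2 p0" and li: "Hk L 2 lift" using p0_Sbar lift_Sbar by (auto simp: Sbar_def)
  have L: "L2 L (\<lambda>x. p0 x - c * lift x)" "L2 L (\<lambda>x. dx L 2 p0 x - c * dx L 2 lift x)"
    using Hk_L2[OF p0] Hk_L2[OF li] Hk_dx(1)[OF p0, of 2] Hk_dx(1)[OF li, of 2] by auto
  have c: "coef n (\<lambda>x. p0 x - c * lift x) = coef n p0 - c * coef n lift" for n
    using Hk_L2[OF p0] Hk_L2[OF li] by (simp add: coef_diff coef_cmult L2_integrable L2_cmult)
  have "coef n (\<lambda>x. dx L 2 p0 x - c * dx L 2 lift x) = - ((freq n)^2) * (coef n p0 - c * coef n lift)" for n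
    using Hk_dx(1)[OF p0, of 2] Hk_dx(1)[OF li, of 2]
    by (simp add: coef_diff coef_cmult L2_integrable L2_cmult coef_lift_dx2 Sbar_coef_dx2[OF p0_Sbar] algebra_simps)
  then have "(coef n (\<lambda>x. dx L 2 p0 x - c * dx L 2 lift x))^2 = (freq n)^4 * (coef n p0 - c * coef n lift)^2" for n
    by (simp add: power_mult_distrib power_mult[symmetric])
  then show ?thesis
    using summable_add[OF bessel(1)[OF L(1)] bessel(1)[OF L(2)]] by (simp add: c distrib_right)
qed

lemma solution_exists:
  "\<exists>phi phit. is_solution L hs g mu sig kappa f phi0 p0 phi phit"
proof -
  obtain f1 f2 f3 where f: "\<And>t. 0 \<le> t \<Longrightarrow> (f has_real_derivative f1 t) (at t within {0..})"
    and f1: "\<And>t. 0 \<le> t \<Longrightarrow> (f1 has_real_derivative f2 t) (at t within {0..})"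
    and f2: "\<And>t. 0 \<le> t \<Longrightarrow> (f2 has_real_derivative f3 t) (at t within {0..})"
    and f3: "\<And>t. 0 \<le> t \<Longrightarrow> continuous (at t within {0..}) f3"
    using f_C3 unfolding C3_Rplus_def by blast
  note cont = DERIV_continuous[OF f] DERIV_continuous[OF f1] DERIV_continuous[OF f2] f3
  define wc where "wc = (\<lambda>n. coef n lift)"
  define vc where "vc = (\<lambda>n. coef n (dx L 2 lift))"
  \<comment> \<open>Inserting f w into the equation leaves the residual - (f'' + kappa f') w + (c^2
    f + mu f') w'', as w'''' = 0. \<open>al\<close> and \<open>be\<close> are its time factors,
    \<open>wc\<close> and \<open>vc\<close> the coefficients of w and w''.\<close>
  define al where "al = (\<lambda>t. - (f2 t + kappa * f1 t))"
  define be where "be = (\<lambda>t. g * hs * f t + mu * f1 t)"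
  define al' where "al' = (\<lambda>t. - (f3 t + kappa * f2 t))"
  define be' where "be' = (\<lambda>t. g * hs * f1 t + mu * f2 t)"
  define F where "F = (\<lambda>n t. al t * wc n + be t * vc n)"
  define F' where "F' = (\<lambda>n t. al' t * wc n + be' t * vc n)"
  have dF: "(F n has_real_derivative F' n t) (at t within {0..})" if "0 \<le> t" for n t
    unfolding F_def F'_def al_def be_def al'_def be'_def
    by (auto intro!: derivative_eq_intros f[OF that] f1[OF that] f2[OF that] simp: algebra_simps)
  have cF: "continuous_on {0..} (F n)" for n
    unfolding continuous_on_eq_continuous_within using DERIV_continuous[OF dF] by auto
  define a where "a = (\<lambda>n. coef n phi0 - f 0 * wc n)"
  define p where "p = (\<lambda>n. coef n p0 - f1 0 * wc n)"
  have "\<forall>n. \<exists>y y1. y 0 = a n \<and> y1 0 = p n \<and>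
      (\<forall>t\<ge>0. (y has_real_derivative y1 t) (at t within {0..})) \<and>
      (\<forall>t\<ge>0. (y1 has_real_derivative (F n t - damp n * y1 t - stiff n * y t)) (at t within {0..}))"
    using mode_ode_exists[OF cF] by metis
  then obtain y y1 where y0: "\<And>n. y n 0 = a n" and y10: "\<And>n. y1 n 0 = p n"
    and dy: "\<And>n t. 0 \<le> t \<Longrightarrow> (y n has_real_derivative y1 n t) (at t within {0..})"
    and dy1: "\<And>n t. 0 \<le> t \<Longrightarrow> (y1 n has_real_derivative (F n t - damp n * y1 n t - stiff n * y n t)) (at t within {0..})"
    by metis
  define y2 where "y2 = (\<lambda>n t. F n t - damp n * y1 n t - stiff n * y n t)"
  have dy1': "(y1 n has_real_derivative y2 n t) (at t within {0..})" if "0 \<le> t" for n t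
    using dy1[OF that] by (simp add: y2_def)
  have cy2: "continuous (at t within {0..}) (y2 n)" if "0 \<le> t" for n t
    unfolding y2_def
    by (intro continuous_intros DERIV_continuous[OF dF] DERIV_continuous[OF dy] DERIV_continuous[OF dy1] that)

  define A where "A = (\<lambda>n. (1 + (freq n)^8) * (a n)^2)"
  define P where "P = (\<lambda>n. (1 + (freq n)^4) * (p n)^2)"
  \<comment> \<open>The spatial profile of the forcing: Bessel makes it summable, whereas the time
    factors are bounded uniformly in \<open>n\<close>.\<close>
  define q where "q = (\<lambda>n. (wc n)^2 + (vc n)^2)"
  have sA: "summable A" unfolding A_def a_def wc_def by (rule initial_position_decay)
  have sP: "summable P" unfolding P_def p_def wc_def by (rule initial_velocity_decay)
  have sq: "summable q" unfolding q_def wc_def vc_def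
    by (intro summable_add bessel Hk_L2[OF lift_H4] Hk_dx(1)[OF lift_H4]) simp
  have "\<exists>B\<ge>0. \<forall>t. 0 \<le> t \<longrightarrow> t \<le> T \<longrightarrow> \<bar>al t\<bar> \<le> B \<and> \<bar>be t\<bar> \<le> B \<and> \<bar>al' t\<bar> \<le> B \<and> \<bar>be' t\<bar> \<le> B" for T
  proof -
    \<comment> \<open>Bounding the sum of the absolute values gives one bound for all four time
      factors. Here the third derivative of \<open>f\<close> enters, through
      \<open>al'\<close>.\<close>
    have "continuous (at t within {0..}) (\<lambda>t. \<bar>al t\<bar> + \<bar>be t\<bar> + \<bar>al' t\<bar> + \<bar>be' t\<bar>)" if "0 \<le> t" for t
      unfolding al_def be_def al'_def be'_def by (intro continuous_intros cont that)
    from bounded_on_compact_interval[OF this, of T]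
    obtain B where "0 \<le> B" "\<And>t. 0 \<le> t \<Longrightarrow> t \<le> T \<Longrightarrow> \<bar>\<bar>al t\<bar> + \<bar>be t\<bar> + \<bar>al' t\<bar> + \<bar>be' t\<bar>\<bar> \<le> B" by blast
    then show ?thesis by (intro exI[of _ B]) fastforce
  qed
  then obtain B where B0: "\<And>T. 0 \<le> B T" and B: "\<And>T t. 0 \<le> t \<Longrightarrow> t \<le> T \<Longrightarrow>
      \<bar>al t\<bar> \<le> B T \<and> \<bar>be t\<bar> \<le> B T \<and> \<bar>al' t\<bar> \<le> B T \<and> \<bar>be' t\<bar> \<le> B T" by metis
  define K where "K = (\<lambda>T n. 2 * (B T)^2 * q n)"
  have sK: "summable (K T)" for T unfolding K_def by (intro summable_mult sq)
  have comb: "(r * v + s * w)^2 \<le> 2 * b^2 * (v^2 + w^2)" if "\<bar>r\<bar> \<le> b" "\<bar>s\<bar> \<le> b" for r s v w b :: real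
  proof -
    have "(r * v + s * w)^2 \<le> 2 * (r * v)^2 + 2 * (s * w)^2"
      using sum_squares_bound[of "r * v" "s * w"] unfolding power2_sum by linarith
    moreover have "r^2 \<le> b^2" "s^2 \<le> b^2" using that by (metis abs_ge_zero power2_abs power_mono)+
    then have "(r * v)^2 \<le> b^2 * v^2" "(s * w)^2 \<le> b^2 * w^2"
      unfolding power_mult_distrib by (auto intro: mult_right_mono)
    ultimately show ?thesis by (simp add: distrib_left)
  qed
  have KF: "(F n t)^2 \<le> K T n" "(F' n t)^2 \<le> K T n" if "0 \<le> t" "t \<le> T" for n t T
    unfolding F_def F'_def K_def q_def using comb B[OF that] by blast+
  define M2 where "M2 = (\<lambda>T n. bd2 T (K T n) (P n) (A n))"
  define M1 where "M1 = (\<lambda>T n. bd1 T (K T n) (P n) (A n))"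
  define M0 where "M0 = (\<lambda>T n. bd0 T (K T n) (P n) (A n))"
  have sM: "summable (M2 T)" "summable (M1 T)" "summable (M0 T)" for T
    unfolding M2_def M1_def M0_def by (rule summable_bds[OF sK sP sA])+
  have b2: "1 * (y2 n t)^2 \<le> M2 T n" and b1: "(1 + (freq n)^4) * (y1 n t)^2 \<le> M1 T n"
    and b0: "(1 + (freq n)^8) * (y n t)^2 \<le> M0 T n" if t: "0 \<le> t" "t \<le> T" for n t T
  proof -
    have A': "(1 + (freq n)^8) * (y n 0)^2 \<le> A n" and P': "(1 + (freq n)^4) * (y1 n 0)^2 \<le> P n"
      by (simp_all add: A_def P_def y0 y10)
    have "(y2 n t)^2 \<le> M2 T n" unfolding M2_def y2_def
      by (rule mode_bounds(1)[where y="y n" and F'="F' n"]) (assumption | rule dy dy1 dF KF A' P' t)+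
    then show "1 * (y2 n t)^2 \<le> M2 T n" by simp
    show "(1 + (freq n)^4) * (y1 n t)^2 \<le> M1 T n" unfolding M1_def
      by (rule mode_bounds(2)[where y="y n" and F'="F' n"]) (assumption | rule dy dy1 dF KF A' P' t)+
    show "(1 + (freq n)^8) * (y n t)^2 \<le> M0 T n" unfolding M0_def
      by (rule mode_bounds(3)[where y="y n" and F'="F' n"]) (assumption | rule dy dy1 dF KF A' P' t)+
  qed
  have s0: "summable (\<lambda>n. (y n t)^2)" "summable (\<lambda>n. (freq n)^8 * (y n t)^2)" if "0 \<le> t" for t
    by (rule summable_weighted_sq[OF sM(3) _ b0[OF that order_refl]]; simp)+
  have s1: "summable (\<lambda>n. (y1 n t)^2)" "summable (\<lambda>n. (freq n)^4 * (y1 n t)^2)" if "0 \<le> t" for t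
    by (rule summable_weighted_sq[OF sM(2) _ b1[OF that order_refl]]; simp)+
  have s2: "summable (\<lambda>n. (y2 n t)^2)" if "0 \<le> t" for t
    by (rule summable_comparison_test'[OF sM(1)[of t], of 0]) (use b2[OF that order_refl] in simp)

  define phi where "phi = (\<lambda>t x. fser (\<lambda>n. y n t) x + f t * lift x)"
  define phit where "phit = (\<lambda>t x. fser (\<lambda>n. y1 n t) x + f1 t * lift x)"
  define phitt where "phitt = (\<lambda>t x. fser (\<lambda>n. y2 n t) x + f2 t * lift x)"
  have H2: "Hk L 2 lift" using lift_Sbar by (simp add: Sbar_def)
  have Ll: "L2 L lift" by (rule Hk_L2[OF H2])
  note c4 = controlled_Hnorm4[OF lift_H4] and c2 = controlled_Hnorm2[OF H2] and c0 = controlled_L2norm[OF Ll]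
  have cont_phi: "cont_path (Hnorm L 4) phi" unfolding phi_def
    by (rule cont_path_fser[OF c4 DERIV_continuous[OF dy] sM(3) b0 cont(1)])
  have cont_phit: "cont_path (Hnorm L 2) phit" unfolding phit_def
    by (rule cont_path_fser[OF c2 DERIV_continuous[OF dy1] sM(2) b1 cont(2)])
  have cont_phitt: "cont_path (L2norm L) phitt" unfolding phitt_def
    by (rule cont_path_fser[OF c0 cy2 sM(1) b2 cont(3)])
  have deriv_phi: "deriv_path (Hnorm L 2) phi phit" unfolding phi_def phit_def
    by (rule deriv_path_fser[OF c2 dy s0(1) sM(2) b1 f])
  have deriv_phit: "deriv_path (L2norm L) phit phitt" unfolding phit_def phitt_def
    by (rule deriv_path_fser[OF c0 dy1' s1(1) sM(1) b2 f1])

  have L_phi: "L2 L (phi t)" "L2 L (phit t)" "L2 L (phitt t)" if "0 \<le> t" for t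
    unfolding phi_def phit_def phitt_def using that
    by (intro L2_add L2_fser L2_cmult Ll s0 s1 s2; assumption)+
  have coefs: "coef n (phi t) = y n t + f t * wc n" "coef n (phit t) = y1 n t + f1 t * wc n"
     "coef n (phitt t) = y2 n t + f2 t * wc n" if "0 \<le> t" for n t
    unfolding phi_def phit_def phitt_def wc_def
    using fser[OF s0(1)[OF that]] fser[OF s1(1)[OF that]] fser[OF s2[OF that]] Ll
    by (simp_all add: coef_add coef_cmult L2_integrable L2_cmult)

  have phi_H4: "Hk L 4 (phi t)" and phi_Sbar: "Sbar L (phi t)"
    and phi_b: "bval L (dx L 3 (phi t)) 0 = - f t / sig" "bval L (dx L 3 (phi t)) L = - f t / sig" if t: "0 \<le> t" for t
  proof -
    let ?u = "fser (\<lambda>n. y n t)"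
    have u: "L2 L ?u" "summable (\<lambda>n. (freq n)^8 * (coef n ?u)^2)"
      using fser[OF s0(1)[OF t]] s0(2)[OF t] by simp_all
    note H = H4_if_coef_decay[OF u]
    have e: "AE x in Iv L. phi t x = ?u x + f t * lift x" by (simp add: phi_def)
    note l = dx_lincomb[OF H(2) lift_H4 L_phi(1)[OF t] e]
    show H4: "Hk L 4 (phi t)" by (rule l(1))
    have "Hk L 2 (phi t)" by (rule Hk_mono[OF H4]) simp
    then show "Sbar L (phi t)" unfolding Sbar_def
      using l(3)[of 1 0] l(3)[of 1 L] H(1) lift_Sbar by (simp add: Sbar_def)
    show "bval L (dx L 3 (phi t)) 0 = - f t / sig" "bval L (dx L 3 (phi t)) L = - f t / sig"
      using l(3)[of 3 0] l(3)[of 3 L] H(3,4) lift_bval by simp_all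
  qed
  have phit_Sbar: "Sbar L (phit t)" if t: "0 \<le> t" for t
  proof -
    let ?u = "fser (\<lambda>n. y1 n t)"
    have u: "L2 L ?u" "summable (\<lambda>n. (freq n)^4 * (coef n ?u)^2)"
      using fser[OF s1(1)[OF t]] s1(2)[OF t] by simp_all
    have S: "Sbar L ?u" by (rule Sbar_if_coef_decay[OF u])
    then have H: "Hk L 2 ?u" by (simp add: Sbar_def)
    have e: "AE x in Iv L. phit t x = ?u x + f1 t * lift x" by (simp add: phit_def)
    note l = dx_lincomb[OF H H2 L_phi(2)[OF t] e]
    show ?thesis unfolding Sbar_def
      using l(1) l(3)[of 1 0] l(3)[of 1 L] S lift_Sbar by (simp add: Sbar_def)
  qed

  have pde: "AE x in Iv L. phitt t x = (sqrt (g * hs))^2 * dx L 2 (phi t) x - sig * hs * dx L 4 (phi t) x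
      + mu * dx L 2 (phit t) x - kappa * phit t x" if t: "0 \<le> t" for t
  proof (rule AE_eq_if_coef_eq)
    note R = rhs_coef[OF phi_Sbar[OF t] phi_H4[OF t] phit_Sbar[OF t] phi_b[OF t]]
    show "integrable (Iv L) (phitt t)" by (rule L2_integrable[OF L_phi(3)[OF t]])
    show "integrable (Iv L) (\<lambda>x. (sqrt (g * hs))^2 * dx L 2 (phi t) x - sig * hs * dx L 4 (phi t) x
      + mu * dx L 2 (phit t) x - kappa * phit t x)" by (rule L2_integrable[OF R(1)])
    fix n
    \<comment> \<open>By \<open>lift_coef\<close> the boundary forcing equals the fourth-order
      stiffness contributed by \<open>f t * lift\<close>, so the two cancel; the second-order
      stiffness of the lift is matched by \<open>be\<close>.\<close>
    have "amp n * ((-1)^n - 1) = sig * ((freq n)^4 * wc n)"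
      using lift_coef[of n] sig by (simp add: wc_def field_simps)
    then have w: "hs * amp n * ((-1)^n - 1) * f t = sig * hs * (freq n)^4 * wc n * f t"
      by (simp add: mult.assoc)
    have v: "vc n = - ((freq n)^2) * wc n" by (simp add: vc_def wc_def coef_lift_dx2)
    show "coef n (phitt t) = coef n (\<lambda>x. (sqrt (g * hs))^2 * dx L 2 (phi t) x - sig * hs * dx L 4 (phi t) x
      + mu * dx L 2 (phit t) x - kappa * phit t x)"
      unfolding R(2) coefs[OF t] w y2_def F_def v al_def be_def damp_def stiff_def
      by (simp add: algebra_simps)
  qed

  have init: "AE x in Iv L. phi 0 x = phi0 x" "AE x in Iv L. phit 0 x = p0 x"
  proof -
    show "AE x in Iv L. phi 0 x = phi0 x"
      by (rule AE_eq_if_coef_eq)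
         (use L_phi(1)[of 0] Hk_L2[OF phi0_H4] L2_integrable coefs(1)[of 0] in \<open>auto simp: y0 a_def\<close>)
    have "L2 L p0" using p0_Sbar Hk_L2 by (auto simp: Sbar_def)
    then show "AE x in Iv L. phit 0 x = p0 x"
      by (intro AE_eq_if_coef_eq)
         (use L_phi(2)[of 0] L2_integrable coefs(2)[of 0] in \<open>auto simp: y10 p_def\<close>)
  qed

  have bx: "bval L (dx L 1 (phi t)) 0 = 0" "bval L (dx L 1 (phi t)) L = 0" if "0 \<le> t" for t
    using phi_Sbar[OF that] by (auto simp: Sbar_def)
  have "is_solution L hs g mu sig kappa f phi0 p0 phi phit"
    unfolding is_solution_def
    by (intro conjI allI impI exI[of _ phitt] phi_Sbar phi_H4 cont_phi phit_Sbar deriv_phi cont_phit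
        L_phi(3) deriv_phit cont_phitt pde init bx phi_b) assumption+
  then show ?thesis by blast
qed

end

theorem theorem4:
  fixes L hs g mu sig kappa :: real and f phi0 p0 :: "real \<Rightarrow> real"
  assumes "L > 0" "hs > 0" "g > 0" "mu > 0" "sig > 0" "kappa \<ge> 0"
    and "Sbar L phi0" "Hk L 4 phi0" "Sbar L p0" "C3_Rplus f"
    and "bval L (dx L 3 phi0) 0 = - f 0 / sig" "bval L (dx L 3 phi0) L = - f 0 / sig"
  shows "\<exists>phi phit. is_solution L hs g mu sig kappa f phi0 p0 phi phit \<and>
           (\<forall>psi psit. is_solution L hs g mu sig kappa f phi0 p0 psi psit \<longrightarrow>
              (\<forall>t\<ge>0. AE x in Iv L. psi t x = phi t x)) \<and>
           ((\<integral>x. phi0 x \<partial>Iv L) = 0 \<and> (\<integral>x. p0 x \<partial>Iv L) = 0 \<longrightarrow>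
              (\<forall>t\<ge>0. (\<integral>x. phi t x \<partial>Iv L) = 0 \<and> (\<integral>x. phit t x \<partial>Iv L) = 0))"
proof -
  interpret damped_beam L hs g mu sig kappa f phi0 p0
    by unfold_locales (use assms in auto)
  obtain phi phit where "is_solution L hs g mu sig kappa f phi0 p0 phi phit"
    using solution_exists by blast
  then show ?thesis
    using solution_unique solution_mean_zero by (intro exI[of _ phi] exI[of _ phit]) simp
qed

end
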